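(* Let $G$ be a locally profinite group, $Z$ a closed central subgroup of $G$, $C$ a field, and $\mathfrak X$ a set of $C$-types in $G$. Let $\mathfrak X'$ be the set of $C$-types $(J',V')$ where, for $(J,V)\in\mathfrak X$, $J'$ is the $G$-normalizer of $J$ and $V'$ is the isomorphism class of $\operatorname{ind}_J^{J'}V$. Let $\mathcal Z$ be a set of isomorphism classes of irreducible $Z$-compact smooth $C$-representations of $G$, and $H\subset\operatorname{Aut}(C)$ a subgroup. If $\mathfrak X$ satisfies intertwining (resp. unicity, resp. $\mathcal Z$-exhaustion, resp. $H$-stability), then so does $\mathfrak X'$. If $\mathfrak X$ satisfies unicity and $H$-stability, then $\mathfrak X'$ satisfies $H$-unicity.
   Context: $\operatorname{ind}_J^G$ denotes compact induction of smooth representations from an open subgroup $J$. A $C$-type in $G$ is a pair $(J,V)$ with $J\subset G$ an open subgroup and $V$ an isomorphism class of irreducible smooth $C$-representations of $J$ such that $\operatorname{ind}_J^GV$ is irreducible. A smooth $C$-representation $W$ of $G$ is $Z$-compact if for all small enough compact open subgroups $K\subset G$ (of pro-order invertible in $C$, whose existence is assumed when this notion is used) and all $w\in W$ the support of $g\mapsto e_Kgw$ is compact modulo $Z$, where $e_K$ is the projector onto $K$-invariants given by averaging over $K$. $\mathfrak X$ satisfies: intertwining if for each $(J,V)\in\mathfrak X$ the natural injection $\operatorname{End}_{C[J]}(V)\to\operatorname{End}_{C[G]}(\operatorname{ind}_J^GV)$ is an isomorphism; unicity if $\operatorname{ind}_J^GV\simeq\operatorname{ind}_{J_1}^GV_1$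 with $(J,V),(J_1,V_1)\in\mathfrak X$ implies that some $g\in G$ conjugates $(J,V)$ to $(J_1,V_1)$; $\mathcal Z$-exhaustion if for $(J,V)\in\mathfrak X$ the class of $\operatorname{ind}_J^GV$ is in $\mathcal Z$ and any element of $\mathcal Z$ has that form; $H$-stability if $(J,\sigma(V))\in\mathfrak X$ for all $(J,V)\in\mathfrak X$ and $\sigma\in H$, where $\sigma(V)=C\otimes_{\sigma,C}V$; $H$-unicity if it is $H$-stable and for $(J,V)\in\mathfrak X$, $\sigma\in H$, $\operatorname{ind}_J^GV\simeq\operatorname{ind}_J^G\sigma(V)$ implies $V\simeq\sigma(V)$. *)

theory Defs
  imports "HOL-Analysis.Analysis" "HOL-Algebra.Algebra" "HOL-Algebra.Free_Abelian_Groups"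
begin

section \<open>Locally profinite groups\<close>

locale topological_group = Group.group G for G :: "'g monoid" (structure) +
  fixes T :: "'g topology"
  assumes topspace_eq: "topspace T = carrier G"
    and mult_continuous: "continuous_map (prod_topology T T) T (\<lambda>(x, y). x \<otimes> y)"
    and inv_continuous: "continuous_map T T (\<lambda>x. inv x)"

definition open_subgroup :: "'g monoid \<Rightarrow> 'g topology \<Rightarrow> 'g set \<Rightarrow> bool" where
  "open_subgroup G T K \<longleftrightarrow> subgroup K G \<and> openin T K"

definition compact_open_subgroup :: "'g monoid \<Rightarrow> 'g topology \<Rightarrow> 'g set \<Rightarrow> bool" where
  "compact_open_subgroup G T K \<longleftrightarrow> open_subgroup G T K \<and> compactin T K"

locale locally_profinite_group = topological_group +
  assumes hausdorff: "Hausdorff_space T"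
    and small_compact_open:
      "\<lbrakk>openin T U; \<one> \<in> U\<rbrakk> \<Longrightarrow> \<exists>K. compact_open_subgroup G T K \<and> K \<subseteq> U"

text \<open>A subgroup \<open>J\<close> of \<open>G\<close> is viewed as a group through \<open>subgrp G J\<close>, with the topology
  \<open>subtopology T J\<close>.\<close>

abbreviation subgrp :: "'g monoid \<Rightarrow> 'g set \<Rightarrow> 'g monoid" where
  "subgrp G J \<equiv> G\<lparr>carrier := J\<rparr>"

text \<open>Used for left \<open>S\<close>-stable closed sets \<open>A\<close> (supports), where it says that the image of \<open>A\<close>
  in the quotient of \<open>G\<close> by \<open>S\<close> is compact.\<close>

definition compact_mod :: "'g monoid \<Rightarrow> 'g topology \<Rightarrow> 'g set \<Rightarrow> 'g set \<Rightarrow> bool" where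
  "compact_mod G T S A \<longleftrightarrow> (\<exists>K. compactin T K \<and> A \<subseteq> S <#>\<^bsub>G\<^esub> K)"


section \<open>Smooth representations\<close>

text \<open>The fields \<^const>\<open>monoid.mult\<close> and \<^const>\<open>monoid.one\<close> that the library's
  \<open>module\<close> records inherit from rings carry no meaning here, and neither do the values of
  \<open>act\<close> outside the group that is acting; no notion below depends on them.\<close>

record ('c, 'g, 'v) rep = "('c, 'v) module" +
  act :: "'g \<Rightarrow> 'v \<Rightarrow> 'v"

definition mod_hom ::
  "'c ring \<Rightarrow> ('c, 'v, 'm) module_scheme \<Rightarrow> ('c, 'w, 'n) module_scheme \<Rightarrow> ('v \<Rightarrow> 'w) set" where
  "mod_hom C V W = {\<phi> \<in> carrier V \<rightarrow> carrier W.
     (\<forall>x\<in>carrier V. \<forall>y\<in>carrier V. \<phi> (x \<oplus>\<^bsub>V\<^esub> y) = \<phi> x \<oplus>\<^bsub>W\<^esub> \<phi> y) \<and>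
     (\<forall>c\<in>carrier C. \<forall>x\<in>carrier V. \<phi> (c \<odot>\<^bsub>V\<^esub> x) = c \<odot>\<^bsub>W\<^esub> \<phi> x)}"

definition smooth_rep ::
  "'c ring \<Rightarrow> 'g monoid \<Rightarrow> 'g topology \<Rightarrow> ('c, 'g, 'v) rep \<Rightarrow> bool" where
  "smooth_rep C G T V \<longleftrightarrow> module C V \<and>
     (\<forall>g\<in>carrier G. act V g \<in> mod_hom C V V) \<and>
     (\<forall>x\<in>carrier V. act V \<one>\<^bsub>G\<^esub> x = x) \<and>
     (\<forall>g\<in>carrier G. \<forall>h\<in>carrier G. \<forall>x\<in>carrier V. act V (g \<otimes>\<^bsub>G\<^esub> h) x = act V g (act V h x)) \<and>
     (\<forall>x\<in>carrier V. openin T (stabilizer G (act V) x))"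

definition irreducible_rep ::
  "'c ring \<Rightarrow> 'g monoid \<Rightarrow> 'g topology \<Rightarrow> ('c, 'g, 'v) rep \<Rightarrow> bool" where
  "irreducible_rep C G T V \<longleftrightarrow> smooth_rep C G T V \<and> carrier V \<noteq> {\<zero>\<^bsub>V\<^esub>} \<and>
     (\<forall>W. submodule W C V \<and> (\<forall>g\<in>carrier G. \<forall>x\<in>W. act V g x \<in> W) \<longrightarrow>
        W = {\<zero>\<^bsub>V\<^esub>} \<or> W = carrier V)"

definition rep_hom ::
  "'c ring \<Rightarrow> 'g monoid \<Rightarrow> ('c, 'g, 'v) rep \<Rightarrow> ('c, 'g, 'w) rep \<Rightarrow> ('v \<Rightarrow> 'w) set" where
  "rep_hom C G V W =
     {\<phi> \<in> mod_hom C V W. \<forall>g\<in>carrier G. \<forall>x\<in>carrier V. \<phi> (act V g x) = act W g (\<phi> x)}"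

definition rep_iso ::
  "'c ring \<Rightarrow> 'g monoid \<Rightarrow> ('c, 'g, 'v) rep \<Rightarrow> ('c, 'g, 'w) rep \<Rightarrow> bool" where
  "rep_iso C G V W \<longleftrightarrow> (\<exists>\<phi>\<in>rep_hom C G V W. bij_betw \<phi> (carrier V) (carrier W))"

text \<open>Endomorphisms are taken extensional so that each of them occurs only once.\<close>

definition rep_End :: "'c ring \<Rightarrow> 'g monoid \<Rightarrow> ('c, 'g, 'v) rep \<Rightarrow> ('v \<Rightarrow> 'v) ring" where
  "rep_End C G V =
     \<lparr>carrier = rep_hom C G V V \<inter> extensional (carrier V),
      monoid.mult = (\<lambda>\<phi> \<psi>. compose (carrier V) \<phi> \<psi>), monoid.one = (\<lambda>x\<in>carrier V. x),
      ring.zero = (\<lambda>x\<in>carrier V. \<zero>\<^bsub>V\<^esub>), ring.add = (\<lambda>\<phi> \<psi>. \<lambda>x\<in>carrier V. \<phi> x \<oplus>\<^bsub>V\<^esub> \<psi> x)\<rparr>"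


section \<open>Isomorphism classes\<close>

text \<open>An irreducible representation of a subgroup of \<open>G\<close> is spanned by the orbit of any nonzero
  vector, so it has an isomorphic copy whose vectors are elements of \<^typ>\<open>'g \<Rightarrow> 'c\<close> (with
  arbitrary carrier and operations); see \<open>iso_class_irreducible_nonempty\<close> below. An isomorphism class of
  irreducible representations is therefore a full equivalence class of representations on this
  type.\<close>

type_synonym ('c, 'g) urep = "('c, 'g, 'g \<Rightarrow> 'c) rep"

definition iso_class ::
  "'c ring \<Rightarrow> 'g monoid \<Rightarrow> 'g topology \<Rightarrow> ('c, 'g, 'v) rep \<Rightarrow> ('c, 'g) urep set" where
  "iso_class C G T V = {U. smooth_rep C G T U \<and> rep_iso C G V U}"

definition irreducible_class ::
  "'c ring \<Rightarrow> 'g monoid \<Rightarrow> 'g topology \<Rightarrow> ('c, 'g) urep set \<Rightarrow> bool" where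
  "irreducible_class C G T \<V> \<longleftrightarrow> (\<exists>V::('c, 'g) urep. irreducible_rep C G T V \<and> \<V> = iso_class C G T V)"

lemma rep_transport:
  fixes V :: "('c, 'g, 'v) rep" and f :: "'v \<Rightarrow> 'w"
  assumes V: "smooth_rep C G T V" and inj: "inj_on f (carrier V)"
  shows "\<exists>U :: ('c, 'g, 'w) rep. smooth_rep C G T U \<and> rep_iso C G V U"
proof -
  interpret module C V using V by (simp add: smooth_rep_def)
  have hom: "\<And>g. g \<in> carrier G \<Longrightarrow> act V g \<in> mod_hom C V V" using V by (simp add: smooth_rep_def)
  have cl: "\<And>g x. g \<in> carrier G \<Longrightarrow> x \<in> carrier V \<Longrightarrow> act V g x \<in> carrier V"
    using hom by (fastforce simp: mod_hom_def)
  define i where "i = inv_into (carrier V) f"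
  have i[simp]: "\<And>x. x \<in> carrier V \<Longrightarrow> i (f x) = x"
    unfolding i_def using inj by simp
  define U :: "('c, 'g, 'w) rep" where "U =
    \<lparr>carrier = f ` carrier V, monoid.mult = undefined, monoid.one = undefined,
     ring.zero = f \<zero>\<^bsub>V\<^esub>, ring.add = (\<lambda>x y. f (i x \<oplus>\<^bsub>V\<^esub> i y)),
     module.smult = (\<lambda>c x. f (c \<odot>\<^bsub>V\<^esub> i x)), act = (\<lambda>g x. f (act V g (i x)))\<rparr>"
  have U[simp]: "carrier U = f ` carrier V" "\<zero>\<^bsub>U\<^esub> = f \<zero>\<^bsub>V\<^esub>"
    "\<And>x y. x \<oplus>\<^bsub>U\<^esub> y = f (i x \<oplus>\<^bsub>V\<^esub> i y)" "\<And>c x. c \<odot>\<^bsub>U\<^esub> x = f (c \<odot>\<^bsub>V\<^esub> i x)"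
    "\<And>g x. act U g x = f (act V g (i x))"
    by (simp_all add: U_def)
  have "abelian_group U"
  proof (rule abelian_groupI, goal_cases)
    case (6 x)
    then obtain y where "y \<in> carrier V" "x = f y" by auto
    then have "f (\<ominus>\<^bsub>V\<^esub> y) \<in> carrier U \<and> f (\<ominus>\<^bsub>V\<^esub> y) \<oplus>\<^bsub>U\<^esub> x = \<zero>\<^bsub>U\<^esub>"
      by (simp add: M.l_neg)
    then show ?case by blast
  qed (auto simp: M.a_ac)
  then have "module C U"
    by (intro moduleI) (auto simp: R.is_cring smult_l_distr smult_r_distr smult_assoc1)
  moreover have "stabilizer G (act U) (f x) = stabilizer G (act V) x" if "x \<in> carrier V" for x
    using that cl inj by (auto simp: stabilizer_def inj_on_eq_iff)
  ultimately have "smooth_rep C G T U"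
    using V cl by (auto simp: smooth_rep_def mod_hom_def)
  moreover have "f \<in> rep_hom C G V U" by (auto simp: rep_hom_def mod_hom_def)
  moreover have "bij_betw f (carrier V) (carrier U)" using inj by (simp add: bij_betw_def)
  ultimately show ?thesis unfolding rep_iso_def by blast
qed

lemma iso_class_irreducible_nonempty:
  fixes V :: "('c, 'g, 'v) rep"
  assumes G: "Group.group G" and V: "irreducible_rep C G T V"
  shows "iso_class C G T V \<noteq> {}"
proof -
  have sm: "smooth_rep C G T V" using V by (simp add: irreducible_rep_def)
  interpret module C V using sm by (simp add: smooth_rep_def)
  interpret G: Group.group G by fact
  have hom: "\<And>g. g \<in> carrier G \<Longrightarrow> act V g \<in> mod_hom C V V" using sm by (simp add: smooth_rep_def)
  have cl[simp]: "\<And>g x. g \<in> carrier G \<Longrightarrow> x \<in> carrier V \<Longrightarrow> act V g x \<in> carrier V"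
    using hom by (fastforce simp: mod_hom_def)
  obtain v where v: "v \<in> carrier V" "v \<noteq> \<zero>\<^bsub>V\<^esub>"
  proof -
    have "carrier V \<noteq> {\<zero>\<^bsub>V\<^esub>}" using V by (simp add: irreducible_rep_def)
    then show ?thesis using M.zero_closed that by blast
  qed
  define P where "P F a \<longleftrightarrow> finite F \<and> F \<subseteq> carrier G \<and> a \<in> carrier G \<rightarrow> carrier C \<and>
    (\<forall>g. g \<notin> F \<longrightarrow> a g = \<zero>\<^bsub>C\<^esub>)" for F a
  define ev where "ev F a = (\<Oplus>\<^bsub>V\<^esub>g\<in>F. a g \<odot>\<^bsub>V\<^esub> act V g v)" for F a
  define S where "S = {ev F a | F a. P F a}"
  have ev_ext: "ev F' a = ev F a" if "P F a" "F \<subseteq> F'" "finite F'" "F' \<subseteq> carrier G" for F F' a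
    unfolding ev_def
    by (rule M.add.finprod_mono_neutral_cong_left[symmetric])
       (use that v in \<open>auto simp: P_def Pi_def subset_iff\<close>)
  have S_sub: "S \<subseteq> carrier V"
    using v by (auto simp: S_def P_def ev_def Pi_def subset_iff intro!: M.finsum_closed)
  have S_add: "x \<oplus>\<^bsub>V\<^esub> y \<in> S" if xy: "x \<in> S" "y \<in> S" for x y
  proof -
    obtain F a F' a' where *: "P F a" "x = ev F a" "P F' a'" "y = ev F' a'"
      using xy by (auto simp: S_def)
    let ?F = "F \<union> F'" and ?a = "\<lambda>g. a g \<oplus>\<^bsub>C\<^esub> a' g"
    have F: "finite ?F" "?F \<subseteq> carrier G" using * by (auto simp: P_def)
    have "x \<oplus>\<^bsub>V\<^esub> y = ev ?F a \<oplus>\<^bsub>V\<^esub> ev ?F a'"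
      using * F ev_ext[of F a ?F] ev_ext[of F' a' ?F] by simp
    also have "\<dots> = (\<Oplus>\<^bsub>V\<^esub>g\<in>?F. a g \<odot>\<^bsub>V\<^esub> act V g v \<oplus>\<^bsub>V\<^esub> a' g \<odot>\<^bsub>V\<^esub> act V g v)"
      unfolding ev_def
      by (rule M.finsum_addf[symmetric]) (use * F v in \<open>auto simp: P_def Pi_def subset_iff\<close>)
    also have "\<dots> = ev ?F ?a"
      unfolding ev_def
      by (rule M.finsum_cong') (use * F v in \<open>auto simp: P_def Pi_def subset_iff smult_l_distr\<close>)
    finally show ?thesis
      using * by (auto simp: S_def P_def Pi_def intro!: exI[of _ ?F] exI[of _ ?a])
  qed
  have S_sing: "c \<odot>\<^bsub>V\<^esub> act V g v \<in> S" if "c \<in> carrier C" "g \<in> carrier G" for c g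
  proof -
    let ?a = "\<lambda>h. if h = g then c else \<zero>\<^bsub>C\<^esub>"
    have "ev {g} ?a = c \<odot>\<^bsub>V\<^esub> act V g v" using that v by (simp add: ev_def)
    moreover have "P {g} ?a" using that by (auto simp: P_def)
    ultimately show ?thesis
      unfolding S_def by (intro CollectI exI[of _ "{g}"] exI[of _ ?a] conjI) simp_all
  qed
  have S_zero: "\<zero>\<^bsub>V\<^esub> \<in> S" using S_sing[OF R.zero_closed G.one_closed] v by simp
  have S_image: "\<phi> x \<in> S"
    if x: "x \<in> S" and phi: "\<phi> \<in> carrier V \<rightarrow> carrier V" "\<phi> \<zero>\<^bsub>V\<^esub> = \<zero>\<^bsub>V\<^esub>"
      "\<And>x y. x \<in> carrier V \<Longrightarrow> y \<in> carrier V \<Longrightarrow> \<phi> (x \<oplus>\<^bsub>V\<^esub> y) = \<phi> x \<oplus>\<^bsub>V\<^esub> \<phi> y"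
      "\<And>c g. c \<in> carrier C \<Longrightarrow> g \<in> carrier G \<Longrightarrow> \<phi> (c \<odot>\<^bsub>V\<^esub> act V g v) \<in> S" for x \<phi>
  proof -
    obtain F a where Fa: "P F a" "x = ev F a" using x by (auto simp: S_def)
    have "finite F" "F \<subseteq> carrier G" "a \<in> F \<rightarrow> carrier C" using Fa by (auto simp: P_def)
    then have "\<phi> (ev F a) \<in> S"
    proof (induction F)
      case empty
      then show ?case using phi S_zero by (simp add: ev_def)
    next
      case (insert g F)
      have cl': "(\<lambda>g. a g \<odot>\<^bsub>V\<^esub> act V g v) \<in> F \<rightarrow> carrier V"
        "a g \<odot>\<^bsub>V\<^esub> act V g v \<in> carrier V" "ev F a \<in> carrier V"
        using insert v by (auto simp: ev_def Pi_def subset_iff intro!: M.finsum_closed)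
      then have "ev (insert g F) a = a g \<odot>\<^bsub>V\<^esub> act V g v \<oplus>\<^bsub>V\<^esub> ev F a"
        unfolding ev_def using insert by (subst M.finsum_insert) auto
      then show ?case using insert phi cl' S_add by (auto simp: Pi_def)
    qed
    then show ?thesis using Fa by simp
  qed
  have S_smult: "c \<odot>\<^bsub>V\<^esub> x \<in> S" if c: "c \<in> carrier C" and x: "x \<in> S" for c x
    by (rule S_image[OF x, of "\<lambda>x. c \<odot>\<^bsub>V\<^esub> x"])
       (use c v in \<open>auto simp: smult_r_distr smult_assoc1[symmetric] intro: S_sing\<close>)
  have S_act: "act V g x \<in> S" if g: "g \<in> carrier G" and x: "x \<in> S" for g x
  proof (rule S_image[OF x, of "act V g"])
    have lin: "act V g (c \<odot>\<^bsub>V\<^esub> y) = c \<odot>\<^bsub>V\<^esub> act V g y" if "c \<in> carrier C" "y \<in> carrier V" for c y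
      using hom[OF g] that by (auto simp: mod_hom_def)
    show "act V g \<zero>\<^bsub>V\<^esub> = \<zero>\<^bsub>V\<^esub>"
      using lin[of "\<zero>\<^bsub>C\<^esub>" "\<zero>\<^bsub>V\<^esub>"] g by simp
    show "act V g (c \<odot>\<^bsub>V\<^esub> act V h v) \<in> S" if "c \<in> carrier C" "h \<in> carrier G" for c h
    proof -
      have "act V g (act V h v) = act V (g \<otimes>\<^bsub>G\<^esub> h) v"
        using sm g that v by (simp add: smooth_rep_def)
      then show ?thesis using lin[of c "act V h v"] S_sing[of c "g \<otimes>\<^bsub>G\<^esub> h"] g that v by simp
    qed
  qed (use hom[OF g] in \<open>auto simp: mod_hom_def\<close>)
  have "submodule S C V"
  proof (rule submoduleI[OF S_sub S_zero _ S_add S_smult])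
    fix x assume x: "x \<in> S"
    then have "\<ominus>\<^bsub>V\<^esub> x = (\<ominus>\<^bsub>C\<^esub> \<one>\<^bsub>C\<^esub>) \<odot>\<^bsub>V\<^esub> x" using S_sub by (auto simp: smult_l_minus)
    then show "\<ominus>\<^bsub>V\<^esub> x \<in> S" using x S_smult by simp
  qed
  moreover have "v \<in> S"
    using S_sing[of "\<one>\<^bsub>C\<^esub>" "\<one>\<^bsub>G\<^esub>"] v sm by (simp add: smooth_rep_def)
  ultimately have S: "S = carrier V"
    using V S_act v(2) unfolding irreducible_rep_def by (metis singletonD)
  have "\<exists>a. \<exists>F. P F a \<and> x = ev F a" if "x \<in> carrier V" for x
    using that unfolding S[symmetric] S_def by blast
  then obtain f where f: "\<And>x. x \<in> carrier V \<Longrightarrow> \<exists>F. P F (f x) \<and> x = ev F (f x)" by metis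
  have f_ev: "ev {g. f x g \<noteq> \<zero>\<^bsub>C\<^esub>} (f x) = x" if x: "x \<in> carrier V" for x
  proof -
    obtain F where F: "P F (f x)" "x = ev F (f x)" using f[OF x] by blast
    let ?F = "{g. f x g \<noteq> \<zero>\<^bsub>C\<^esub>}"
    have sub: "?F \<subseteq> F" using F(1) unfolding P_def by blast
    have fin: "finite F" "F \<subseteq> carrier G" using F(1) unfolding P_def by blast+
    have "P ?F (f x)"
      using F(1) sub finite_subset[OF sub fin(1)] unfolding P_def by blast
    from ev_ext[OF this sub fin] show ?thesis using F(2) by metis
  qed
  have "inj_on f (carrier V)"
    by (rule inj_on_inverseI[where g = "\<lambda>a. ev {g. a g \<noteq> \<zero>\<^bsub>C\<^esub>} a"]) (rule f_ev)
  from rep_transport[OF sm this] show ?thesis by (auto simp: iso_class_def)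
qed


section \<open>Compact induction, conjugation and Galois twist\<close>

definition cind ::
  "'g monoid \<Rightarrow> 'g topology \<Rightarrow> 'g set \<Rightarrow> ('c, 'g, 'v) rep \<Rightarrow> ('c, 'g, 'g \<Rightarrow> 'v) rep" where
  "cind G T J V =
     \<lparr>carrier = {f \<in> carrier G \<rightarrow>\<^sub>E carrier V.
        (\<forall>j\<in>J. \<forall>g\<in>carrier G. f (j \<otimes>\<^bsub>G\<^esub> g) = act V j (f g)) \<and>
        (\<exists>K. open_subgroup G T K \<and> (\<forall>g\<in>carrier G. \<forall>k\<in>K. f (g \<otimes>\<^bsub>G\<^esub> k) = f g)) \<and>
        compact_mod G T J {g \<in> carrier G. f g \<noteq> \<zero>\<^bsub>V\<^esub>}},
      monoid.mult = undefined, monoid.one = undefined,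
      ring.zero = (\<lambda>g\<in>carrier G. \<zero>\<^bsub>V\<^esub>),
      ring.add = (\<lambda>f f'. \<lambda>g\<in>carrier G. f g \<oplus>\<^bsub>V\<^esub> f' g),
      module.smult = (\<lambda>c f. \<lambda>g\<in>carrier G. c \<odot>\<^bsub>V\<^esub> f g),
      act = (\<lambda>x f. \<lambda>g\<in>carrier G. f (g \<otimes>\<^bsub>G\<^esub> x))\<rparr>"

definition cind_map ::
  "'g monoid \<Rightarrow> 'g topology \<Rightarrow> 'g set \<Rightarrow> ('c, 'g, 'v) rep \<Rightarrow>
     ('v \<Rightarrow> 'v) \<Rightarrow> ('g \<Rightarrow> 'v) \<Rightarrow> 'g \<Rightarrow> 'v" where
  "cind_map G T J V \<phi> = (\<lambda>f\<in>carrier (cind G T J V). \<lambda>g\<in>carrier G. \<phi> (f g))"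

text \<open>The conjugate of a representation of \<open>J\<close> by \<open>g\<close>, a representation of \<open>g J g\<inverse>\<close>.\<close>

definition conj_rep :: "'g monoid \<Rightarrow> 'g \<Rightarrow> ('c, 'g, 'v) rep \<Rightarrow> ('c, 'g, 'v) rep" where
  "conj_rep G g V = V\<lparr>act := (\<lambda>x. act V (inv\<^bsub>G\<^esub> g \<otimes>\<^bsub>G\<^esub> x \<otimes>\<^bsub>G\<^esub> g))\<rparr>"

definition Aut_ring :: "'c ring \<Rightarrow> ('c \<Rightarrow> 'c) monoid" where
  "Aut_ring C = (BijGroup (carrier C))\<lparr>carrier := ring_iso C C \<inter> Bij (carrier C)\<rparr>"

text \<open>The tensor product of \<open>C\<close> and \<open>V\<close> over \<open>C\<close>, where \<open>C\<close> is a right module over itself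
  through \<open>\<sigma>\<close>: the free abelian group on pairs \<open>(a, x)\<close> modulo the subgroup \<open>twist_rel\<close>.
  Its elements are cosets; an endomorphism of the free group preserving \<open>twist_rel\<close> acts on
  them by taking the image of a coset and saturating it.\<close>

definition twist_free :: "'c ring \<Rightarrow> ('c, 'g, 'v) rep \<Rightarrow> ('c \<times> 'v \<Rightarrow>\<^sub>0 int) monoid" where
  "twist_free C V = free_Abelian_group (carrier C \<times> carrier V)"

definition twist_rel ::
  "'c ring \<Rightarrow> ('c \<Rightarrow> 'c) \<Rightarrow> ('c, 'g, 'v) rep \<Rightarrow> ('c \<times> 'v \<Rightarrow>\<^sub>0 int) set" where
  "twist_rel C \<sigma> V = generate (twist_free C V)
     ({frag_of (a \<oplus>\<^bsub>C\<^esub> b, x) - frag_of (a, x) - frag_of (b, x) | a b x.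
         a \<in> carrier C \<and> b \<in> carrier C \<and> x \<in> carrier V} \<union>
      {frag_of (a, x \<oplus>\<^bsub>V\<^esub> y) - frag_of (a, x) - frag_of (a, y) | a x y.
         a \<in> carrier C \<and> x \<in> carrier V \<and> y \<in> carrier V} \<union>
      {frag_of (a \<otimes>\<^bsub>C\<^esub> \<sigma> b, x) - frag_of (a, b \<odot>\<^bsub>V\<^esub> x) | a b x.
         a \<in> carrier C \<and> b \<in> carrier C \<and> x \<in> carrier V})"

definition twist ::
  "'c ring \<Rightarrow> ('c \<Rightarrow> 'c) \<Rightarrow> ('c, 'g, 'v) rep \<Rightarrow> ('c, 'g, ('c \<times> 'v \<Rightarrow>\<^sub>0 int) set) rep" where
  "twist C \<sigma> V =
     (let F = twist_free C V; R = twist_rel C \<sigma> V in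
      \<lparr>carrier = carrier (F Mod R), monoid.mult = undefined, monoid.one = undefined,
       ring.zero = \<one>\<^bsub>F Mod R\<^esub>, ring.add = monoid.mult (F Mod R),
       module.smult = (\<lambda>c A. R <#>\<^bsub>F\<^esub> frag_extend (\<lambda>(a, x). frag_of (c \<otimes>\<^bsub>C\<^esub> a, x)) ` A),
       act = (\<lambda>g A. R <#>\<^bsub>F\<^esub> frag_extend (\<lambda>(a, x). frag_of (a, act V g x)) ` A)\<rparr>)"


section \<open>\<open>Z\<close>-compactness\<close>

text \<open>The pro-order of \<open>K\<close> is invertible when the index of every open subgroup of \<open>K\<close> is (this
  index is finite for compact \<open>K\<close>).\<close>

definition pro_order_invertible :: "'c ring \<Rightarrow> 'g monoid \<Rightarrow> 'g topology \<Rightarrow> 'g set \<Rightarrow> bool" where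
  "pro_order_invertible C G T K \<longleftrightarrow>
     (\<forall>K'. open_subgroup G T K' \<and> K' \<subseteq> K \<longrightarrow>
        [card (rcosets\<^bsub>subgrp G K\<^esub> K')] \<cdot>\<^bsub>C\<^esub> \<one>\<^bsub>C\<^esub> \<in> Units C)"

text \<open>The average of \<open>k w\<close> for \<open>k\<close> in \<open>K\<close>. As \<open>k w\<close> depends only on the class of \<open>k\<close> modulo the
  open stabiliser of \<open>w\<close> in \<open>K\<close>, and determines it, this is the average over the finite orbit.\<close>

definition average :: "'c ring \<Rightarrow> 'g monoid \<Rightarrow> ('c, 'g, 'v) rep \<Rightarrow> 'g set \<Rightarrow> 'v \<Rightarrow> 'v" where
  "average C G V K w =
     (let Kw = orbit (subgrp G K) (act V) w
      in inv\<^bsub>C\<^esub> ([card Kw] \<cdot>\<^bsub>C\<^esub> \<one>\<^bsub>C\<^esub>) \<odot>\<^bsub>V\<^esub> (\<Oplus>\<^bsub>V\<^esub>x\<in>Kw. x))"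

text \<open>The pro-order of every compact open subgroup of \<open>K\<^sub>0\<close> is invertible if that of \<open>K\<^sub>0\<close> is. The
  standing assumption that such a \<open>K\<^sub>0\<close> exists is part of the definition.\<close>

definition Z_compact ::
  "'c ring \<Rightarrow> 'g monoid \<Rightarrow> 'g topology \<Rightarrow> 'g set \<Rightarrow> ('c, 'g, 'v) rep \<Rightarrow> bool" where
  "Z_compact C G T Z W \<longleftrightarrow>
     (\<exists>K\<^sub>0. compact_open_subgroup G T K\<^sub>0 \<and> pro_order_invertible C G T K\<^sub>0 \<and>
        (\<forall>K. compact_open_subgroup G T K \<and> K \<subseteq> K\<^sub>0 \<longrightarrow>
           (\<forall>w\<in>carrier W.
              compact_mod G T Z {g \<in> carrier G. average C G W K (act W g w) \<noteq> \<zero>\<^bsub>W\<^esub>})))"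


section \<open>Types and their properties\<close>

type_synonym ('c, 'g) tpair = "'g set \<times> ('c, 'g) urep set"

definition is_type :: "'c ring \<Rightarrow> 'g monoid \<Rightarrow> 'g topology \<Rightarrow> ('c, 'g) tpair \<Rightarrow> bool" where
  "is_type C G T = (\<lambda>(J, \<V>). open_subgroup G T J \<and>
     irreducible_class C (subgrp G J) (subtopology T J) \<V> \<and>
     (\<forall>V\<in>\<V>. irreducible_rep C G T (cind G T J V)))"

definition normalizer_types ::
  "'c ring \<Rightarrow> 'g monoid \<Rightarrow> 'g topology \<Rightarrow> ('c, 'g) tpair set \<Rightarrow> ('c, 'g) tpair set" where
  "normalizer_types C G T \<XX> =
     {(J', iso_class C (subgrp G J') (subtopology T J')
             (cind (subgrp G J') (subtopology T J') J V)) | J J' \<V> V.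
        (J, \<V>) \<in> \<XX> \<and> V \<in> \<V> \<and> J' = normalizer G J}"

definition intertwining :: "'c ring \<Rightarrow> 'g monoid \<Rightarrow> 'g topology \<Rightarrow> ('c, 'g) tpair set \<Rightarrow> bool" where
  "intertwining C G T \<XX> \<longleftrightarrow> (\<forall>(J, \<V>)\<in>\<XX>. \<forall>V\<in>\<V>.
     cind_map G T J V \<in> ring_iso (rep_End C (subgrp G J) V) (rep_End C G (cind G T J V)))"

definition unicity :: "'c ring \<Rightarrow> 'g monoid \<Rightarrow> 'g topology \<Rightarrow> ('c, 'g) tpair set \<Rightarrow> bool" where
  "unicity C G T \<XX> \<longleftrightarrow> (\<forall>(J, \<V>)\<in>\<XX>. \<forall>(J\<^sub>1, \<V>\<^sub>1)\<in>\<XX>. \<forall>V\<in>\<V>. \<forall>V\<^sub>1\<in>\<V>\<^sub>1.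
     rep_iso C G (cind G T J V) (cind G T J\<^sub>1 V\<^sub>1) \<longrightarrow>
     (\<exists>g\<in>carrier G. J\<^sub>1 = g <#\<^bsub>G\<^esub> J #>\<^bsub>G\<^esub> inv\<^bsub>G\<^esub> g \<and>
        rep_iso C (subgrp G J\<^sub>1) (conj_rep G g V) V\<^sub>1))"

definition exhaustion ::
  "'c ring \<Rightarrow> 'g monoid \<Rightarrow> 'g topology \<Rightarrow> ('c, 'g) urep set set \<Rightarrow> ('c, 'g) tpair set \<Rightarrow> bool" where
  "exhaustion C G T \<ZZ> \<XX> \<longleftrightarrow>
     (\<forall>(J, \<V>)\<in>\<XX>. \<forall>V\<in>\<V>. iso_class C G T (cind G T J V) \<in> \<ZZ>) \<and>
     (\<forall>\<W>\<in>\<ZZ>. \<exists>(J, \<V>)\<in>\<XX>. \<exists>V\<in>\<V>. \<W> = iso_class C G T (cind G T J V))"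

definition stability ::
  "'c ring \<Rightarrow> 'g monoid \<Rightarrow> 'g topology \<Rightarrow> ('c \<Rightarrow> 'c) set \<Rightarrow> ('c, 'g) tpair set \<Rightarrow> bool" where
  "stability C G T H \<XX> \<longleftrightarrow> (\<forall>(J, \<V>)\<in>\<XX>. \<forall>V\<in>\<V>. \<forall>\<sigma>\<in>H.
     (J, iso_class C (subgrp G J) (subtopology T J) (twist C \<sigma> V)) \<in> \<XX>)"

definition twist_unicity ::
  "'c ring \<Rightarrow> 'g monoid \<Rightarrow> 'g topology \<Rightarrow> ('c \<Rightarrow> 'c) set \<Rightarrow> ('c, 'g) tpair set \<Rightarrow> bool" where
  "twist_unicity C G T H \<XX> \<longleftrightarrow> stability C G T H \<XX> \<and>
     (\<forall>(J, \<V>)\<in>\<XX>. \<forall>V\<in>\<V>. \<forall>\<sigma>\<in>H.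
        rep_iso C G (cind G T J V) (cind G T J (twist C \<sigma> V)) \<longrightarrow>
        rep_iso C (subgrp G J) V (twist C \<sigma> V))"

end

theory Submission
  imports Defs
begin

text \<open>Write \<open>J'\<close> for the normalizer of \<open>J\<close> and \<open>V'\<close> for the representation of \<open>J'\<close> induced by \<open>V\<close>. By
  transitivity of compact induction, \<open>V\<close> and \<open>V'\<close> induce isomorphic representations of \<open>G\<close>, through
  \<open>f \<mapsto> (g \<mapsto> (j \<mapsto> f (j g)))\<close>. A stable subspace of \<open>V'\<close> induces a stable subspace of this
  representation, so \<open>V'\<close> is irreducible, and an endomorphism of it that comes from \<open>V\<close> comes from
  \<open>V'\<close>. Forming \<open>(J', V')\<close> commutes with conjugation by \<open>G\<close> and with Galois twists, the latter because
  the tensor product twist is \<open>V\<close> with scalars acting through the inverse of \<open>\<sigma>\<close>. For \<open>H\<close>-unicity,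
  unicity applied to \<open>V\<close> and \<open>\<sigma>(V)\<close> gives an element \<open>g\<close> that normalizes \<open>J\<close>, hence lies in \<open>J'\<close>, and
  so the conjugate of \<open>V'\<close> by \<open>g\<close> is isomorphic to \<open>V'\<close>.\<close>

section \<open>Morphisms of smooth representations\<close>

text \<open>The properties quantify over all members of an isomorphism class, and these have vectors
  in \<open>'g \<Rightarrow> 'c\<close>, while V' consists of functions with values in V. So V' is
  met only through isomorphic copies W, and every property has to be moved along isomorphisms:
  compact induction, twisting, conjugation and surjectivity on endomorphisms are each shown to
  respect them. The index of J in J' can be infinite, so the elements of V' are functions with
  support compact modulo J, and transitivity must compare two nested support conditions with a
  single one. That comparison is where closedness of open subgroups and small compact open subgroups
  enter. The description of the twist by scalars pays off because it keeps the vectors and the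
  action of V, and therefore commutes with induction as an equality of records.\<close>

lemma rep_homI:
  assumes "\<And>x. x \<in> carrier V \<Longrightarrow> \<phi> x \<in> carrier W"
    and "\<And>x y. x \<in> carrier V \<Longrightarrow> y \<in> carrier V \<Longrightarrow> \<phi> (x \<oplus>\<^bsub>V\<^esub> y) = \<phi> x \<oplus>\<^bsub>W\<^esub> \<phi> y"
    and "\<And>c x. c \<in> carrier C \<Longrightarrow> x \<in> carrier V \<Longrightarrow> \<phi> (c \<odot>\<^bsub>V\<^esub> x) = c \<odot>\<^bsub>W\<^esub> \<phi> x"
    and "\<And>g x. g \<in> carrier G \<Longrightarrow> x \<in> carrier V \<Longrightarrow> \<phi> (act V g x) = act W g (\<phi> x)"
  shows "\<phi> \<in> rep_hom C G V W"
  using assms by (simp add: rep_hom_def mod_hom_def)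

lemma
  assumes "\<phi> \<in> rep_hom C G V W"
  shows rep_hom_closed: "x \<in> carrier V \<Longrightarrow> \<phi> x \<in> carrier W"
    and rep_hom_add: "x \<in> carrier V \<Longrightarrow> y \<in> carrier V \<Longrightarrow> \<phi> (x \<oplus>\<^bsub>V\<^esub> y) = \<phi> x \<oplus>\<^bsub>W\<^esub> \<phi> y"
    and rep_hom_smult: "c \<in> carrier C \<Longrightarrow> x \<in> carrier V \<Longrightarrow> \<phi> (c \<odot>\<^bsub>V\<^esub> x) = c \<odot>\<^bsub>W\<^esub> \<phi> x"
    and rep_hom_act: "g \<in> carrier G \<Longrightarrow> x \<in> carrier V \<Longrightarrow> \<phi> (act V g x) = act W g (\<phi> x)"
  using assms by (auto simp: rep_hom_def mod_hom_def)

locale smooth_representation =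
  fixes C :: "'c ring" and G :: "'g monoid" and T :: "'g topology" and V :: "('c, 'g, 'v) rep"
  assumes smooth: "smooth_rep C G T V"
begin

sublocale module C V
  using smooth by (simp add: smooth_rep_def)

lemma act_closed [simp, intro]: "g \<in> carrier G \<Longrightarrow> x \<in> carrier V \<Longrightarrow> act V g x \<in> carrier V"
  and act_add [simp]: "g \<in> carrier G \<Longrightarrow> x \<in> carrier V \<Longrightarrow> y \<in> carrier V \<Longrightarrow>
    act V g (x \<oplus>\<^bsub>V\<^esub> y) = act V g x \<oplus>\<^bsub>V\<^esub> act V g y"
  and act_smult [simp]: "g \<in> carrier G \<Longrightarrow> c \<in> carrier C \<Longrightarrow> x \<in> carrier V \<Longrightarrow>
    act V g (c \<odot>\<^bsub>V\<^esub> x) = c \<odot>\<^bsub>V\<^esub> act V g x"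
  and act_one [simp]: "x \<in> carrier V \<Longrightarrow> act V \<one>\<^bsub>G\<^esub> x = x"
  and act_mult: "g \<in> carrier G \<Longrightarrow> h \<in> carrier G \<Longrightarrow> x \<in> carrier V \<Longrightarrow>
    act V (g \<otimes>\<^bsub>G\<^esub> h) x = act V g (act V h x)"
  and openin_stabilizer: "x \<in> carrier V \<Longrightarrow> openin T (stabilizer G (act V) x)"
  using smooth by (auto simp: smooth_rep_def mod_hom_def)

lemma act_zero [simp]: "g \<in> carrier G \<Longrightarrow> act V g \<zero>\<^bsub>V\<^esub> = \<zero>\<^bsub>V\<^esub>"
  using act_smult[of g "\<zero>\<^bsub>C\<^esub>" "\<zero>\<^bsub>V\<^esub>"] by simp

end

lemma rep_hom_zero:
  assumes "\<phi> \<in> rep_hom C G V W" "module C V" "module C W"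
  shows "\<phi> \<zero>\<^bsub>V\<^esub> = \<zero>\<^bsub>W\<^esub>"
proof -
  interpret V: module C V by fact
  interpret W: module C W by fact
  show ?thesis
    using rep_hom_smult[OF assms(1), of "\<zero>\<^bsub>C\<^esub>" "\<zero>\<^bsub>V\<^esub>"] rep_hom_closed[OF assms(1), of "\<zero>\<^bsub>V\<^esub>"]
    by simp
qed

lemma rep_hom_compose:
  assumes "\<phi> \<in> rep_hom C G V W" "\<psi> \<in> rep_hom C G U V"
  shows "\<phi> \<circ> \<psi> \<in> rep_hom C G U W"
  using assms by (auto simp: rep_hom_def mod_hom_def Pi_def)

text \<open>Allows a morphism to be replaced by its extensional restriction, as the carriers of
  \<open>rep_End\<close> require.\<close>

lemma rep_hom_cong:
  assumes "\<And>x. x \<in> carrier V \<Longrightarrow> \<phi> x = \<psi> x" "smooth_rep C G T V" "\<psi> \<in> rep_hom C G V W"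
  shows "\<phi> \<in> rep_hom C G V W"
proof -
  interpret V: smooth_representation C G T V by unfold_locales fact
  show ?thesis using assms by (auto simp: rep_hom_def mod_hom_def)
qed

lemma rep_hom_inv_into:
  assumes V: "smooth_rep C G T V"
    and \<phi>: "\<phi> \<in> rep_hom C G V W" "bij_betw \<phi> (carrier V) (carrier W)"
  shows "inv_into (carrier V) \<phi> \<in> rep_hom C G W V"
proof -
  interpret V: smooth_representation C G T V by unfold_locales fact
  have inv: "inv_into (carrier V) \<phi> (\<phi> x) = x" if "x \<in> carrier V" for x
    using \<phi>(2) that by (simp add: bij_betw_def)
  have W: "\<exists>x \<in> carrier V. y = \<phi> x" if "y \<in> carrier W" for y
    using \<phi>(2) that by (auto simp: bij_betw_def)
  show ?thesis
    by (rule rep_homI)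
      (auto dest!: W simp: inv rep_hom_add[OF \<phi>(1), symmetric] rep_hom_smult[OF \<phi>(1), symmetric]
        rep_hom_act[OF \<phi>(1), symmetric])
qed

lemma rep_iso_refl: "rep_iso C G V V"
  unfolding rep_iso_def by (rule bexI[of _ "\<lambda>x. x"]) (auto intro: rep_homI simp: bij_betw_def)

lemma rep_iso_trans [trans]:
  assumes "rep_iso C G U V" "rep_iso C G V W"
  shows "rep_iso C G U W"
  using assms unfolding rep_iso_def by (metis bij_betw_trans rep_hom_compose)

text \<open>The relation is defined on bare records, so inverting a morphism requires the source to
  be closed under its own operations; smoothness of V supplies this.\<close>

lemma rep_iso_sym:
  assumes "smooth_rep C G T V" "rep_iso C G V W"
  shows "rep_iso C G W V"
  using assms rep_hom_inv_into bij_betw_inv_into unfolding rep_iso_def by blast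

lemma rep_iso_stabilizer:
  assumes V: "smooth_rep C G T V" and \<phi>: "\<phi> \<in> rep_hom C G V W" "bij_betw \<phi> (carrier V) (carrier W)"
    and x: "x \<in> carrier V"
  shows "stabilizer G (act W) (\<phi> x) = stabilizer G (act V) x"
proof -
  interpret V: smooth_representation C G T V by unfold_locales fact
  have "inj_on \<phi> (carrier V)" using \<phi>(2) by (simp add: bij_betw_def)
  then show ?thesis
    using x by (auto simp: stabilizer_def rep_hom_act[OF \<phi>(1), symmetric] inj_on_eq_iff)
qed

text \<open>Transport of structure onto a bare record W. The zero is an independent field of W, and
  additivity of \<phi> would determine its value only if W were already known to be a module, so its
  compatibility is a hypothesis. The lemma yields the module axioms of the tensor product
  twist.\<close>

lemma smooth_rep_iso:
  assumes G: "Group.group G" and V: "smooth_rep C G T V"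
    and \<phi>: "\<phi> \<in> rep_hom C G V W" "bij_betw \<phi> (carrier V) (carrier W)" "\<phi> \<zero>\<^bsub>V\<^esub> = \<zero>\<^bsub>W\<^esub>"
  shows "smooth_rep C G T W"
proof -
  interpret Group.group G by fact
  interpret V: smooth_representation C G T V by unfold_locales fact
  have W: "carrier W = \<phi> ` carrier V" using \<phi>(2) by (simp add: bij_betw_def)
  note [simp] = rep_hom_add[OF \<phi>(1), symmetric] rep_hom_smult[OF \<phi>(1), symmetric]
    rep_hom_act[OF \<phi>(1), symmetric] \<phi>(3)[symmetric]
  have "abelian_group W"
  proof (rule abelian_groupI, goal_cases)
    case (6 x)
    then obtain y where "y \<in> carrier V" "x = \<phi> y" by (auto simp: W)
    then have "\<phi> (\<ominus>\<^bsub>V\<^esub> y) \<in> carrier W \<and> \<phi> (\<ominus>\<^bsub>V\<^esub> y) \<oplus>\<^bsub>W\<^esub> x = \<zero>\<^bsub>W\<^esub>"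
      by (simp add: V.M.l_neg W)
    then show ?case by blast
  qed (auto simp: W V.M.a_ac)
  then have "module C W"
    by (intro moduleI)
      (auto simp: W V.R.is_cring V.smult_l_distr V.smult_r_distr V.smult_assoc1)
  then show ?thesis
    using V.openin_stabilizer rep_iso_stabilizer[OF V \<phi>(1,2)]
    by (auto simp: smooth_rep_def mod_hom_def W V.act_mult)
qed

text \<open>A stable submodule U of W pulls back along \<phi> to a stable submodule of V, and
  surjectivity recovers U as the image of its preimage.\<close>

lemma irreducible_rep_iso:
  assumes V: "irreducible_rep C G T V" and W: "smooth_rep C G T W" and iso: "rep_iso C G V W"
  shows "irreducible_rep C G T W"
proof -
  have sV: "smooth_rep C G T V" using V by (simp add: irreducible_rep_def)
  interpret V: smooth_representation C G T V by unfold_locales fact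
  interpret W: smooth_representation C G T W by unfold_locales fact
  obtain \<phi> where \<phi>: "\<phi> \<in> rep_hom C G V W" "bij_betw \<phi> (carrier V) (carrier W)"
    using iso by (auto simp: rep_iso_def)
  have 0: "\<phi> \<zero>\<^bsub>V\<^esub> = \<zero>\<^bsub>W\<^esub>"
    using rep_hom_zero \<phi>(1) V.module_axioms W.module_axioms by blast
  have im: "carrier W = \<phi> ` carrier V" and inj: "inj_on \<phi> (carrier V)"
    using \<phi>(2) by (auto simp: bij_betw_def)
  have "U = {\<zero>\<^bsub>W\<^esub>} \<or> U = carrier W"
    if U: "submodule U C W" "\<forall>g\<in>carrier G. \<forall>x\<in>U. act W g x \<in> U" for U
  proof -
    note UE = W.submoduleE[OF U(1)]
    define U' where "U' = {x \<in> carrier V. \<phi> x \<in> U}"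
    have "\<phi> (\<ominus>\<^bsub>V\<^esub> x) \<in> U" if "x \<in> carrier V" "\<phi> x \<in> U" for x
    proof -
      have "\<phi> (\<ominus>\<^bsub>V\<^esub> x) = \<ominus>\<^bsub>W\<^esub> \<phi> x"
        using that rep_hom_add[OF \<phi>(1), of "\<ominus>\<^bsub>V\<^esub> x" x] 0
        by (intro W.M.minus_equality[symmetric]) (auto simp: V.M.l_neg rep_hom_closed[OF \<phi>(1)])
      then show ?thesis using UE that by simp
    qed
    moreover have "\<zero>\<^bsub>W\<^esub> \<in> U" using U(1) subgroup.one_closed by (fastforce simp: submodule_def)
    ultimately have "submodule U' C V"
      using UE 0 by (intro V.submoduleI)
        (auto simp: U'_def rep_hom_add[OF \<phi>(1)] rep_hom_smult[OF \<phi>(1)])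
    moreover have "\<forall>g\<in>carrier G. \<forall>x\<in>U'. act V g x \<in> U'"
      using U(2) by (auto simp: U'_def rep_hom_act[OF \<phi>(1)])
    ultimately have "U' = {\<zero>\<^bsub>V\<^esub>} \<or> U' = carrier V"
      using V unfolding irreducible_rep_def by blast
    moreover have "\<phi> ` U' = U" using UE(1) im by (auto simp: U'_def)
    ultimately show ?thesis using 0 im by auto
  qed
  moreover have "carrier W \<noteq> {\<zero>\<^bsub>W\<^esub>}"
  proof
    assume *: "carrier W = {\<zero>\<^bsub>W\<^esub>}"
    have "x = \<zero>\<^bsub>V\<^esub>" if "x \<in> carrier V" for x
      using that * 0 inj rep_hom_closed[OF \<phi>(1)] by (metis V.M.zero_closed inj_on_eq_iff singletonD)
    then have "carrier V = {\<zero>\<^bsub>V\<^esub>}" by auto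
    then show False using V by (simp add: irreducible_rep_def)
  qed
  ultimately show ?thesis using W by (simp add: irreducible_rep_def)
qed

lemma iso_class_cong:
  assumes "smooth_rep C G T V" "rep_iso C G V W"
  shows "iso_class C G T V = iso_class C G T W"
  unfolding iso_class_def
  using rep_iso_trans[OF rep_iso_sym[OF assms]] rep_iso_trans[OF assms(2)] by blast

text \<open>Any member can replace the representative through which the class is given, so later
  arguments may choose V freely in its class.\<close>

lemma irreducible_class_member:
  fixes \<V> :: "('c, 'g) urep set"
  assumes "irreducible_class C G T \<V>" "V \<in> \<V>"
  shows "irreducible_rep C G T V" "\<V> = iso_class C G T V"
proof -
  obtain U :: "('c, 'g) urep" where U: "irreducible_rep C G T U" "\<V> = iso_class C G T U"
    using assms(1) unfolding irreducible_class_def by blast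
  have V: "smooth_rep C G T V" "rep_iso C G U V" using assms(2) U(2) by (simp_all add: iso_class_def)
  show "irreducible_rep C G T V" by (rule irreducible_rep_iso[OF U(1) V])
  show "\<V> = iso_class C G T V"
    using U iso_class_cong[OF _ V(2)] by (simp add: irreducible_rep_def)
qed

text \<open>V may have vectors of any type, in particular functions into functions as for V'. A copy
  on \<open>'g \<Rightarrow> 'c\<close> exists by \<open>iso_class_irreducible_nonempty\<close>, and
  it serves as representative.\<close>

lemma irreducible_class_iso_class:
  assumes "Group.group G" "irreducible_rep C G T V"
  shows "irreducible_class C G T (iso_class C G T V)"
proof -
  obtain U where U: "U \<in> iso_class C G T V"
    using iso_class_irreducible_nonempty[OF assms] by blast
  then have "irreducible_rep C G T U"
    using irreducible_rep_iso[OF assms(2)] by (auto simp: iso_class_def)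
  moreover have "iso_class C G T V = iso_class C G T U"
    using U assms(2) by (intro iso_class_cong) (auto simp: iso_class_def irreducible_rep_def)
  ultimately show ?thesis by (auto simp: irreducible_class_def)
qed

section \<open>Conjugates and open subgroups\<close>

text \<open>Together with \<open>m_assoc\<close>, which associates to the right, these rules cancel
  neighbouring inverse letters inside a longer word.\<close>

lemma (in Group.group) inv_mult_cancel [simp]:
  assumes "x \<in> carrier G" "y \<in> carrier G"
  shows "inv x \<otimes> (x \<otimes> y) = y" "x \<otimes> (inv x \<otimes> y) = y"
  using assms by (simp_all flip: m_assoc)

text \<open>This is g A g^-1 written as a preimage: membership becomes a condition on the expression
  that occurs in \<open>conj_rep\<close>, and openness follows from continuity.\<close>

definition (in Group.group) conj_set where
  "conj_set g A = {x \<in> carrier G. inv g \<otimes> x \<otimes> g \<in> A}"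

context Group.group
begin

lemma conj_coset_eq:
  assumes "A \<subseteq> carrier G" "g \<in> carrier G"
  shows "g <# A #> inv g = conj_set g A"
proof (intro equalityI subsetI)
  fix x assume "x \<in> g <# A #> inv g"
  then obtain a where a: "a \<in> A" "x = g \<otimes> a \<otimes> inv g" by (auto simp: l_coset_def r_coset_def)
  moreover have "a \<in> carrier G" using a(1) assms(1) by blast
  ultimately show "x \<in> conj_set g A"
    using assms(2) by (simp add: conj_set_def m_assoc)
next
  fix x assume "x \<in> conj_set g A"
  then have x: "x \<in> carrier G" "inv g \<otimes> x \<otimes> g \<in> A" by (simp_all add: conj_set_def)
  moreover have "x = g \<otimes> (inv g \<otimes> x \<otimes> g) \<otimes> inv g"
    using x(1) assms(2) by (simp add: m_assoc)
  ultimately show "x \<in> g <# A #> inv g" by (auto simp: l_coset_def r_coset_def)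
qed

lemma conj_set_carrier: "conj_set g A \<subseteq> carrier G"
  by (auto simp: conj_set_def)

lemma conj_set_mono: "A \<subseteq> B \<Longrightarrow> conj_set g A \<subseteq> conj_set g B"
  by (auto simp: conj_set_def)

lemma conj_setD: "x \<in> conj_set g A \<Longrightarrow> x \<in> carrier G" "x \<in> conj_set g A \<Longrightarrow> inv g \<otimes> x \<otimes> g \<in> A"
  by (auto simp: conj_set_def)

lemma conj_setI:
  "a \<in> A \<Longrightarrow> a \<in> carrier G \<Longrightarrow> g \<in> carrier G \<Longrightarrow> g \<otimes> a \<otimes> inv g \<in> conj_set g A"
  by (simp add: conj_set_def m_assoc)

lemma conj_set_mult:
  "g \<in> carrier G \<Longrightarrow> h \<in> carrier G \<Longrightarrow> conj_set g (conj_set h A) = conj_set (g \<otimes> h) A"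
  by (auto simp: conj_set_def inv_mult_group m_assoc)

lemma conj_set_one: "A \<subseteq> carrier G \<Longrightarrow> conj_set \<one> A = A"
  by (auto simp: conj_set_def)

lemma conj_set_inv:
  assumes "A \<subseteq> carrier G" "g \<in> carrier G"
  shows "conj_set (inv g) (conj_set g A) = A" "conj_set g (conj_set (inv g) A) = A"
  using assms by (simp_all add: conj_set_mult conj_set_one)

lemma subgroup_conj_set:
  assumes "subgroup K G" "g \<in> carrier G"
  shows "subgroup (conj_set g K) G"
proof -
  interpret K: subgroup K G by fact
  show ?thesis
    unfolding conj_set_def
  proof (rule subgroupI, goal_cases)
    case (3 x)
    then have "inv (inv g \<otimes> x \<otimes> g) \<in> K" by simp
    then show ?case using 3 assms(2) by (simp add: inv_mult_group m_assoc)
  next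
    case (4 x y)
    then have "(inv g \<otimes> x \<otimes> g) \<otimes> (inv g \<otimes> y \<otimes> g) \<in> K" by simp
    then show ?case using 4 assms(2) by (simp add: m_assoc)
  qed (use assms(2) in \<open>auto intro!: exI[of _ \<one>]\<close>)
qed

lemma mem_normalizer_iff:
  assumes "A \<subseteq> carrier G"
  shows "x \<in> normalizer G A \<longleftrightarrow> x \<in> carrier G \<and> conj_set x A = A"
  using assms conj_coset_eq by (auto simp: normalizer_def stabilizer_def)

lemma subgroup_subset_normalizer:
  assumes "subgroup J G"
  shows "J \<subseteq> normalizer G J"
proof
  interpret J: subgroup J G by fact
  fix j assume j: "j \<in> J"
  have "x \<in> J" if "x \<in> carrier G" "inv j \<otimes> x \<otimes> j \<in> J" for x
  proof -
    have "j \<otimes> (inv j \<otimes> x \<otimes> j) \<otimes> inv j \<in> J" using that(2) j by blast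
    moreover have "j \<otimes> (inv j \<otimes> x \<otimes> j) \<otimes> inv j = x"
      using that(1) J.mem_carrier[OF j] by (simp add: m_assoc)
    ultimately show ?thesis by metis
  qed
  then have "conj_set j J \<subseteq> J" unfolding conj_set_def by blast
  moreover have "J \<subseteq> conj_set j J" using j by (auto simp: conj_set_def)
  ultimately have "conj_set j J = J" by blast
  then show "j \<in> normalizer G J" using mem_normalizer_iff[OF J.subset] J.mem_carrier[OF j] by blast
qed

text \<open>Stabilizers along an orbit are conjugate: y fixes g A g^-1 exactly when g^-1 y g fixes
  A.\<close>

lemma normalizer_conj_set:
  assumes A: "A \<subseteq> carrier G" and g: "g \<in> carrier G"
  shows "normalizer G (conj_set g A) = conj_set g (normalizer G A)"
proof -
  have "conj_set y (conj_set g A) = conj_set g A \<longleftrightarrow> conj_set (inv g \<otimes> y \<otimes> g) A = A"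
    if y: "y \<in> carrier G" for y
  proof -
    have "conj_set (inv g \<otimes> y \<otimes> g) A = conj_set (inv g) (conj_set y (conj_set g A))"
      using g y by (simp add: conj_set_mult m_assoc)
    then show ?thesis
      using conj_set_inv[OF A g] conj_set_inv[OF conj_set_carrier g] by metis
  qed
  then show ?thesis
    using g by (auto simp: mem_normalizer_iff A conj_set_carrier conj_set_def[of g "normalizer G A"])
qed

end

section \<open>Topology of translates, conjugates and open subgroups\<close>

context topological_group
begin

lemma open_subgroup_subset: "open_subgroup G T J \<Longrightarrow> J \<subseteq> carrier G"
  and open_subgroup_subgroup: "open_subgroup G T J \<Longrightarrow> subgroup J G"
  by (auto simp: open_subgroup_def dest: subgroup.subset)

lemma continuous_map_mult:
  assumes "continuous_map Y T f" "continuous_map Y T f'"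
  shows "continuous_map Y T (\<lambda>x. f x \<otimes> f' x)"
  using continuous_map_compose[OF continuous_map_pairedI[OF assms] mult_continuous]
  by (simp add: o_def)

lemma continuous_map_conj:
  assumes "g \<in> carrier G" "h \<in> carrier G"
  shows "continuous_map T T (\<lambda>x. g \<otimes> x \<otimes> h)"
  using assms by (intro continuous_map_mult) (auto simp: topspace_eq)

lemma openin_translate:
  assumes "openin T U" "g \<in> carrier G" "h \<in> carrier G"
  shows "openin T {x \<in> carrier G. g \<otimes> x \<otimes> h \<in> U}"
  using openin_continuous_map_preimage[OF continuous_map_conj[OF assms(2,3)] assms(1)]
  by (simp add: topspace_eq)

lemma compactin_translate:
  assumes "compactin T K" "g \<in> carrier G" "h \<in> carrier G"
  shows "compactin T ((\<lambda>x. g \<otimes> x \<otimes> h) ` K)"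
  using image_compactin[OF assms(1) continuous_map_conj[OF assms(2,3)]] .

lemma compactin_set_mult:
  assumes "compactin T K" "compactin T L"
  shows "compactin T (K <#> L)"
proof -
  have "K <#> L = (\<lambda>(x, y). x \<otimes> y) ` (K \<times> L)" by (force simp: set_mult_def)
  then show ?thesis
    using image_compactin[OF _ mult_continuous] assms by (simp add: compactin_Times)
qed

lemma open_subgroup_conj_set:
  assumes "open_subgroup G T K" "g \<in> carrier G"
  shows "open_subgroup G T (conj_set g K)"
  using assms subgroup_conj_set[of K g] openin_translate[of K "inv g" g]
  by (simp add: open_subgroup_def conj_set_def)

lemma open_subgroup_Int:
  "open_subgroup G T K \<Longrightarrow> open_subgroup G T L \<Longrightarrow> open_subgroup G T (K \<inter> L)"
  by (simp add: open_subgroup_def subgroups_Inter_pair openin_Int)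

text \<open>J is a union of cosets of the open subgroup K. This gives openness of normalizers and of
  stabilizers of induced functions.\<close>

lemma open_subgroup_superset:
  assumes "open_subgroup G T K" "subgroup J G" "K \<subseteq> J"
  shows "open_subgroup G T J"
proof -
  interpret K: subgroup K G using assms(1) by (simp add: open_subgroup_def)
  interpret J: subgroup J G by fact
  have "\<exists>U. openin T U \<and> x \<in> U \<and> U \<subseteq> J" if x: "x \<in> J" for x
  proof (intro exI conjI)
    \<comment> \<open>The coset xK, with a trivial right factor to fit the two-sided form of
      \<open>openin_translate\<close>.\<close>
    let ?U = "{y \<in> carrier G. inv x \<otimes> y \<otimes> \<one> \<in> K}"
    show "openin T ?U" using assms(1) that openin_translate by (simp add: open_subgroup_def)
    show "x \<in> ?U" using that by simp
    have "y \<in> J" if "y \<in> carrier G" "inv x \<otimes> y \<in> J" for y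
      using inv_mult_cancel(2)[OF J.mem_carrier[OF x] that(1)] J.m_closed[OF x that(2)] by metis
    moreover have "inv x \<otimes> y \<in> J" if "y \<in> carrier G" "inv x \<otimes> y \<otimes> \<one> \<in> K" for y
      using that x assms(3) by auto
    ultimately show "?U \<subseteq> J" by blast
  qed
  then have "openin T J" by (subst openin_subopen) blast
  then show ?thesis using assms(2) by (simp add: open_subgroup_def)
qed

text \<open>The complement is a union of cosets of J. Closedness makes the intersection of a compact
  set with J compact.\<close>

lemma open_subgroup_closedin:
  assumes "open_subgroup G T J"
  shows "closedin T J"
proof -
  interpret J: subgroup J G using assms by (simp add: open_subgroup_def)
  have "\<exists>U. openin T U \<and> x \<in> U \<and> U \<subseteq> carrier G - J" if x: "x \<in> carrier G - J" for x
  proof (intro exI conjI)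
    let ?U = "{y \<in> carrier G. inv x \<otimes> y \<otimes> \<one> \<in> J}"
    show "openin T ?U" using assms that openin_translate by (simp add: open_subgroup_def)
    show "x \<in> ?U" using that by simp
    have "x \<in> J" if "y \<in> J" "inv x \<otimes> y \<otimes> \<one> \<in> J" for y
    proof -
      have "inv x \<otimes> y \<in> J" using that x by simp
      then have "y \<otimes> inv (inv x \<otimes> y) \<in> J" using that by simp
      moreover have "y \<otimes> inv (inv x \<otimes> y) = x" using that x by (simp add: inv_mult_group)
      ultimately show ?thesis by metis
    qed
    then show "?U \<subseteq> carrier G - J" using x by blast
  qed
  then have "openin T (carrier G - J)" by (subst openin_subopen) blast
  then show ?thesis by (simp add: closedin_def topspace_eq J.subset)
qed

lemma topological_group_subgrp:
  assumes "subgroup J G"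
  shows "topological_group (subgrp G J) (subtopology T J)"
proof -
  interpret J: subgroup J G by fact
  have 1: "continuous_map (subtopology (prod_topology T T) (J \<times> J)) T (\<lambda>(x, y). x \<otimes> y)"
    using continuous_map_from_subtopology mult_continuous by blast
  have 2: "continuous_map (subtopology T J) T (\<lambda>x. inv x)"
    using continuous_map_from_subtopology inv_continuous by blast
  \<comment> \<open>The inverse of \<open>subgrp G J\<close> is a different term, identified with
    that of G only on J, so continuity is carried over by agreement there.\<close>
  have 3: "continuous_map (subtopology T J) T (\<lambda>x. inv\<^bsub>subgrp G J\<^esub> x)"
    by (rule continuous_map_eq[OF 2]) (use assms m_inv_consistent in auto)
  show ?thesis
  proof (intro topological_group.intro topological_group_axioms.intro)
    show "Group.group (subgrp G J)" using assms subgroup_imp_group by blast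
    show "topspace (subtopology T J) = carrier (subgrp G J)" using J.subset by (auto simp: topspace_eq)
    show "continuous_map (prod_topology (subtopology T J) (subtopology T J)) (subtopology T J)
      (\<lambda>(x, y). x \<otimes>\<^bsub>subgrp G J\<^esub> y)"
      using 1 J.subset unfolding subtopology_Times continuous_map_in_subtopology
      by (auto simp: topspace_eq)
    show "continuous_map (subtopology T J) (subtopology T J) (\<lambda>x. inv\<^bsub>subgrp G J\<^esub> x)"
      using 3 J.subset m_inv_consistent[OF assms] unfolding continuous_map_in_subtopology
      by (auto simp: topspace_eq)
  qed
qed

text \<open>Openness of J makes relative openness absolute, so invariance groups can be moved
  between J and G.\<close>

lemma open_subgroup_subgrp_iff:
  assumes "open_subgroup G T J"
  shows "open_subgroup (subgrp G J) (subtopology T J) K \<longleftrightarrow> open_subgroup G T K \<and> K \<subseteq> J"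
proof -
  have J: "subgroup J G" "openin T J" using assms by (auto simp: open_subgroup_def)
  have "subgroup K (subgrp G J) \<longleftrightarrow> subgroup K G \<and> K \<subseteq> J"
    using J(1) subgroup_incl[of K J] incl_subgroup[of J K] subgroup.subset[of K "subgrp G J"]
    by fastforce
  then show ?thesis using J(2) by (auto simp: open_subgroup_def openin_open_subtopology)
qed

end

context locally_profinite_group
begin

lemma compact_open_subgroup_exists:
  assumes "open_subgroup G T K"
  obtains L where "open_subgroup G T L" "compactin T L" "L \<subseteq> K"
  using small_compact_open[of K] assms
  by (auto simp: open_subgroup_def compact_open_subgroup_def subgroup.one_closed)

lemma locally_profinite_group_subgrp:
  assumes "open_subgroup G T J"
  shows "locally_profinite_group (subgrp G J) (subtopology T J)"
proof -
  interpret J: topological_group "subgrp G J" "subtopology T J"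
    using assms topological_group_subgrp by (simp add: open_subgroup_def)
  show ?thesis
  proof
    show "Hausdorff_space (subtopology T J)" using hausdorff Hausdorff_space_subtopology by blast
    fix U assume U: "openin (subtopology T J) U" "\<one>\<^bsub>subgrp G J\<^esub> \<in> U"
    then have "openin T U" "U \<subseteq> J"
      using assms by (auto simp: open_subgroup_def openin_open_subtopology)
    moreover obtain K where "compact_open_subgroup G T K" "K \<subseteq> U"
      using U(2) \<open>openin T U\<close> small_compact_open by auto
    ultimately show "\<exists>K. compact_open_subgroup (subgrp G J) (subtopology T J) K \<and> K \<subseteq> U"
      using open_subgroup_subgrp_iff[OF assms]
      by (intro exI[of _ K]) (auto simp: compact_open_subgroup_def compactin_subtopology)
  qed
qed

end

section \<open>Compact induction\<close>

lemma (in Group.group) stabilizer_subgroupI: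
  assumes "\<And>g h. g \<in> carrier G \<Longrightarrow> h \<in> carrier G \<Longrightarrow> \<phi> (g \<otimes> h) x = \<phi> g (\<phi> h x)" "\<phi> \<one> x = x"
  shows "subgroup (stabilizer G \<phi> x) G"
proof -
  have "\<phi> (inv g) x = x" if "g \<in> carrier G" "\<phi> g x = x" for g
    using that assms(2) assms(1)[of "inv g" g] by simp
  then show ?thesis
    using assms by (auto simp: stabilizer_def intro!: subgroupI)
qed

text \<open>The carrier is left out on purpose: the operations can be unfolded freely while
  membership stays folded and goes through \<open>cindI\<close> and its converses.\<close>

lemma cind_simps:
  "\<zero>\<^bsub>cind G T J V\<^esub> = (\<lambda>g\<in>carrier G. \<zero>\<^bsub>V\<^esub>)"
  "f \<oplus>\<^bsub>cind G T J V\<^esub> f' = (\<lambda>g\<in>carrier G. f g \<oplus>\<^bsub>V\<^esub> f' g)"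
  "c \<odot>\<^bsub>cind G T J V\<^esub> f = (\<lambda>g\<in>carrier G. c \<odot>\<^bsub>V\<^esub> f g)"
  "act (cind G T J V) x f = (\<lambda>g\<in>carrier G. f (g \<otimes>\<^bsub>G\<^esub> x))"
  by (simp_all add: cind_def)

lemma cindI:
  assumes "\<And>g. g \<in> carrier G \<Longrightarrow> f g \<in> carrier V" "f \<in> extensional (carrier G)"
    and "\<And>j g. j \<in> J \<Longrightarrow> g \<in> carrier G \<Longrightarrow> f (j \<otimes>\<^bsub>G\<^esub> g) = act V j (f g)"
    and "open_subgroup G T K" "\<And>g k. g \<in> carrier G \<Longrightarrow> k \<in> K \<Longrightarrow> f (g \<otimes>\<^bsub>G\<^esub> k) = f g"
    and "compact_mod G T J {g \<in> carrier G. f g \<noteq> \<zero>\<^bsub>V\<^esub>}"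
  shows "f \<in> carrier (cind G T J V)"
  using assms by (auto simp: cind_def PiE_def)

lemma
  assumes "f \<in> carrier (cind G T J V)"
  shows cind_closed: "g \<in> carrier G \<Longrightarrow> f g \<in> carrier V"
    and cind_extensional: "f \<in> extensional (carrier G)"
    and cind_equivariant: "j \<in> J \<Longrightarrow> g \<in> carrier G \<Longrightarrow> f (j \<otimes>\<^bsub>G\<^esub> g) = act V j (f g)"
    and cind_smooth: "\<exists>K. open_subgroup G T K \<and> (\<forall>g\<in>carrier G. \<forall>k\<in>K. f (g \<otimes>\<^bsub>G\<^esub> k) = f g)"
    and cind_support: "compact_mod G T J {g \<in> carrier G. f g \<noteq> \<zero>\<^bsub>V\<^esub>}"
  using assms by (auto simp: cind_def PiE_iff)

lemma cind_eqI:
  assumes "f \<in> carrier (cind G T J V)" "f' \<in> carrier (cind G T J V)"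
    and "\<And>g. g \<in> carrier G \<Longrightarrow> f g = f' g"
  shows "f = f'"
  using assms by (intro extensionalityI[of _ "carrier G"]) (auto dest: cind_extensional)

lemma compact_mod_mono: "compact_mod G T S B \<Longrightarrow> A \<subseteq> B \<Longrightarrow> compact_mod G T S A"
  unfolding compact_mod_def by blast

lemma compact_mod_empty: "compact_mod G T S {}"
  unfolding compact_mod_def by (auto intro: exI[of _ "{}"])

lemma compact_mod_Un:
  assumes "compact_mod G T S A" "compact_mod G T S B"
  shows "compact_mod G T S (A \<union> B)"
proof -
  obtain K L where KL: "compactin T K" "A \<subseteq> S <#>\<^bsub>G\<^esub> K" "compactin T L" "B \<subseteq> S <#>\<^bsub>G\<^esub> L"
    using assms unfolding compact_mod_def by blast
  moreover have "S <#>\<^bsub>G\<^esub> (K \<union> L) = (S <#>\<^bsub>G\<^esub> K) \<union> (S <#>\<^bsub>G\<^esub> L)" by (auto simp: set_mult_def)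
  ultimately show ?thesis
    unfolding compact_mod_def by (intro exI[of _ "K \<union> L"]) (auto intro: compactin_Un)
qed

text \<open>If A lies in S K, then A x^-1 lies in S (K x^-1), and K x^-1 is again compact.\<close>

lemma (in topological_group) compact_mod_translate:
  assumes A: "compact_mod G T S A" and "S \<subseteq> carrier G" "x \<in> carrier G"
  shows "compact_mod G T S {g \<in> carrier G. g \<otimes> x \<in> A}"
proof -
  obtain K where K: "compactin T K" "A \<subseteq> S <#> K"
    using A unfolding compact_mod_def by blast
  let ?K = "(\<lambda>k. \<one> \<otimes> k \<otimes> inv x) ` K"
  have "g \<in> S <#> ?K" if g: "g \<in> carrier G" "g \<otimes> x \<in> A" for g
  proof -
    obtain s k where sk: "s \<in> S" "k \<in> K" "g \<otimes> x = s \<otimes> k"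
      using g(2) K(2) by (auto simp: set_mult_def)
    have "k \<in> carrier G" "s \<in> carrier G"
      using sk K(1) assms(2) compactin_subset_topspace topspace_eq by blast+
    then have "g = s \<otimes> (\<one> \<otimes> k \<otimes> inv x)"
      using sk(3) that(1) assms(3) inv_solve_right[of g "s \<otimes> k" x] by (simp add: m_assoc)
    then show ?thesis using sk by (auto simp: set_mult_def)
  qed
  then show ?thesis
    unfolding compact_mod_def using K(1) assms(3)
    by (intro exI[of _ ?K]) (auto intro: compactin_translate)
qed

locale compact_induction = topological_group G T +
    V: smooth_representation C "subgrp G J" "subtopology T J" V
  for G :: "'g monoid" (structure) and T and J and C :: "'c ring" and V :: "('c, 'g, 'v) rep" +
  assumes open_subgroup: "open_subgroup G T J"
begin

sublocale J: subgroup J G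
  using open_subgroup by (simp add: open_subgroup_def)

text \<open>Restated with the carrier and the product of \<open>subgrp G J\<close> reduced to J and
  to the product of G.\<close>

lemmas V_act_closed = V.act_closed[simplified]
  and V_act_one = V.act_one[simplified]
  and V_act_mult = V.act_mult[simplified]
  and V_act_zero = V.act_zero[simplified]
  and V_act_add = V.act_add[simplified]
  and V_act_smult = V.act_smult[simplified]

lemma cind_add_closed:
  assumes f: "f \<in> carrier (cind G T J V)" and f': "f' \<in> carrier (cind G T J V)"
  shows "f \<oplus>\<^bsub>cind G T J V\<^esub> f' \<in> carrier (cind G T J V)"
proof -
  obtain K K' where K: "open_subgroup G T K" "\<forall>g\<in>carrier G. \<forall>k\<in>K. f (g \<otimes> k) = f g"
    "open_subgroup G T K'" "\<forall>g\<in>carrier G. \<forall>k\<in>K'. f' (g \<otimes> k) = f' g"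
    using cind_smooth[OF f] cind_smooth[OF f'] by blast
  have "compact_mod G T J {g \<in> carrier G. f g \<oplus>\<^bsub>V\<^esub> f' g \<noteq> \<zero>\<^bsub>V\<^esub>}"
    by (rule compact_mod_mono[OF compact_mod_Un[OF cind_support[OF f] cind_support[OF f']]]) auto
  moreover have "{g \<in> carrier G. (\<lambda>g\<in>carrier G. f g \<oplus>\<^bsub>V\<^esub> f' g) g \<noteq> \<zero>\<^bsub>V\<^esub>} =
      {g \<in> carrier G. f g \<oplus>\<^bsub>V\<^esub> f' g \<noteq> \<zero>\<^bsub>V\<^esub>}" by auto
  ultimately show ?thesis
    unfolding cind_simps using K open_subgroup_subset[OF K(1)]
    by (intro cindI[of _ _ _ _ _ "K \<inter> K'"])
      (auto simp: cind_closed[OF f] cind_closed[OF f'] cind_equivariant[OF f]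
        cind_equivariant[OF f'] V_act_add open_subgroup_Int subset_iff)
qed

lemma cind_smult_closed:
  assumes f: "f \<in> carrier (cind G T J V)" and c: "c \<in> carrier C"
  shows "c \<odot>\<^bsub>cind G T J V\<^esub> f \<in> carrier (cind G T J V)"
proof -
  obtain K where K: "open_subgroup G T K" "\<forall>g\<in>carrier G. \<forall>k\<in>K. f (g \<otimes> k) = f g"
    using cind_smooth[OF f] by blast
  have "compact_mod G T J {g \<in> carrier G. (\<lambda>g\<in>carrier G. c \<odot>\<^bsub>V\<^esub> f g) g \<noteq> \<zero>\<^bsub>V\<^esub>}"
    by (rule compact_mod_mono[OF cind_support[OF f]]) (use c in auto)
  then show ?thesis
    unfolding cind_simps using K open_subgroup_subset[OF K(1)] c
    by (intro cindI[of _ _ _ _ _ K])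
      (auto simp: cind_closed[OF f] cind_equivariant[OF f] V_act_smult subset_iff)
qed

lemma cind_zero_closed: "\<zero>\<^bsub>cind G T J V\<^esub> \<in> carrier (cind G T J V)"
proof -
  have "{g \<in> carrier G. (\<lambda>g\<in>carrier G. \<zero>\<^bsub>V\<^esub>) g \<noteq> \<zero>\<^bsub>V\<^esub>} = {}" by auto
  then have "compact_mod G T J {g \<in> carrier G. (\<lambda>g\<in>carrier G. \<zero>\<^bsub>V\<^esub>) g \<noteq> \<zero>\<^bsub>V\<^esub>}"
    by (simp only: compact_mod_empty)
  then show ?thesis
    unfolding cind_simps using open_subgroup
    by (intro cindI[of _ _ _ _ _ J]) (auto simp: V_act_zero)
qed

lemma cind_act_closed:
  assumes f: "f \<in> carrier (cind G T J V)" and x: "x \<in> carrier G"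
  shows "act (cind G T J V) x f \<in> carrier (cind G T J V)"
proof -
  obtain K where K: "open_subgroup G T K" "\<forall>g\<in>carrier G. \<forall>k\<in>K. f (g \<otimes> k) = f g"
    using cind_smooth[OF f] by blast
  \<comment> \<open>From g k x = (g x) (x^-1 k x), right translation by x turns invariance under K
    into invariance under x K x^-1.\<close>
  let ?K = "conj_set x K"
  have inv: "f (g \<otimes> k \<otimes> x) = f (g \<otimes> x)" if "g \<in> carrier G" "k \<in> ?K" for g k
  proof -
    note k = conj_setD[OF that(2)]
    have "g \<otimes> k \<otimes> x = (g \<otimes> x) \<otimes> (inv x \<otimes> k \<otimes> x)"
      using that(1) k(1) x by (simp add: m_assoc)
    then show ?thesis using K(2) k(2) that(1) x by simp
  qed
  have "{g \<in> carrier G. (\<lambda>g\<in>carrier G. f (g \<otimes> x)) g \<noteq> \<zero>\<^bsub>V\<^esub>} \<subseteq>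
      {g \<in> carrier G. g \<otimes> x \<in> {g \<in> carrier G. f g \<noteq> \<zero>\<^bsub>V\<^esub>}}" using x by auto
  then have "compact_mod G T J {g \<in> carrier G. (\<lambda>g\<in>carrier G. f (g \<otimes> x)) g \<noteq> \<zero>\<^bsub>V\<^esub>}"
    using compact_mod_mono compact_mod_translate[OF cind_support[OF f] J.subset x] by blast
  moreover have "open_subgroup G T ?K" using open_subgroup_conj_set K(1) x by blast
  ultimately show ?thesis
    unfolding cind_simps using inv x conj_set_carrier[of x K]
    by (intro cindI[of _ _ _ _ _ ?K]) (auto simp: cind_closed[OF f] cind_equivariant[OF f] m_assoc subset_iff)
qed

lemma smooth_cind: "smooth_rep C G T (cind G T J V)"
proof -
  have "abelian_group (cind G T J V)"
  proof (rule abelian_groupI, goal_cases)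
    case (6 f)
    \<comment> \<open>The additive inverse is taken to be (-1) f, whose membership is already
      covered by closure under scalars.\<close>
    have "(\<ominus>\<^bsub>C\<^esub> \<one>\<^bsub>C\<^esub>) \<odot>\<^bsub>cind G T J V\<^esub> f \<in> carrier (cind G T J V)"
      using 6 by (simp add: cind_smult_closed)
    moreover have "(\<ominus>\<^bsub>C\<^esub> \<one>\<^bsub>C\<^esub>) \<odot>\<^bsub>cind G T J V\<^esub> f \<oplus>\<^bsub>cind G T J V\<^esub> f = \<zero>\<^bsub>cind G T J V\<^esub>"
      unfolding cind_simps
      by (rule restrict_ext) (simp add: cind_closed[OF 6] V.smult_l_minus V.M.l_neg)
    ultimately show ?case by blast
  next
    case (3 f f' f'')
    then show ?case unfolding cind_simps
      by (intro restrict_ext) (simp add: cind_closed V.M.a_assoc)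
  next
    case (4 f f')
    then show ?case unfolding cind_simps
      by (intro restrict_ext) (simp add: cind_closed V.M.a_comm)
  next
    case (5 f)
    show ?case unfolding cind_simps
      by (rule extensionalityI[of _ "carrier G"])
        (use cind_extensional[OF 5] cind_closed[OF 5] in auto)
  qed (simp_all add: cind_add_closed cind_zero_closed)
  then have mod: "module C (cind G T J V)"
  proof (rule moduleI[OF V.R.is_cring], goal_cases)
    case (2 a b f)
    then show ?case unfolding cind_simps
      by (intro restrict_ext) (simp add: cind_closed V.smult_l_distr)
  next
    case (3 a f f')
    then show ?case unfolding cind_simps
      by (intro restrict_ext) (simp add: cind_closed V.smult_r_distr)
  next
    case (4 a b f)
    then show ?case unfolding cind_simps
      by (intro restrict_ext) (simp add: cind_closed V.smult_assoc1)
  next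
    case (5 f)
    show ?case unfolding cind_simps
      by (rule extensionalityI[of _ "carrier G"])
        (use cind_extensional[OF 5] cind_closed[OF 5] in auto)
  qed (simp_all add: cind_smult_closed)
  have one: "act (cind G T J V) \<one> f = f" if f: "f \<in> carrier (cind G T J V)" for f
    unfolding cind_simps
    by (rule extensionalityI[of _ "carrier G"]) (use cind_extensional[OF f] in auto)
  have mult: "act (cind G T J V) (g \<otimes> h) f = act (cind G T J V) g (act (cind G T J V) h f)"
    if "g \<in> carrier G" "h \<in> carrier G" for g h f
    using that unfolding cind_simps by (intro restrict_ext) (simp add: m_assoc)
  have "openin T (stabilizer G (act (cind G T J V)) f)" if f: "f \<in> carrier (cind G T J V)" for f
  proof -
    obtain K where K: "open_subgroup G T K" "\<forall>g\<in>carrier G. \<forall>k\<in>K. f (g \<otimes> k) = f g"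
      using cind_smooth[OF f] by blast
    have "act (cind G T J V) k f = f" if "k \<in> K" for k
      unfolding cind_simps using K(2) that
      by (intro extensionalityI[of _ "carrier G"]) (use cind_extensional[OF f] in auto)
    \<comment> \<open>The invariance group required of each induced function sits inside its
      stabilizer, which is then open as an overgroup.\<close>
    then have "K \<subseteq> stabilizer G (act (cind G T J V)) f"
      using open_subgroup_subset[OF K(1)] by (auto simp: stabilizer_def)
    moreover have "subgroup (stabilizer G (act (cind G T J V)) f) G"
      by (rule stabilizer_subgroupI) (simp_all add: mult one f)
    ultimately show ?thesis
      using open_subgroup_superset[OF K(1)] by (simp add: open_subgroup_def)
  qed
  moreover have "act (cind G T J V) g \<in> mod_hom C (cind G T J V) (cind G T J V)"
    if g: "g \<in> carrier G" for g
  proof -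
    have "act (cind G T J V) g (f \<oplus>\<^bsub>cind G T J V\<^esub> f') =
      act (cind G T J V) g f \<oplus>\<^bsub>cind G T J V\<^esub> act (cind G T J V) g f'" for f f'
      using g unfolding cind_simps by (intro restrict_ext) simp
    moreover have "act (cind G T J V) g (c \<odot>\<^bsub>cind G T J V\<^esub> f) =
      c \<odot>\<^bsub>cind G T J V\<^esub> act (cind G T J V) g f" for c f
      using g unfolding cind_simps by (intro restrict_ext) simp
    ultimately show ?thesis
      unfolding mod_hom_def using cind_act_closed[OF _ g] by blast
  qed
  ultimately show ?thesis
    using mod one mult unfolding smooth_rep_def by blast
qed

text \<open>The canonical copy of V in the induced representation. Evaluation at \<one> recovers v,
  and through this pair both submodules and endomorphisms of V can be read off upstairs.\<close>

definition point :: "'v \<Rightarrow> 'g \<Rightarrow> 'v" where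
  "point v = (\<lambda>g\<in>carrier G. if g \<in> J then act V g v else \<zero>\<^bsub>V\<^esub>)"

lemma point_one: "v \<in> carrier V \<Longrightarrow> point v \<one> = v"
  by (simp add: point_def V_act_one)

lemma mult_mem_iff: "j \<in> J \<Longrightarrow> g \<in> carrier G \<Longrightarrow> j \<otimes> g \<in> J \<longleftrightarrow> g \<in> J"
  by (metis J.m_closed J.m_inv_closed J.mem_carrier inv_mult_cancel(1))

lemma mult_mem_iff': "j \<in> J \<Longrightarrow> g \<in> carrier G \<Longrightarrow> g \<otimes> j \<in> J \<longleftrightarrow> g \<in> J"
  by (metis J.m_closed J.m_inv_closed J.mem_carrier m_assoc r_inv r_one)

text \<open>The function is right invariant under the stabilizer of v in J, which is open in G
  because J is. Its support lies in J, so the compact set {\<one>} suffices modulo J.\<close>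

lemma point_closed:
  assumes v: "v \<in> carrier V"
  shows "point v \<in> carrier (cind G T J V)"
proof -
  let ?K = "stabilizer (subgrp G J) (act V) v"
  have "Group.group (subgrp G J)" using J.subgroup_axioms subgroup_imp_group by blast
  then have "subgroup ?K (subgrp G J)"
    by (rule group.stabilizer_subgroupI) (simp_all add: V_act_mult V_act_one v)
  then have K: "open_subgroup (subgrp G J) (subtopology T J) ?K"
    using V.openin_stabilizer[OF v] by (simp add: open_subgroup_def)
  then have K: "open_subgroup G T ?K" using open_subgroup_subgrp_iff open_subgroup by blast
  have KJ: "?K \<subseteq> J" by (auto simp: stabilizer_def)
  have "point v (g \<otimes> k) = point v g" if "g \<in> carrier G" "k \<in> ?K" for g k
  proof (cases "g \<in> J")
    case True
    have "k \<in> J" "act V k v = v" using that by (auto simp: stabilizer_def)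
    then show ?thesis using True that v by (simp add: point_def V_act_mult)
  next
    case False
    moreover have "k \<in> J" using that KJ by blast
    ultimately show ?thesis using that by (simp add: point_def mult_mem_iff')
  qed
  moreover have "compact_mod G T J {g \<in> carrier G. point v g \<noteq> \<zero>\<^bsub>V\<^esub>}"
    unfolding compact_mod_def
    by (rule exI[of _ "{\<one>}"]) (auto simp: point_def set_mult_def topspace_eq split: if_splits)
  ultimately show ?thesis
    using K v by (intro cindI[of _ _ _ _ _ ?K])
      (auto simp: point_def V_act_closed V_act_mult V_act_zero mult_mem_iff)
qed

text \<open>Functions with all values in W form a stable submodule U. Via \<open>point\<close> and
  evaluation at \<one>, U = 0 forces W = 0, and U equal to everything forces W to be all of
  V.\<close>

lemma irreducible_cind_imp:
  assumes irr: "irreducible_rep C G T (cind G T J V)"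
  shows "irreducible_rep C (subgrp G J) (subtopology T J) V"
proof -
  interpret I: smooth_representation C G T "cind G T J V"
    by unfold_locales (rule smooth_cind)
  have "W = {\<zero>\<^bsub>V\<^esub>} \<or> W = carrier V"
    if W: "submodule W C V" "\<forall>g\<in>J. \<forall>x\<in>W. act V g x \<in> W" for W
  proof -
    note WE = V.submoduleE[OF W(1)]
    have W0: "\<zero>\<^bsub>V\<^esub> \<in> W" using W(1) subgroup.one_closed by (fastforce simp: submodule_def)
    define U where "U = {f \<in> carrier (cind G T J V). \<forall>g\<in>carrier G. f g \<in> W}"
    have "\<ominus>\<^bsub>cind G T J V\<^esub> f \<in> U" if "f \<in> U" for f
    proof -
      have f: "f \<in> carrier (cind G T J V)" using that by (simp add: U_def)
      have "\<ominus>\<^bsub>cind G T J V\<^esub> f = (\<ominus>\<^bsub>C\<^esub> \<one>\<^bsub>C\<^esub>) \<odot>\<^bsub>cind G T J V\<^esub> f"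
        using f by (simp add: I.smult_l_minus)
      then show ?thesis using that WE f by (simp add: U_def) (simp add: cind_simps)
    qed
    then have "submodule U C (cind G T J V)"
      using WE(4,5) W0 by (intro I.submoduleI) (auto simp: U_def, auto simp: cind_simps)
    moreover have "\<forall>g\<in>carrier G. \<forall>f\<in>U. act (cind G T J V) g f \<in> U"
      by (auto simp: U_def) (simp add: cind_simps)
    ultimately have "U = {\<zero>\<^bsub>cind G T J V\<^esub>} \<or> U = carrier (cind G T J V)"
      using irr unfolding irreducible_rep_def by blast
    then show ?thesis
    proof
      assume U: "U = {\<zero>\<^bsub>cind G T J V\<^esub>}"
      have "w = \<zero>\<^bsub>V\<^esub>" if "w \<in> W" for w
      proof -
        have w: "w \<in> carrier V" using that WE(1) by blast
        then have "point w \<in> U"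
          using that W(2) W0 point_closed by (auto simp: U_def point_def)
        then show ?thesis using U point_one[OF w] by (simp add: cind_simps)
      qed
      then show ?thesis using W0 by blast
    next
      assume U: "U = carrier (cind G T J V)"
      have "v \<in> W" if "v \<in> carrier V" for v
      proof -
        have "point v \<in> U" using U point_closed that by blast
        then show ?thesis using point_one[OF that] by (force simp: U_def)
      qed
      then show ?thesis using WE(1) by blast
    qed
  qed
  moreover have "carrier V \<noteq> {\<zero>\<^bsub>V\<^esub>}"
  proof
    assume "carrier V = {\<zero>\<^bsub>V\<^esub>}"
    then have "f = \<zero>\<^bsub>cind G T J V\<^esub>" if "f \<in> carrier (cind G T J V)" for f
      using that cind_zero_closed
      by (intro cind_eqI) (auto simp: cind_simps(1) dest: cind_closed)
    then have "carrier (cind G T J V) = {\<zero>\<^bsub>cind G T J V\<^esub>}" using cind_zero_closed by blast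
    then show False using irr by (simp add: irreducible_rep_def)
  qed
  ultimately show ?thesis using V.smooth by (simp add: irreducible_rep_def)
qed

end

section \<open>Functoriality of compact induction\<close>

text \<open>Induction on morphisms as a plain map. Unlike \<open>cind_map\<close> it admits
  different source and target and mentions no subgroup or representation, so the same map can be
  read at both stages of an iterated induction.\<close>

definition postcomp :: "'g monoid \<Rightarrow> ('v \<Rightarrow> 'w) \<Rightarrow> ('g \<Rightarrow> 'v) \<Rightarrow> 'g \<Rightarrow> 'w" where
  "postcomp G \<phi> f = (\<lambda>g\<in>carrier G. \<phi> (f g))"

lemma cind_map_eq: "f \<in> carrier (cind G T J V) \<Longrightarrow> cind_map G T J V \<phi> f = postcomp G \<phi> f"
  by (simp add: cind_map_def postcomp_def)

context topological_group
begin

text \<open>Preservation of zero keeps the support inside that of f; it is a separate hypothesis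
  since V and W are arbitrary records here.\<close>

lemma postcomp_closed:
  assumes "J \<subseteq> carrier G" and \<phi>: "\<phi> \<in> rep_hom C (subgrp G J) V W" "\<phi> \<zero>\<^bsub>V\<^esub> = \<zero>\<^bsub>W\<^esub>"
    and f: "f \<in> carrier (cind G T J V)"
  shows "postcomp G \<phi> f \<in> carrier (cind G T J W)"
proof -
  obtain K where K: "open_subgroup G T K" "\<forall>g\<in>carrier G. \<forall>k\<in>K. f (g \<otimes> k) = f g"
    using cind_smooth[OF f] by blast
  have "compact_mod G T J {g \<in> carrier G. postcomp G \<phi> f g \<noteq> \<zero>\<^bsub>W\<^esub>}"
    by (rule compact_mod_mono[OF cind_support[OF f]]) (use \<phi>(2) in \<open>auto simp: postcomp_def\<close>)
  then show ?thesis
    using assms(1) K open_subgroup_subset[OF K(1)]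
    by (intro cindI[of _ _ _ _ _ K])
      (auto simp: postcomp_def subset_iff cind_equivariant[OF f] cind_closed[OF f]
        rep_hom_closed[OF \<phi>(1)] rep_hom_act[OF \<phi>(1)])
qed

lemma postcomp_rep_hom:
  assumes "J \<subseteq> carrier G" and \<phi>: "\<phi> \<in> rep_hom C (subgrp G J) V W" "\<phi> \<zero>\<^bsub>V\<^esub> = \<zero>\<^bsub>W\<^esub>"
  shows "postcomp G \<phi> \<in> rep_hom C G (cind G T J V) (cind G T J W)"
proof (rule rep_homI, goal_cases)
  case (1 f)
  then show ?case using postcomp_closed[OF assms] by blast
next
  case (2 f f')
  then show ?case unfolding cind_simps postcomp_def
    by (intro restrict_ext) (simp add: rep_hom_add[OF \<phi>(1)] cind_closed)
next
  case (3 c f)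
  then show ?case unfolding cind_simps postcomp_def
    by (intro restrict_ext) (simp add: rep_hom_smult[OF \<phi>(1)] cind_closed)
next
  case (4 g f)
  then show ?case unfolding cind_simps postcomp_def by (intro restrict_ext) simp
qed

lemma postcomp_inverse:
  assumes "f \<in> carrier (cind G T J V)" "\<And>x. x \<in> carrier V \<Longrightarrow> \<psi> (\<phi> x) = x"
  shows "postcomp G \<psi> (postcomp G \<phi> f) = f"
  using assms cind_closed[OF assms(1)] cind_extensional[OF assms(1)]
  by (intro extensionalityI[of _ "carrier G"]) (auto simp: postcomp_def)

lemma postcomp_bij:
  assumes J: "J \<subseteq> carrier G" and V: "smooth_rep C (subgrp G J) T' V"
    and \<phi>: "\<phi> \<in> rep_hom C (subgrp G J) V W" "bij_betw \<phi> (carrier V) (carrier W)" "\<phi> \<zero>\<^bsub>V\<^esub> = \<zero>\<^bsub>W\<^esub>"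
  shows "bij_betw (postcomp G \<phi>) (carrier (cind G T J V)) (carrier (cind G T J W))"
proof (rule bij_betw_byWitness[where f' = "postcomp G (inv_into (carrier V) \<phi>)"])
  interpret V: smooth_representation C "subgrp G J" T' V by unfold_locales fact
  let ?\<psi> = "inv_into (carrier V) \<phi>"
  have \<psi>: "?\<psi> \<in> rep_hom C (subgrp G J) W V" using rep_hom_inv_into V \<phi> by blast
  have inv: "x \<in> carrier V \<Longrightarrow> ?\<psi> (\<phi> x) = x" "y \<in> carrier W \<Longrightarrow> \<phi> (?\<psi> y) = y" for x y
    using \<phi>(2) by (simp_all add: bij_betw_inv_into_left bij_betw_inv_into_right)
  have 0: "?\<psi> \<zero>\<^bsub>W\<^esub> = \<zero>\<^bsub>V\<^esub>" using inv(1)[of "\<zero>\<^bsub>V\<^esub>"] \<phi>(3) by simp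
  show "\<forall>f\<in>carrier (cind G T J V). postcomp G ?\<psi> (postcomp G \<phi> f) = f"
    using postcomp_inverse inv(1) by blast
  show "\<forall>f\<in>carrier (cind G T J W). postcomp G \<phi> (postcomp G ?\<psi> f) = f"
    using postcomp_inverse inv(2) by blast
  show "postcomp G \<phi> ` carrier (cind G T J V) \<subseteq> carrier (cind G T J W)"
    using postcomp_closed[OF J \<phi>(1,3)] by blast
  show "postcomp G ?\<psi> ` carrier (cind G T J W) \<subseteq> carrier (cind G T J V)"
    using postcomp_closed[OF J \<psi> 0] by blast
qed

lemma rep_iso_cind:
  assumes J: "J \<subseteq> carrier G"
    and V: "smooth_rep C (subgrp G J) T1 V" and W: "smooth_rep C (subgrp G J) T2 W"
    and iso: "rep_iso C (subgrp G J) V W"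
  shows "rep_iso C G (cind G T J V) (cind G T J W)"
proof -
  obtain \<phi> where \<phi>: "\<phi> \<in> rep_hom C (subgrp G J) V W" "bij_betw \<phi> (carrier V) (carrier W)"
    using iso by (auto simp: rep_iso_def)
  have "\<phi> \<zero>\<^bsub>V\<^esub> = \<zero>\<^bsub>W\<^esub>"
    using rep_hom_zero[OF \<phi>(1)] V W by (simp add: smooth_rep_def)
  then show ?thesis
    unfolding rep_iso_def using postcomp_rep_hom[OF J \<phi>(1)] postcomp_bij[OF J V \<phi>] by blast
qed

end

section \<open>Endomorphism rings and the intertwining property\<close>

lemma rep_End_simps:
  "carrier (rep_End C G V) = rep_hom C G V V \<inter> extensional (carrier V)"
  "\<phi> \<otimes>\<^bsub>rep_End C G V\<^esub> \<psi> = compose (carrier V) \<phi> \<psi>"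
  "\<one>\<^bsub>rep_End C G V\<^esub> = (\<lambda>x\<in>carrier V. x)"
  "\<phi> \<oplus>\<^bsub>rep_End C G V\<^esub> \<psi> = (\<lambda>x\<in>carrier V. \<phi> x \<oplus>\<^bsub>V\<^esub> \<psi> x)"
  by (simp_all add: rep_End_def)

text \<open>Surjectivity of \<open>cind_map\<close> freed from extensionality, a form that can be
  carried along isomorphisms.\<close>

definition endomorphisms_induced ::
  "'c ring \<Rightarrow> 'g monoid \<Rightarrow> 'g topology \<Rightarrow> 'g set \<Rightarrow> ('c, 'g, 'v) rep \<Rightarrow> bool" where
  "endomorphisms_induced C G T J V \<longleftrightarrow>
     (\<forall>\<psi>\<in>rep_hom C G (cind G T J V) (cind G T J V). \<exists>\<phi>\<in>rep_hom C (subgrp G J) V V.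
        \<forall>f\<in>carrier (cind G T J V). \<psi> f = postcomp G \<phi> f)"

context compact_induction
begin

lemma rep_hom_zero_V: "\<phi> \<in> rep_hom C (subgrp G J) V V \<Longrightarrow> \<phi> \<zero>\<^bsub>V\<^esub> = \<zero>\<^bsub>V\<^esub>"
  using rep_hom_zero V.module_axioms by blast

lemma cind_map_closed:
  assumes "\<phi> \<in> rep_hom C (subgrp G J) V V"
  shows "cind_map G T J V \<phi> \<in> carrier (rep_End C G (cind G T J V))"
proof -
  have *: "postcomp G \<phi> \<in> rep_hom C G (cind G T J V) (cind G T J V)"
    using postcomp_rep_hom[OF J.subset assms] rep_hom_zero_V[OF assms] by blast
  have "cind_map G T J V \<phi> \<in> rep_hom C G (cind G T J V) (cind G T J V)"
    by (rule rep_hom_cong[OF cind_map_eq smooth_cind *])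
  then show ?thesis by (simp add: rep_End_simps cind_map_def)
qed

lemma postcomp_point:
  assumes "\<phi> \<in> rep_hom C (subgrp G J) V V" "v \<in> carrier V"
  shows "postcomp G \<phi> (point v) \<one> = \<phi> v"
  by (simp add: postcomp_def point_one assms)

lemma cind_map_ring_hom:
  "cind_map G T J V \<in> ring_hom (rep_End C (subgrp G J) V) (rep_End C G (cind G T J V))"
proof (rule ring_hom_memI, goal_cases)
  case (1 \<phi>)
  then show ?case using cind_map_closed by (simp add: rep_End_simps)
next
  case (2 \<phi> \<psi>)
  then have \<psi>: "\<psi> \<in> rep_hom C (subgrp G J) V V" by (simp add: rep_End_simps)
  \<comment> \<open>The outer map is evaluated by \<open>cind_map_eq\<close> at the image of f under
    the inner one, so this image must lie in the carrier.\<close>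
  note postcomp_closed[OF J.subset \<psi> rep_hom_zero_V[OF \<psi>]]
  then show ?case
    by (intro extensionalityI[of _ "carrier (cind G T J V)"])
      (auto simp: rep_End_simps cind_map_eq compose_eq postcomp_def cind_closed
        intro!: restrict_ext, auto simp: cind_map_def)
next
  case (3 \<phi> \<psi>)
  show ?case
    by (intro extensionalityI[of _ "carrier (cind G T J V)"])
      (auto simp: rep_End_simps cind_simps cind_map_eq postcomp_def cind_closed
        intro!: restrict_ext, auto simp: cind_map_def)
next
  case 4
  have "postcomp G (\<lambda>x\<in>carrier V. x) f = f" if "f \<in> carrier (cind G T J V)" for f
    using postcomp_inverse[OF that, of "\<lambda>x. x" "\<lambda>x\<in>carrier V. x"]
    by (simp add: postcomp_def cong: restrict_cong)
  then show ?case
    by (intro extensionalityI[of _ "carrier (cind G T J V)"])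
      (auto simp: rep_End_simps cind_map_eq, auto simp: cind_map_def)
qed

text \<open>The value \<phi> v is read off at \<one> from the image of
  \<open>point v\<close>.\<close>

lemma inj_on_cind_map: "inj_on (cind_map G T J V) (carrier (rep_End C (subgrp G J) V))"
proof (rule inj_onI)
  fix \<phi> \<psi>
  assume *: "\<phi> \<in> carrier (rep_End C (subgrp G J) V)" "\<psi> \<in> carrier (rep_End C (subgrp G J) V)"
    "cind_map G T J V \<phi> = cind_map G T J V \<psi>"
  have "\<phi> v = \<psi> v" if "v \<in> carrier V" for v
    using * postcomp_point[OF _ that] cind_map_eq[OF point_closed[OF that]]
    by (metis IntE rep_End_simps(1))
  then show "\<phi> = \<psi>"
    using * by (intro extensionalityI[of _ "carrier V"]) (auto simp: rep_End_simps)
qed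

text \<open>The ring laws and injectivity hold for every V, so intertwining amounts to surjectivity.
  Restriction to the carrier translates between plain and extensional morphisms.\<close>

lemma cind_map_ring_iso_iff:
  "cind_map G T J V \<in> ring_iso (rep_End C (subgrp G J) V) (rep_End C G (cind G T J V)) \<longleftrightarrow>
    endomorphisms_induced C G T J V" (is "?iso \<longleftrightarrow> ?ind")
proof
  assume iso: ?iso
  show ?ind
    unfolding endomorphisms_induced_def
  proof
    fix \<psi> assume \<psi>: "\<psi> \<in> rep_hom C G (cind G T J V) (cind G T J V)"
    have "restrict \<psi> (carrier (cind G T J V)) \<in> rep_hom C G (cind G T J V) (cind G T J V)"
      by (rule rep_hom_cong[OF _ smooth_cind \<psi>]) simp
    then have "restrict \<psi> (carrier (cind G T J V)) \<in> carrier (rep_End C G (cind G T J V))"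
      by (simp add: rep_End_simps)
    then obtain \<phi> where \<phi>: "\<phi> \<in> carrier (rep_End C (subgrp G J) V)"
      "restrict \<psi> (carrier (cind G T J V)) = cind_map G T J V \<phi>"
      using iso by (force simp: ring_iso_def bij_betw_def)
    have "\<psi> f = postcomp G \<phi> f" if "f \<in> carrier (cind G T J V)" for f
      using fun_cong[OF \<phi>(2), of f] that by (simp add: cind_map_eq)
    then show "\<exists>\<phi>\<in>rep_hom C (subgrp G J) V V. \<forall>f\<in>carrier (cind G T J V). \<psi> f = postcomp G \<phi> f"
      using \<phi>(1) by (auto simp: rep_End_simps)
  qed
next
  assume ind: ?ind
  have "\<psi> \<in> cind_map G T J V ` carrier (rep_End C (subgrp G J) V)"
    if "\<psi> \<in> carrier (rep_End C G (cind G T J V))" for \<psi>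
  proof -
    have \<psi>: "\<psi> \<in> rep_hom C G (cind G T J V) (cind G T J V)"
      "\<psi> \<in> extensional (carrier (cind G T J V))" using that by (auto simp: rep_End_simps)
    then obtain \<phi> where \<phi>: "\<phi> \<in> rep_hom C (subgrp G J) V V"
      "\<forall>f\<in>carrier (cind G T J V). \<psi> f = postcomp G \<phi> f"
      using ind unfolding endomorphisms_induced_def by blast
    let ?\<phi> = "restrict \<phi> (carrier V)"
    have "?\<phi> \<in> carrier (rep_End C (subgrp G J) V)"
      using rep_hom_cong[OF _ V.smooth \<phi>(1), of ?\<phi>] by (simp add: rep_End_simps)
    moreover have "postcomp G ?\<phi> f = postcomp G \<phi> f" if "f \<in> carrier (cind G T J V)" for f
      unfolding postcomp_def by (rule restrict_ext) (simp add: cind_closed[OF that])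
    then have "\<psi> = cind_map G T J V ?\<phi>"
      using \<psi>(2) \<phi>(2)
      by (intro extensionalityI[of _ "carrier (cind G T J V)"])
        (auto simp: cind_map_eq, auto simp: cind_map_def)
    ultimately show ?thesis by blast
  qed
  then have "cind_map G T J V ` carrier (rep_End C (subgrp G J) V) =
      carrier (rep_End C G (cind G T J V))"
    using ring_hom_closed[OF cind_map_ring_hom] by blast
  then show ?iso
    using cind_map_ring_hom inj_on_cind_map by (simp add: ring_iso_def bij_betw_def)
qed

end

lemma rep_hom_conjugate:
  assumes V: "smooth_rep C G T V"
    and a: "a \<in> rep_hom C G V W" "bij_betw a (carrier V) (carrier W)"
    and \<psi>: "\<psi> \<in> rep_hom C G V V"
  shows "a \<circ> \<psi> \<circ> inv_into (carrier V) a \<in> rep_hom C G W W"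
  using rep_hom_compose[OF rep_hom_compose[OF a(1) \<psi>] rep_hom_inv_into[OF V a]] .

text \<open>Conjugation by \<open>postcomp G \<alpha>\<close> moves \<psi> to the W side, where it
  is induced by some \<phi>; conjugating \<phi> back by \<alpha> gives the endomorphism of
  V.\<close>

lemma (in topological_group) endomorphisms_induced_iso:
  assumes J: "J \<subseteq> carrier G"
    and V: "smooth_rep C (subgrp G J) T1 V" and W: "smooth_rep C (subgrp G J) T2 W"
    and iso: "rep_iso C (subgrp G J) V W"
    and IV: "smooth_rep C G T (cind G T J V)"
    and ind: "endomorphisms_induced C G T J W"
  shows "endomorphisms_induced C G T J V"
  unfolding endomorphisms_induced_def
proof
  let ?V = "cind G T J V" and ?W = "cind G T J W"
  fix \<psi> assume \<psi>: "\<psi> \<in> rep_hom C G ?V ?V"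
  obtain \<alpha> where \<alpha>: "\<alpha> \<in> rep_hom C (subgrp G J) V W" "bij_betw \<alpha> (carrier V) (carrier W)"
    using iso by (auto simp: rep_iso_def)
  have 0: "\<alpha> \<zero>\<^bsub>V\<^esub> = \<zero>\<^bsub>W\<^esub>"
    using rep_hom_zero[OF \<alpha>(1)] V W by (simp add: smooth_rep_def)
  let ?a = "postcomp G \<alpha>" and ?\<beta> = "inv_into (carrier V) \<alpha>"
  have a: "?a \<in> rep_hom C G ?V ?W" "bij_betw ?a (carrier ?V) (carrier ?W)"
    using postcomp_rep_hom[OF J \<alpha>(1) 0] postcomp_bij[OF J V \<alpha> 0] by blast+
  obtain \<phi> where \<phi>: "\<phi> \<in> rep_hom C (subgrp G J) W W"
    "\<forall>f\<in>carrier ?W. (?a \<circ> \<psi> \<circ> inv_into (carrier ?V) ?a) f = postcomp G \<phi> f"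
    using rep_hom_conjugate[OF IV a \<psi>] ind unfolding endomorphisms_induced_def by blast
  have \<beta>: "?\<beta> \<in> rep_hom C (subgrp G J) W V" by (rule rep_hom_inv_into[OF V \<alpha>])
  have inv: "?\<beta> (\<alpha> x) = x" if "x \<in> carrier V" for x
    using \<alpha>(2) that by (simp add: bij_betw_inv_into_left)
  have "\<psi> f = postcomp G (?\<beta> \<circ> \<phi> \<circ> \<alpha>) f" if f: "f \<in> carrier ?V" for f
  proof -
    have "?a (\<psi> f) = postcomp G \<phi> (?a f)"
      using \<phi>(2) rep_hom_closed[OF a(1) f] f a(2) by (force simp: bij_betw_inv_into_left)
    moreover have "postcomp G ?\<beta> (?a (\<psi> f)) = \<psi> f"
      by (rule postcomp_inverse[OF rep_hom_closed[OF \<psi> f]]) (rule inv)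
    ultimately show ?thesis by (simp add: postcomp_def cong: restrict_cong)
  qed
  then show "\<exists>\<phi>\<in>rep_hom C (subgrp G J) V V. \<forall>f\<in>carrier ?V. \<psi> f = postcomp G \<phi> f"
    using rep_hom_compose[OF rep_hom_compose[OF \<beta> \<phi>(1)] \<alpha>(1)] by blast
qed

section \<open>Transitivity of compact induction\<close>

text \<open>Transitivity is set up for an arbitrary open J' above J; the normalizer is substituted
  for J' afterwards.\<close>

locale nested_induction = locally_profinite_group G T + compact_induction G T J C V
  for G :: "'g monoid" (structure) and T and J and C :: "'c ring" and V :: "('c, 'g, 'v) rep" +
  fixes J'
  assumes open_subgroup': "open_subgroup G T J'" and subset': "J \<subseteq> J'"
begin

sublocale J': subgroup J' G
  using open_subgroup' by (simp add: open_subgroup_def)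

abbreviation T' where "T' \<equiv> subtopology T J'"

abbreviation V' where "V' \<equiv> cind (subgrp G J') T' J V"

sublocale sub: locally_profinite_group "subgrp G J'" T'
  by (rule locally_profinite_group_subgrp[OF open_subgroup'])

lemma subgrp_subgrp: "subgrp (subgrp G J') J = subgrp G J"
  by simp

lemma subtopology_T': "subtopology T' J = subtopology T J"
  using subset' by (simp add: subtopology_subtopology Int_absorb1)

text \<open>\<open>inner\<close> is induction from J to J'; \<open>outer\<close> induces its result
  V' from J' to G.\<close>

sublocale inner: compact_induction "subgrp G J'" T' J C V
proof -
  have "smooth_representation C (subgrp (subgrp G J') J) (subtopology T' J) V"
    using V.smooth_representation_axioms by (simp only: subgrp_subgrp subtopology_T')
  moreover have "open_subgroup (subgrp G J') T' J"
    using open_subgroup_subgrp_iff[OF open_subgroup'] open_subgroup subset' by blast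
  ultimately show "compact_induction (subgrp G J') T' J C V"
    by (intro compact_induction.intro compact_induction_axioms.intro sub.topological_group_axioms)
qed

sublocale outer: compact_induction G T J' C V'
  by (intro compact_induction.intro compact_induction_axioms.intro topological_group_axioms
      smooth_representation.intro inner.smooth_cind open_subgroup')

text \<open>If j l lies in J' with j in J, then l lies in J'. So the compact set L may be cut down
  to its intersection with J', which is compact because the open subgroup J' is closed.\<close>

lemma restrict_closed:
  assumes f: "f \<in> carrier (cind G T J V)"
  shows "restrict f J' \<in> carrier V'"
proof -
  obtain K where K: "open_subgroup G T K" "\<forall>g\<in>carrier G. \<forall>k\<in>K. f (g \<otimes> k) = f g"
    using cind_smooth[OF f] by blast
  obtain L where L: "compactin T L" "{g \<in> carrier G. f g \<noteq> \<zero>\<^bsub>V\<^esub>} \<subseteq> J <#> L"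
    using cind_support[OF f] unfolding compact_mod_def by blast
  have "g \<in> J <#> (J' \<inter> L)" if g: "g \<in> J'" "f g \<noteq> \<zero>\<^bsub>V\<^esub>" for g
  proof -
    have "g \<in> J <#> L" using g L(2) J'.mem_carrier by blast
    then obtain j l where jl: "j \<in> J" "l \<in> L" "g = j \<otimes> l"
      unfolding set_mult_def by blast
    moreover have "l \<in> carrier G"
      using jl(2) L(1) compactin_subset_topspace topspace_eq by blast
    moreover have "j \<in> J'" using jl(1) subset' by blast
    ultimately have "l \<in> J'" using outer.mult_mem_iff g(1) by blast
    then show ?thesis using jl by (auto simp: set_mult_def)
  qed
  then have "{g \<in> carrier (subgrp G J'). restrict f J' g \<noteq> \<zero>\<^bsub>V\<^esub>} \<subseteq> J <#>\<^bsub>subgrp G J'\<^esub> (J' \<inter> L)"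
    by (auto simp: set_mult_def)
  moreover have "compactin T' (J' \<inter> L)"
    using L(1) open_subgroup_closedin[OF open_subgroup']
    by (simp add: compactin_subtopology closed_Int_compactin)
  ultimately have "compact_mod (subgrp G J') T' J {g \<in> carrier (subgrp G J'). restrict f J' g \<noteq> \<zero>\<^bsub>V\<^esub>}"
    unfolding compact_mod_def by blast
  moreover have "open_subgroup (subgrp G J') T' (K \<inter> J')"
    using open_subgroup_subgrp_iff[OF open_subgroup'] open_subgroup_Int K(1) open_subgroup' by blast
  ultimately show ?thesis
    using K(2) subset'
    by (intro cindI[of _ _ _ _ _ "K \<inter> J'"])
      (auto simp: cind_closed[OF f] cind_equivariant[OF f] subset_iff)
qed

section \<open>The isomorphism of transitivity and its inverse\<close>

definition slices where
  "slices f = (\<lambda>g\<in>carrier G. \<lambda>j\<in>J'. f (j \<otimes> g))"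

text \<open>Inverse to \<open>slices\<close>, because equivariance under J' gives F (j g) \<one> = F
  g j.\<close>

definition unslice where
  "unslice F = (\<lambda>g\<in>carrier G. F g \<one>)"

text \<open>The slice at g is the restriction to J' of the right translate of f by g.\<close>

lemma slice_closed:
  assumes "f \<in> carrier (cind G T J V)" "g \<in> carrier G"
  shows "(\<lambda>j\<in>J'. f (j \<otimes> g)) \<in> carrier V'"
proof -
  have "(\<lambda>j\<in>J'. f (j \<otimes> g)) = restrict (act (cind G T J V) g f) J'"
    by (rule restrict_ext) (simp add: cind_simps)
  then show ?thesis using restrict_closed[OF cind_act_closed[OF assms]] by simp
qed

lemma slices_closed:
  assumes f: "f \<in> carrier (cind G T J V)"
  shows "slices f \<in> carrier (cind G T J' V')"
proof -
  obtain K where K: "open_subgroup G T K" "\<forall>g\<in>carrier G. \<forall>k\<in>K. f (g \<otimes> k) = f g"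
    using cind_smooth[OF f] by blast
  obtain L where L: "compactin T L" "{g \<in> carrier G. f g \<noteq> \<zero>\<^bsub>V\<^esub>} \<subseteq> J <#> L"
    using cind_support[OF f] unfolding compact_mod_def by blast
  \<comment> \<open>The same compact L serves: if f (j' g) is nonzero for some j' in J', then g lies
    in j'^-1 J L, inside J' L.\<close>
  have "g \<in> J' <#> L" if g: "g \<in> carrier G" "slices f g \<noteq> \<zero>\<^bsub>V'\<^esub>" for g
  proof -
    have "\<exists>j\<in>J'. f (j \<otimes> g) \<noteq> \<zero>\<^bsub>V\<^esub>"
    proof (rule ccontr)
      assume "\<not> ?thesis"
      then have "slices f g = \<zero>\<^bsub>V'\<^esub>"
        using g(1) unfolding slices_def cind_simps by (auto intro!: restrict_ext)
      then show False using g(2) by blast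
    qed
    then obtain j' where j': "j' \<in> J'" "f (j' \<otimes> g) \<noteq> \<zero>\<^bsub>V\<^esub>" by blast
    moreover have "j' \<otimes> g \<in> carrier G" using j'(1) g(1) by simp
    ultimately have "j' \<otimes> g \<in> J <#> L" using L(2) by blast
    then obtain j l where jl: "j \<in> J" "l \<in> L" "j' \<otimes> g = j \<otimes> l"
      unfolding set_mult_def by blast
    have "l \<in> carrier G"
      using jl(2) L(1) compactin_subset_topspace topspace_eq by blast
    then have "g = inv j' \<otimes> j \<otimes> l"
      using jl j'(1) g(1) inv_mult_cancel(1)[of j' g] by (simp add: m_assoc)
    moreover have "inv j' \<otimes> j \<in> J'" using jl(1) j'(1) subset' by blast
    ultimately show ?thesis using jl(2) unfolding set_mult_def by blast
  qed
  then have "compact_mod G T J' {g \<in> carrier G. slices f g \<noteq> \<zero>\<^bsub>V'\<^esub>}"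
    unfolding compact_mod_def using L(1) by blast
  moreover have "slices f (j \<otimes> g) = act V' j (slices f g)" if "j \<in> J'" "g \<in> carrier G" for j g
    using that unfolding slices_def cind_simps by (auto simp: m_assoc intro!: restrict_ext)
  moreover have "slices f (g \<otimes> k) = slices f g" if "g \<in> carrier G" "k \<in> K" for g k
  proof -
    have k: "k \<in> carrier G" using that(2) open_subgroup_subset[OF K(1)] by blast
    have "f (j \<otimes> (g \<otimes> k)) = f (j \<otimes> g)" if "j \<in> J'" for j
      using K(2) \<open>k \<in> K\<close> \<open>g \<in> carrier G\<close> k that by (simp flip: m_assoc)
    then show ?thesis using that(1) k by (auto simp: slices_def intro!: restrict_ext)
  qed
  moreover have "slices f g \<in> carrier V'" if "g \<in> carrier G" for g
    using slice_closed[OF f that] that by (simp add: slices_def)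
  moreover have "slices f \<in> extensional (carrier G)" by (simp add: slices_def)
  ultimately show ?thesis using K(1) by - (rule cindI[of _ _ _ _ _ K]; blast)
qed

text \<open>The support of \<open>F\<close> is covered by finitely many double cosets \<open>J' p L\<close> with \<open>L\<close> compact open fixing
  \<open>F\<close>, and on each of them the support of \<open>unslice F\<close> is controlled by that of the single function \<open>F p\<close>.\<close>

lemma unslice_closed:
  assumes F: "F \<in> carrier (cind G T J' V')"
  shows "unslice F \<in> carrier (cind G T J V)"
proof -
  have Fg: "F g \<in> carrier V'" if "g \<in> carrier G" for g
    using cind_closed[OF F that] .
  have F1: "F (j \<otimes> g) \<one> = F g j" if "j \<in> J'" "g \<in> carrier G" for j g
    using that by (simp add: cind_equivariant[OF F] cind_simps)
  obtain K where K: "open_subgroup G T K" "\<forall>g\<in>carrier G. \<forall>k\<in>K. F (g \<otimes> k) = F g"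
    using cind_smooth[OF F] by blast
  obtain L where L: "open_subgroup G T L" "compactin T L" "L \<subseteq> K"
    using compact_open_subgroup_exists[OF K(1)] by blast
  obtain P where P: "compactin T P" "{g \<in> carrier G. F g \<noteq> \<zero>\<^bsub>V'\<^esub>} \<subseteq> J' <#> P"
    using cind_support[OF F] unfolding compact_mod_def by blast
  have P_sub: "P \<subseteq> carrier G"
    using P(1) compactin_subset_topspace topspace_eq by blast
  interpret L: subgroup L G using L(1) by (simp add: open_subgroup_def)
  \<comment> \<open>\<open>?U p\<close> is the open coset pL, on which F is constant because L lies
    in K. Compactness of P leaves finitely many of them.\<close>
  let ?U = "\<lambda>p. {x \<in> carrier G. inv p \<otimes> x \<otimes> \<one> \<in> L}"
  have "openin T U" if "U \<in> ?U ` P" for U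
    using that P_sub L(1) openin_translate by (auto simp: open_subgroup_def)
  moreover have "P \<subseteq> \<Union>(?U ` P)"
  proof
    fix p assume "p \<in> P"
    then have "p \<in> ?U p" using P_sub by auto
    then show "p \<in> \<Union>(?U ` P)" using \<open>p \<in> P\<close> by blast
  qed
  ultimately obtain \<F> where \<F>: "finite \<F>" "\<F> \<subseteq> ?U ` P" "P \<subseteq> \<Union>\<F>"
    using P(1) unfolding compactin_def by meson
  then obtain S where S: "S \<subseteq> P" "finite S" "P \<subseteq> \<Union>(?U ` S)"
    using finite_subset_image[OF \<F>(1,2)] by blast
  have "\<exists>M. compactin T M \<and> {j \<in> J'. F p j \<noteq> \<zero>\<^bsub>V\<^esub>} \<subseteq> J <#> M" if "p \<in> P" for p
  proof -
    have "compact_mod (subgrp G J') T' J {g \<in> carrier (subgrp G J'). F p g \<noteq> \<zero>\<^bsub>V\<^esub>}"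
      using Fg P_sub that by (intro cind_support) auto
    then obtain M where "compactin T' M"
      "{g \<in> carrier (subgrp G J'). F p g \<noteq> \<zero>\<^bsub>V\<^esub>} \<subseteq> J <#>\<^bsub>subgrp G J'\<^esub> M"
      unfolding compact_mod_def by blast
    then have "compactin T M \<and> {j \<in> J'. F p j \<noteq> \<zero>\<^bsub>V\<^esub>} \<subseteq> J <#> M"
      by (simp add: compactin_subtopology set_mult_def)
    then show ?thesis by blast
  qed
  then obtain M where M: "\<And>p. p \<in> P \<Longrightarrow> compactin T (M p)"
    "\<And>p. p \<in> P \<Longrightarrow> {j \<in> J'. F p j \<noteq> \<zero>\<^bsub>V\<^esub>} \<subseteq> J <#> M p" by metis
  \<comment> \<open>For p in S, the part of the support inside J' p L lies in J times
    \<open>M p\<close> p L, since \<open>M p\<close> covers the support of F p modulo J. Taking L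
    compact, not merely open, makes Q compact.\<close>
  define Q where "Q = \<Union>((\<lambda>p. M p <#> ({p} <#> L)) ` S)"
  have "compactin T Q"
    unfolding Q_def using S(1,2) P_sub M(1) L(2)
    by (intro compactin_Union) (auto intro!: compactin_set_mult simp: topspace_eq)
  moreover have "g \<in> J <#> Q" if g: "g \<in> carrier G" "F g \<one> \<noteq> \<zero>\<^bsub>V\<^esub>" for g
  proof -
    have "F g \<noteq> \<zero>\<^bsub>V'\<^esub>" using g(2) by (auto simp: cind_simps)
    then have "g \<in> J' <#> P" using g(1) P(2) by blast
    then obtain j' p' where p': "j' \<in> J'" "p' \<in> P" "g = j' \<otimes> p'"
      unfolding set_mult_def by blast
    then obtain p where p: "p \<in> S" "p' \<in> ?U p" using S(3) by blast
    have pG: "p \<in> P" "p \<in> carrier G" "p' \<in> carrier G" using p p' S(1) P_sub by auto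
    \<comment> \<open>Since p' = p l with l in L, one gets F g \<one> = F p' j' = F p j', and only
      the single function F p is left to control.\<close>
    define l where "l = inv p \<otimes> p'"
    have l: "l \<in> L" "p' = p \<otimes> l" using p(2) pG by (simp_all add: l_def)
    have "F g \<one> = F p j'"
      using F1[OF p'(1) pG(3)] p'(3) K(2) L(3) l pG(2) by auto
    then have "j' \<in> J <#> M p" using M(2)[OF pG(1)] g(2) p'(1) by auto
    then obtain j m where jm: "j \<in> J" "m \<in> M p" "j' = j \<otimes> m" by (auto simp: set_mult_def)
    have "m \<in> carrier G"
      using jm(2) M(1)[OF pG(1)] compactin_subset_topspace topspace_eq by blast
    then have "g = j \<otimes> (m \<otimes> (p \<otimes> l))"
      using p'(3) l jm pG(2) by (simp add: m_assoc)
    moreover have "m \<otimes> (p \<otimes> l) \<in> Q"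
      unfolding Q_def set_mult_def using jm(2) l(1) p(1) by blast
    ultimately show ?thesis using jm(1) by (auto simp: set_mult_def)
  qed
  ultimately have "compact_mod G T J {g \<in> carrier G. F g \<one> \<noteq> \<zero>\<^bsub>V\<^esub>}"
    unfolding compact_mod_def by blast
  moreover have "{g \<in> carrier G. unslice F g \<noteq> \<zero>\<^bsub>V\<^esub>} = {g \<in> carrier G. F g \<one> \<noteq> \<zero>\<^bsub>V\<^esub>}"
    by (auto simp: unslice_def)
  moreover have "F g \<one> \<in> carrier V" if "g \<in> carrier G" for g
    using cind_closed[OF Fg[OF that], of \<one>] by simp
  moreover have "F (j \<otimes> g) \<one> = act V j (F g \<one>)" if "j \<in> J" "g \<in> carrier G" for j g
    using F1[of j g] cind_equivariant[OF Fg[OF that(2)], of j \<one>] that subset' by auto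
  ultimately show ?thesis
    using K open_subgroup_subset[OF K(1)]
    by (intro cindI[of _ _ _ _ _ K]) (auto simp: unslice_def subset_iff)
qed

lemma slices_bij: "bij_betw slices (carrier (cind G T J V)) (carrier (cind G T J' V'))"
proof (rule bij_betw_byWitness[where f' = unslice])
  show "\<forall>f\<in>carrier (cind G T J V). unslice (slices f) = f"
    by (auto simp: unslice_def slices_def dest!: cind_extensional
        intro!: extensionalityI[of _ "carrier G"])
  show "\<forall>F\<in>carrier (cind G T J' V'). slices (unslice F) = F"
  proof
    fix F assume F: "F \<in> carrier (cind G T J' V')"
    have "slices (unslice F) g = F g" if "g \<in> carrier G" for g
    proof (rule extensionalityI[of _ J'])
      show "F g \<in> extensional J'" using cind_extensional[OF cind_closed[OF F that]] by simp
      fix j assume "j \<in> J'"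
      then show "slices (unslice F) g j = F g j"
        using that by (simp add: slices_def unslice_def cind_equivariant[OF F] cind_simps)
    qed (use that in \<open>simp add: slices_def\<close>)
    moreover have "slices (unslice F) \<in> extensional (carrier G)" by (simp add: slices_def)
    ultimately show "slices (unslice F) = F"
      using cind_extensional[OF F] extensionalityI by blast
  qed
qed (use slices_closed unslice_closed in blast)+

lemma slices_rep_hom: "slices \<in> rep_hom C G (cind G T J V) (cind G T J' V')"
proof (rule rep_homI, goal_cases)
  case (1 f)
  then show ?case by (rule slices_closed)
next
  case (2 f f')
  show ?case unfolding slices_def cind_simps by (intro restrict_ext) (auto intro!: restrict_ext)
next
  case (3 c f)
  show ?case unfolding slices_def cind_simps by (intro restrict_ext) (auto intro!: restrict_ext)
next
  case (4 x f)
  then show ?case unfolding slices_def cind_simps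
    by (intro restrict_ext) (auto simp: m_assoc intro!: restrict_ext)
qed

lemma rep_iso_nested: "rep_iso C G (cind G T J V) (cind G T J' V')"
  using slices_bij slices_rep_hom by (auto simp: rep_iso_def)

text \<open>Under \<open>slices\<close>, composing with \<phi> becomes composing every slice with
  \<phi>, that is, inducing from J' to G the endomorphism
  \<open>postcomp (subgrp G J') \<phi>\<close> of V'.\<close>

lemma endomorphisms_induced_nested:
  assumes "endomorphisms_induced C G T J V"
  shows "endomorphisms_induced C G T J' V'"
  unfolding endomorphisms_induced_def
proof
  let ?I = "cind G T J V" and ?I' = "cind G T J' V'"
  fix \<psi> assume \<psi>: "\<psi> \<in> rep_hom C G ?I' ?I'"
  have inv: "inv_into (carrier ?I) slices \<in> rep_hom C G ?I' ?I"
    by (rule rep_hom_inv_into[OF smooth_cind slices_rep_hom slices_bij])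
  obtain \<phi> where \<phi>: "\<phi> \<in> rep_hom C (subgrp G J) V V"
    "\<forall>f\<in>carrier ?I. (inv_into (carrier ?I) slices \<circ> \<psi> \<circ> slices) f = postcomp G \<phi> f"
    using rep_hom_compose[OF rep_hom_compose[OF inv \<psi>] slices_rep_hom] assms
    unfolding endomorphisms_induced_def by blast
  have "\<psi> F = postcomp G (postcomp (subgrp G J') \<phi>) F" if F: "F \<in> carrier ?I'" for F
  proof -
    obtain f where f: "f \<in> carrier ?I" "F = slices f"
      using F slices_bij by (auto simp: bij_betw_def)
    have "slices (inv_into (carrier ?I) slices (\<psi> F)) = \<psi> F"
      using rep_hom_closed[OF \<psi> F] slices_bij by (simp add: bij_betw_inv_into_right)
    then have "\<psi> F = slices (postcomp G \<phi> f)" using \<phi>(2) f by simp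
    then show ?thesis
      unfolding f(2) by (auto simp: slices_def postcomp_def intro!: restrict_ext)
  qed
  moreover have "postcomp (subgrp G J') \<phi> \<in> rep_hom C (subgrp G J') V' V'"
    using sub.postcomp_rep_hom[of J \<phi> C V V] \<phi>(1) subset' rep_hom_zero_V by simp
  ultimately show "\<exists>\<phi>\<in>rep_hom C (subgrp G J') V' V'. \<forall>F\<in>carrier ?I'. \<psi> F = postcomp G \<phi> F"
    by blast
qed

end

section \<open>The Galois twist\<close>

text \<open>The tensor product in coordinates x \<mapsto> 1 \<otimes> x: a scalar \<sigma>(b)
  crosses the tensor sign as b, which is why the inverse of \<sigma> appears.\<close>

definition scalar_twist :: "'c ring \<Rightarrow> ('c \<Rightarrow> 'c) \<Rightarrow> ('c, 'g, 'v) rep \<Rightarrow> ('c, 'g, 'v) rep" where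
  "scalar_twist C \<sigma> V = V\<lparr>smult := \<lambda>c. smult V (inv_into (carrier C) \<sigma> c)\<rparr>"

lemma scalar_twist_simps [simp]:
  "carrier (scalar_twist C \<sigma> V) = carrier V"
  "\<zero>\<^bsub>scalar_twist C \<sigma> V\<^esub> = \<zero>\<^bsub>V\<^esub>"
  "x \<oplus>\<^bsub>scalar_twist C \<sigma> V\<^esub> y = x \<oplus>\<^bsub>V\<^esub> y"
  "c \<odot>\<^bsub>scalar_twist C \<sigma> V\<^esub> x = inv_into (carrier C) \<sigma> c \<odot>\<^bsub>V\<^esub> x"
  "act (scalar_twist C \<sigma> V) = act V"
  by (simp_all add: scalar_twist_def)

text \<open>Equivariance, invariance and support involve no scalars, so the two constructions
  commute on the nose.\<close>

lemma cind_scalar_twist: "cind G T J (scalar_twist C \<sigma> V) = scalar_twist C \<sigma> (cind G T J V)"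
  by (simp add: cind_def scalar_twist_def)

lemma rep_hom_scalar_twist:
  assumes \<sigma>: "\<sigma> \<in> ring_iso C C" "ring C" and \<phi>: "\<phi> \<in> rep_hom C G V W"
  shows "\<phi> \<in> rep_hom C G (scalar_twist C \<sigma> V) (scalar_twist C \<sigma> W)"
proof -
  have "inv_into (carrier C) \<sigma> c \<in> carrier C" if "c \<in> carrier C" for c
    using ring_iso_memE(1)[OF ring_iso_set_sym[OF \<sigma>(2,1)]] that by blast
  then show ?thesis
    using \<phi> by (intro rep_homI) (simp_all add: rep_hom_closed rep_hom_add rep_hom_smult rep_hom_act)
qed

lemma rep_iso_scalar_twist:
  assumes "\<sigma> \<in> ring_iso C C" "ring C" "rep_iso C G V W"
  shows "rep_iso C G (scalar_twist C \<sigma> V) (scalar_twist C \<sigma> W)"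
  using assms rep_hom_scalar_twist unfolding rep_iso_def by fastforce

lemma smooth_rep_scalar_twist:
  assumes \<sigma>: "\<sigma> \<in> ring_iso C C" and V: "smooth_rep C G T V"
  shows "smooth_rep C G T (scalar_twist C \<sigma> V)"
proof -
  interpret V: smooth_representation C G T V by unfold_locales fact
  note \<tau> = ring_iso_memE[OF ring_iso_set_sym[OF V.R.ring_axioms \<sigma>]]
  \<comment> \<open>The additive structure is untouched, which leaves only the axioms involving
    scalars.\<close>
  have "add_monoid (scalar_twist C \<sigma> V) = add_monoid V" by (simp add: scalar_twist_def)
  then have "abelian_group (scalar_twist C \<sigma> V)"
    using V.M.abelian_group_axioms
    by (simp add: abelian_group_def abelian_group_axioms_def abelian_monoid_def)
  then have "module C (scalar_twist C \<sigma> V)"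
    by (rule moduleI[OF V.R.is_cring])
      (simp_all add: \<tau> V.smult_l_distr V.smult_r_distr V.smult_assoc1)
  then show ?thesis
    using V by (auto simp: smooth_rep_def mod_hom_def \<tau>)
qed

section \<open>The tensor product twist by generators and relations\<close>

locale twisting = smooth_representation C G T V + group: Group.group G
  for C :: "'c ring" and G :: "'g monoid" and T and V :: "('c, 'g, 'v) rep" +
  fixes \<sigma>
  assumes iso: "\<sigma> \<in> ring_iso C C"
begin

definition \<tau> where "\<tau> = inv_into (carrier C) \<sigma>"

lemma \<tau>_hom: "\<tau> \<in> ring_hom C C"
  using ring_iso_set_sym[OF R.ring_axioms iso] by (simp add: ring_iso_def \<tau>_def)

lemma \<sigma>_\<tau> [simp]: "c \<in> carrier C \<Longrightarrow> \<sigma> (\<tau> c) = c"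
  and \<tau>_\<sigma> [simp]: "c \<in> carrier C \<Longrightarrow> \<tau> (\<sigma> c) = c"
  using iso bij_betw_inv_into_left[of \<sigma> "carrier C" "carrier C" c]
    bij_betw_inv_into_right[of \<sigma> "carrier C" "carrier C" c]
  by (simp_all add: \<tau>_def ring_iso_def)

lemma \<sigma>_hom: "\<sigma> \<in> ring_hom C C"
  using iso by (simp add: ring_iso_def)

lemmas \<tau>_simps [simp] = ring_hom_closed[OF \<tau>_hom] ring_hom_mult[OF \<tau>_hom] ring_hom_add[OF \<tau>_hom]
  ring_hom_one[OF \<tau>_hom]
  and \<sigma>_simps [simp] = ring_hom_closed[OF \<sigma>_hom]

abbreviation A where "A \<equiv> twist_free C V"
abbreviation N where "N \<equiv> twist_rel C \<sigma> V"

text \<open>The relators inside \<open>twist_rel\<close>, given a name so that statements about the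
  generated subgroup can be checked on them.\<close>

definition gens where "gens =
     {frag_of (a \<oplus>\<^bsub>C\<^esub> b, x) - frag_of (a, x) - frag_of (b, x) | a b x.
         a \<in> carrier C \<and> b \<in> carrier C \<and> x \<in> carrier V} \<union>
      {frag_of (a, x \<oplus>\<^bsub>V\<^esub> y) - frag_of (a, x) - frag_of (a, y) | a x y.
         a \<in> carrier C \<and> x \<in> carrier V \<and> y \<in> carrier V} \<union>
      {frag_of (a \<otimes>\<^bsub>C\<^esub> \<sigma> b, x) - frag_of (a, b \<odot>\<^bsub>V\<^esub> x) | a b x.
         a \<in> carrier C \<and> b \<in> carrier C \<and> x \<in> carrier V}"

lemma N_eq: "N = generate A gens"
  by (simp add: twist_rel_def gens_def)

lemma A_simps [simp]:
  "u \<in> carrier A \<longleftrightarrow> Poly_Mapping.keys u \<subseteq> carrier C \<times> carrier V"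
  "u \<otimes>\<^bsub>A\<^esub> v = u + v" "\<one>\<^bsub>A\<^esub> = 0"
  by (simp_all add: twist_free_def)

sublocale A: comm_group A
  by (simp add: twist_free_def abelian_free_Abelian_group)

lemma A_diff: "u \<in> carrier A \<Longrightarrow> v \<in> carrier A \<Longrightarrow> u - v \<in> carrier A"
  using keys_diff[of u v] by auto

lemma A_frag_of: "a \<in> carrier C \<Longrightarrow> x \<in> carrier V \<Longrightarrow> frag_of (a, x) \<in> carrier A"
  by simp

lemma inv_A: "u \<in> carrier A \<Longrightarrow> inv\<^bsub>A\<^esub> u = - u"
  by (simp add: twist_free_def)

lemma gens_carrier: "gens \<subseteq> carrier A"
  unfolding gens_def by (intro Un_least subsetI; elim CollectE exE conjE; hypsubst)
    (intro A_diff A_frag_of; simp)+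

lemma N_subgroup: "subgroup N A"
  unfolding N_eq by (rule A.generate_is_subgroup[OF gens_carrier])

lemma N_carrier: "N \<subseteq> carrier A"
  using N_subgroup by (rule subgroup.subset)

lemma N_zero: "0 \<in> N"
  using subgroup.one_closed[OF N_subgroup] by simp

lemma N_add: "u \<in> N \<Longrightarrow> v \<in> N \<Longrightarrow> u + v \<in> N"
  using subgroup.m_closed[OF N_subgroup] by simp

lemma N_minus: "u \<in> N \<Longrightarrow> - u \<in> N"
  using subgroup.m_inv_closed[OF N_subgroup, of u] N_carrier inv_A by (metis subsetD)

lemma N_diff: "u \<in> N \<Longrightarrow> v \<in> N \<Longrightarrow> u - v \<in> N"
  using N_add[OF _ N_minus, of u v] by simp

lemma
  assumes "a \<in> carrier C" "x \<in> carrier V"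
  shows N_add_left: "b \<in> carrier C \<Longrightarrow>
      frag_of (a \<oplus>\<^bsub>C\<^esub> b, x) - frag_of (a, x) - frag_of (b, x) \<in> N"
    and N_add_right: "y \<in> carrier V \<Longrightarrow>
      frag_of (a, x \<oplus>\<^bsub>V\<^esub> y) - frag_of (a, x) - frag_of (a, y) \<in> N"
    and N_smult: "b \<in> carrier C \<Longrightarrow> frag_of (a \<otimes>\<^bsub>C\<^esub> \<sigma> b, x) - frag_of (a, b \<odot>\<^bsub>V\<^esub> x) \<in> N"
  unfolding N_eq using assms by (intro generate.incl; unfold gens_def; blast)+

lemma N_induct [consumes 1, case_names zero gen minus add]:
  assumes "u \<in> N" and "P 0" and "\<And>u. u \<in> gens \<Longrightarrow> P u" and "\<And>u. P u \<Longrightarrow> P (- u)"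
    and "\<And>u v. P u \<Longrightarrow> P v \<Longrightarrow> P (u + v)"
  shows "P u"
  using assms(1) unfolding N_eq
proof induction
  case (inv h)
  then show ?case using assms(3,4) gens_carrier inv_A by (metis subsetD)
qed (use assms in simp_all)

definition cl where "cl u = N #>\<^bsub>A\<^esub> u"

text \<open>The product of A is addition on the whole type, so u and w may be arbitrary and no
  carrier conditions arise.\<close>

lemma mem_cl: "w \<in> cl u \<longleftrightarrow> w - u \<in> N"
  by (auto simp: cl_def r_coset_def algebra_simps) (metis add_diff_cancel_right' diff_add_cancel)

lemma cl_eq_iff: "cl u = cl v \<longleftrightarrow> u - v \<in> N"
proof
  assume "cl u = cl v"
  moreover have "u \<in> cl u" using mem_cl N_zero by simp
  ultimately show "u - v \<in> N" using mem_cl by blast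
next
  assume *: "u - v \<in> N"
  have "w - u \<in> N \<longleftrightarrow> w - v \<in> N" for w
    using N_add[of "w - u" "u - v"] N_diff[of "w - v" "u - v"] * by auto
  then show "cl u = cl v" by (auto simp: mem_cl)
qed

lemma twist_simps:
  "carrier (twist C \<sigma> V) = cl ` carrier A"
  "\<zero>\<^bsub>twist C \<sigma> V\<^esub> = cl 0"
  "U \<oplus>\<^bsub>twist C \<sigma> V\<^esub> W = U <#>\<^bsub>A\<^esub> W"
  "c \<odot>\<^bsub>twist C \<sigma> V\<^esub> U = N <#>\<^bsub>A\<^esub> frag_extend (\<lambda>(a, x). frag_of (c \<otimes>\<^bsub>C\<^esub> a, x)) ` U"
  "act (twist C \<sigma> V) g U = N <#>\<^bsub>A\<^esub> frag_extend (\<lambda>(a, x). frag_of (a, act V g x)) ` U"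
  by (auto simp: twist_def Let_def FactGroup_def RCOSETS_def cl_def r_coset_def)

lemma cl_add: "u \<in> carrier A \<Longrightarrow> v \<in> carrier A \<Longrightarrow> cl u <#>\<^bsub>A\<^esub> cl v = cl (u + v)"
  using normal.rcos_sum[OF A.subgroup_imp_normal[OF N_subgroup], of u v] by (simp add: cl_def)

lemma frag_extend_N:
  assumes gens: "\<And>u. u \<in> gens \<Longrightarrow> frag_extend p u \<in> N" and "u \<in> N"
  shows "frag_extend p u \<in> N"
  using \<open>u \<in> N\<close>
  by (induction rule: N_induct)
    (simp_all add: gens N_zero N_minus N_add frag_extend_minus frag_extend_add)

text \<open>The operations of \<open>twist\<close> take the image of a coset and saturate it. If the
  additive map preserves N, which can be tested on relators, the result is the coset of the image of
  any representative.\<close>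

lemma saturate_frag_extend:
  assumes gens: "\<And>u. u \<in> gens \<Longrightarrow> frag_extend p u \<in> N"
  shows "N <#>\<^bsub>A\<^esub> frag_extend p ` cl u = cl (frag_extend p u)"
proof (intro equalityI subsetI)
  fix w assume "w \<in> N <#>\<^bsub>A\<^esub> frag_extend p ` cl u"
  then obtain n v where nv: "n \<in> N" "v - u \<in> N" "w = n + frag_extend p v"
    by (auto simp: set_mult_def mem_cl)
  have "frag_extend p (v - u) \<in> N" by (rule frag_extend_N[OF gens nv(2)])
  moreover have "w - frag_extend p u = n + frag_extend p (v - u)"
    using nv(3) by (simp add: frag_extend_diff)
  ultimately show "w \<in> cl (frag_extend p u)" using N_add[OF nv(1)] by (simp only: mem_cl)
next
  fix w assume "w \<in> cl (frag_extend p u)"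
  then have "w - frag_extend p u \<in> N" "u \<in> cl u" using N_zero by (simp_all add: mem_cl)
  moreover have "w = (w - frag_extend p u) \<otimes>\<^bsub>A\<^esub> frag_extend p u" by simp
  ultimately show "w \<in> N <#>\<^bsub>A\<^esub> frag_extend p ` cl u"
    unfolding set_mult_def by blast
qed

lemma smult_cl:
  assumes "c \<in> carrier C"
  shows "c \<odot>\<^bsub>twist C \<sigma> V\<^esub> cl u = cl (frag_extend (\<lambda>(a, x). frag_of (c \<otimes>\<^bsub>C\<^esub> a, x)) u)"
  unfolding twist_simps
proof (rule saturate_frag_extend)
  fix u assume "u \<in> gens"
  then show "frag_extend (\<lambda>(a, x). frag_of (c \<otimes>\<^bsub>C\<^esub> a, x)) u \<in> N"
    unfolding gens_def using assms
    by (elim UnE CollectE exE conjE)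
      (simp_all add: frag_extend_diff R.r_distr N_add_left N_add_right N_smult flip: R.m_assoc)
qed

lemma act_cl:
  assumes "g \<in> carrier G"
  shows "act (twist C \<sigma> V) g (cl u) = cl (frag_extend (\<lambda>(a, x). frag_of (a, act V g x)) u)"
  unfolding twist_simps
proof (rule saturate_frag_extend)
  fix u assume "u \<in> gens"
  then show "frag_extend (\<lambda>(a, x). frag_of (a, act V g x)) u \<in> N"
    unfolding gens_def using assms
    by (elim UnE CollectE exE conjE)
      (simp_all add: frag_extend_diff N_add_left N_add_right N_smult)
qed

text \<open>The map (a, x) \<mapsto> \<tau>(a) x is additive in each variable and sends both (a
  \<sigma>(b), x) and (a, b x) to \<tau>(a) b x. Its extension to the free abelian group thus kills
  N and, on cosets, inverts \<open>unit_tensor\<close>.\<close>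

lemma twist_retraction:
  obtains h where "h \<in> hom A (add_monoid V)"
    "\<And>a x. a \<in> carrier C \<Longrightarrow> x \<in> carrier V \<Longrightarrow> h (frag_of (a, x)) = \<tau> a \<odot>\<^bsub>V\<^esub> x"
    "\<And>u. u \<in> N \<Longrightarrow> h u = \<zero>\<^bsub>V\<^esub>"
proof -
  have "(\<lambda>(a, x). \<tau> a \<odot>\<^bsub>V\<^esub> x) ` (carrier C \<times> carrier V) \<subseteq> carrier (add_monoid V)" by auto
  then obtain h where h: "h \<in> hom A (add_monoid V)"
    "\<And>z. z \<in> carrier C \<times> carrier V \<Longrightarrow> h (frag_of z) = (\<lambda>(a, x). \<tau> a \<odot>\<^bsub>V\<^esub> x) z"
    using comm_group.free_Abelian_group_universal[OF M.a_comm_group] unfolding twist_free_def by metis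
  then have frag: "h (frag_of (a, x)) = \<tau> a \<odot>\<^bsub>V\<^esub> x" if "a \<in> carrier C" "x \<in> carrier V" for a x
    using that by simp
  interpret h: group_hom A "add_monoid V" h
    by (intro group_hom.intro group_hom_axioms.intro h(1) A.group_axioms M.a_group)
  have diff: "h (u - v) = h u \<ominus>\<^bsub>V\<^esub> h v" if "u \<in> carrier A" "v \<in> carrier A" for u v
  proof -
    have "h (u - v) \<oplus>\<^bsub>V\<^esub> h v = h u"
      using h.hom_mult[OF A_diff[OF that] that(2)] by simp
    then show ?thesis
      using h.hom_closed[OF A_diff[OF that]] h.hom_closed[OF that(1)] h.hom_closed[OF that(2)]
      by (simp add: M.minus_eq M.a_assoc M.r_neg flip: \<open>_ = h u\<close>)
  qed
  have cancel: "(p \<oplus>\<^bsub>V\<^esub> q) \<ominus>\<^bsub>V\<^esub> p \<ominus>\<^bsub>V\<^esub> q = \<zero>\<^bsub>V\<^esub>" if "p \<in> carrier V" "q \<in> carrier V" for p q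
    using that by (simp add: M.minus_eq M.a_comm[of p q] M.a_assoc M.r_neg)
  have gens0: "h u = \<zero>\<^bsub>V\<^esub>" if "u \<in> gens" for u
    using that unfolding gens_def
  proof (elim UnE CollectE exE conjE, goal_cases)
    case (1 a b x)
    then have "h u = (\<tau> a \<odot>\<^bsub>V\<^esub> x \<oplus>\<^bsub>V\<^esub> \<tau> b \<odot>\<^bsub>V\<^esub> x) \<ominus>\<^bsub>V\<^esub> \<tau> a \<odot>\<^bsub>V\<^esub> x \<ominus>\<^bsub>V\<^esub> \<tau> b \<odot>\<^bsub>V\<^esub> x"
      using A_frag_of by (simp add: diff A_diff frag smult_l_distr del: A_simps)
    then show ?case using 1 cancel by simp
  next
    case (2 a x y)
    then have "h u = (\<tau> a \<odot>\<^bsub>V\<^esub> x \<oplus>\<^bsub>V\<^esub> \<tau> a \<odot>\<^bsub>V\<^esub> y) \<ominus>\<^bsub>V\<^esub> \<tau> a \<odot>\<^bsub>V\<^esub> x \<ominus>\<^bsub>V\<^esub> \<tau> a \<odot>\<^bsub>V\<^esub> y"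
      using A_frag_of by (simp add: diff A_diff frag smult_r_distr del: A_simps)
    then show ?case using 2 cancel by simp
  next
    case (3 a b x)
    then have "h u = (\<tau> a \<otimes>\<^bsub>C\<^esub> b) \<odot>\<^bsub>V\<^esub> x \<ominus>\<^bsub>V\<^esub> \<tau> a \<odot>\<^bsub>V\<^esub> (b \<odot>\<^bsub>V\<^esub> x)"
      using A_frag_of by (simp add: diff A_diff frag del: A_simps)
    then show ?case using 3 by (simp add: smult_assoc1 M.minus_eq M.r_neg)
  qed
  \<comment> \<open>Membership in the carrier is carried through the induction because h is known to
    be additive only there.\<close>
  have "u \<in> carrier A \<and> h u = \<zero>\<^bsub>V\<^esub>" if "u \<in> N" for u
    using that
  proof (induction rule: N_induct)
    case zero
    then show ?case using h.hom_one by simp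
  next
    case (gen u)
    then show ?case using gens0 gens_carrier by blast
  next
    case (minus u)
    then show ?case using h.hom_inv[of u] inv_A[of u] by (metis A.inv_closed M.add.inv_one monoid.select_convs(2) partial_object.select_convs(1))
  next
    case (add u v)
    then show ?case using h.hom_mult[of u v] A.m_closed[of u v] by simp
  qed
  then show thesis using that h(1) frag by blast
qed

definition unit_tensor where "unit_tensor x = cl (frag_of (\<one>\<^bsub>C\<^esub>, x))"

lemma unit_tensor_rep_hom: "unit_tensor \<in> rep_hom C G (scalar_twist C \<sigma> V) (twist C \<sigma> V)"
proof (rule rep_homI, goal_cases)
  case (1 x)
  then show ?case by (simp add: unit_tensor_def twist_simps)
next
  case (2 x y)
  then have "unit_tensor x <#>\<^bsub>A\<^esub> unit_tensor y = cl (frag_of (\<one>\<^bsub>C\<^esub>, x) + frag_of (\<one>\<^bsub>C\<^esub>, y))"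
    unfolding unit_tensor_def by (simp add: cl_add)
  then show ?case
    using 2 N_add_right[of "\<one>\<^bsub>C\<^esub>" x y]
    by (simp add: twist_simps(3)) (simp add: unit_tensor_def cl_eq_iff algebra_simps)
next
  \<comment> \<open>The third relator with a = 1 and b = \<tau>(c) identifies c \<otimes> x with 1
    \<otimes> \<tau>(c) x.\<close>
  case (3 c x)
  then show ?case
    using N_minus[OF N_smult[of "\<one>\<^bsub>C\<^esub>" x "\<tau> c"]]
    by (simp add: unit_tensor_def smult_cl cl_eq_iff \<tau>_def[symmetric])
next
  case (4 g x)
  then show ?case by (simp add: unit_tensor_def act_cl)
qed

text \<open>The relator expressing 0 + 0 = 0 in the second variable is the negative of the generator
  (1, 0).\<close>

lemma unit_tensor_zero: "unit_tensor \<zero>\<^bsub>V\<^esub> = \<zero>\<^bsub>twist C \<sigma> V\<^esub>"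
  using N_minus[OF N_add_right[of "\<one>\<^bsub>C\<^esub>" "\<zero>\<^bsub>V\<^esub>" "\<zero>\<^bsub>V\<^esub>"]]
  by (simp add: unit_tensor_def twist_simps cl_eq_iff)

lemma unit_tensor_bij: "bij_betw unit_tensor (carrier V) (carrier (twist C \<sigma> V))"
proof -
  obtain h where h: "h \<in> hom A (add_monoid V)"
    "\<And>a x. a \<in> carrier C \<Longrightarrow> x \<in> carrier V \<Longrightarrow> h (frag_of (a, x)) = \<tau> a \<odot>\<^bsub>V\<^esub> x"
    "\<And>u. u \<in> N \<Longrightarrow> h u = \<zero>\<^bsub>V\<^esub>"
    by (rule twist_retraction) blast
  have h_add: "h (u + v) = h u \<oplus>\<^bsub>V\<^esub> h v" if "u \<in> carrier A" "v \<in> carrier A" for u v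
    using h(1) that by (simp add: hom_def)
  have h_closed: "h u \<in> carrier V" if "u \<in> carrier A" for u
    using h(1) that by (auto simp: hom_def)
  have inj: "x = y" if "x \<in> carrier V" "y \<in> carrier V" "unit_tensor x = unit_tensor y" for x y
  proof -
    have *: "frag_of (\<one>\<^bsub>C\<^esub>, x) - frag_of (\<one>\<^bsub>C\<^esub>, y) \<in> N"
      using that(3) by (simp add: unit_tensor_def cl_eq_iff)
    have "h (frag_of (\<one>\<^bsub>C\<^esub>, x) - frag_of (\<one>\<^bsub>C\<^esub>, y) + frag_of (\<one>\<^bsub>C\<^esub>, y)) = \<zero>\<^bsub>V\<^esub> \<oplus>\<^bsub>V\<^esub> y"
      using h_add[OF subsetD[OF N_carrier *], of "frag_of (\<one>\<^bsub>C\<^esub>, y)"] h(2,3) * that(2) by simp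
    then show ?thesis using that h(2) by simp
  qed
  \<comment> \<open>Every u is congruent to 1 \<otimes> h(u), so each class contains a pure tensor
    with first entry 1.\<close>
  have surj: "u - frag_of (\<one>\<^bsub>C\<^esub>, h u) \<in> N" if u: "u \<in> carrier A" for u
  proof -
    have "Poly_Mapping.keys u \<subseteq> carrier C \<times> carrier V" using u by simp
    then show ?thesis
    proof (rule free_Abelian_group_induct)
      have "h 0 = \<zero>\<^bsub>V\<^esub>" using h(3) N_zero by blast
      then show "0 - frag_of (\<one>\<^bsub>C\<^esub>, h 0) \<in> N"
        using N_add_right[of "\<one>\<^bsub>C\<^esub>" "\<zero>\<^bsub>V\<^esub>" "\<zero>\<^bsub>V\<^esub>"] by simp
    next
      fix z assume "z \<in> carrier C \<times> carrier V"
      then obtain a x where "z = (a, x)" "a \<in> carrier C" "x \<in> carrier V" by blast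
      then show "frag_of z - frag_of (\<one>\<^bsub>C\<^esub>, h (frag_of z)) \<in> N"
        using N_smult[of "\<one>\<^bsub>C\<^esub>" x "\<tau> a"] h(2) by simp
    next
      fix u v :: "('c \<times> 'v) \<Rightarrow>\<^sub>0 int"
      assume "Poly_Mapping.keys u \<subseteq> carrier C \<times> carrier V"
        "Poly_Mapping.keys v \<subseteq> carrier C \<times> carrier V"
      then have uv: "u \<in> carrier A" "v \<in> carrier A" by simp_all
      assume IH: "u - frag_of (\<one>\<^bsub>C\<^esub>, h u) \<in> N" "v - frag_of (\<one>\<^bsub>C\<^esub>, h v) \<in> N"
      \<comment> \<open>Induction on the free abelian group proceeds by differences, while the
        relators speak of sums, so h(u) is written as a sum.\<close>
      have "h u = h (u - v) \<oplus>\<^bsub>V\<^esub> h v" using h_add[OF A_diff[OF uv] uv(2)] by simp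
      then have "frag_of (\<one>\<^bsub>C\<^esub>, h u) - frag_of (\<one>\<^bsub>C\<^esub>, h (u - v)) - frag_of (\<one>\<^bsub>C\<^esub>, h v) \<in> N"
        using N_add_right[of "\<one>\<^bsub>C\<^esub>" "h (u - v)" "h v"] h_closed[OF A_diff[OF uv]] h_closed[OF uv(2)]
        by simp
      from N_add[OF N_diff[OF IH] this]
      show "u - v - frag_of (\<one>\<^bsub>C\<^esub>, h (u - v)) \<in> N" by (simp add: algebra_simps)
    qed
  qed
  have "cl u \<in> unit_tensor ` carrier V" if "u \<in> carrier A" for u
    using surj[OF that] h_closed[OF that] by (auto simp: unit_tensor_def cl_eq_iff)
  moreover have "unit_tensor x \<in> carrier (twist C \<sigma> V)" if "x \<in> carrier V" for x
    using rep_hom_closed[OF unit_tensor_rep_hom] that by simp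
  ultimately show ?thesis
    using inj unfolding bij_betw_def inj_on_def twist_simps(1) by blast
qed

lemma rep_iso_twist: "rep_iso C G (scalar_twist C \<sigma> V) (twist C \<sigma> V)"
  using unit_tensor_rep_hom unit_tensor_bij by (auto simp: rep_iso_def)

lemma smooth_rep_twist: "smooth_rep C G T (twist C \<sigma> V)"
  using smooth_rep_iso[OF group.group_axioms smooth_rep_scalar_twist[OF iso smooth] unit_tensor_rep_hom]
    unit_tensor_bij unit_tensor_zero by simp

end

section \<open>Conjugation of representations\<close>

lemma conj_rep_simps [simp]:
  "carrier (conj_rep G g V) = carrier V"
  "\<zero>\<^bsub>conj_rep G g V\<^esub> = \<zero>\<^bsub>V\<^esub>"
  "x \<oplus>\<^bsub>conj_rep G g V\<^esub> y = x \<oplus>\<^bsub>V\<^esub> y"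
  "c \<odot>\<^bsub>conj_rep G g V\<^esub> x = c \<odot>\<^bsub>V\<^esub> x"
  "act (conj_rep G g V) h = act V (inv\<^bsub>G\<^esub> g \<otimes>\<^bsub>G\<^esub> h \<otimes>\<^bsub>G\<^esub> g)"
  by (simp_all add: conj_rep_def)

context topological_group
begin

lemma rep_iso_conj_rep:
  assumes "J \<subseteq> carrier G" "g \<in> carrier G" "rep_iso C (subgrp G J) V W"
  shows "rep_iso C (subgrp G (conj_set g J)) (conj_rep G g V) (conj_rep G g W)"
proof -
  obtain \<phi> where \<phi>: "\<phi> \<in> rep_hom C (subgrp G J) V W" "bij_betw \<phi> (carrier V) (carrier W)"
    using assms(3) by (auto simp: rep_iso_def)
  have "\<phi> \<in> rep_hom C (subgrp G (conj_set g J)) (conj_rep G g V) (conj_rep G g W)"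
    by (rule rep_homI)
      (simp_all add: rep_hom_closed[OF \<phi>(1)] rep_hom_add[OF \<phi>(1)] rep_hom_smult[OF \<phi>(1)]
        rep_hom_act[OF \<phi>(1)] conj_set_def)
  then show ?thesis using \<phi>(2) by (auto simp: rep_iso_def)
qed

text \<open>Stabilizers for the conjugate are preimages of those for V under x \<mapsto> g^-1 x g,
  hence open.\<close>

lemma smooth_rep_conj_rep:
  assumes J: "open_subgroup G T J" and g: "g \<in> carrier G"
    and V: "smooth_rep C (subgrp G J) (subtopology T J) V"
  shows "smooth_rep C (subgrp G (conj_set g J)) (subtopology T (conj_set g J)) (conj_rep G g V)"
proof -
  interpret compact_induction G T J C V
    by (intro compact_induction.intro compact_induction_axioms.intro topological_group_axioms
        smooth_representation.intro V J)
  have J1: "open_subgroup G T (conj_set g J)" using open_subgroup_conj_set[OF J g] .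
  have "add_monoid (conj_rep G g V) = add_monoid V" by (simp add: conj_rep_def)
  then have "abelian_group (conj_rep G g V)"
    using V.M.abelian_group_axioms
    by (simp add: abelian_group_def abelian_group_axioms_def abelian_monoid_def)
  then have mod: "module C (conj_rep G g V)"
    by (rule moduleI[OF V.R.is_cring])
      (simp_all add: V.smult_l_distr V.smult_r_distr V.smult_assoc1)
  have mult: "act V (inv g \<otimes> (x \<otimes> y) \<otimes> g) v = act V (inv g \<otimes> x \<otimes> g) (act V (inv g \<otimes> y \<otimes> g) v)"
    if "x \<in> conj_set g J" "y \<in> conj_set g J" "v \<in> carrier V" for x y v
  proof -
    have "inv g \<otimes> (x \<otimes> y) \<otimes> g = (inv g \<otimes> x \<otimes> g) \<otimes> (inv g \<otimes> y \<otimes> g)"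
      using that g by (simp add: conj_set_def m_assoc)
    then show ?thesis using that by (simp add: V_act_mult conj_set_def)
  qed
  have "openin (subtopology T (conj_set g J))
    (stabilizer (subgrp G (conj_set g J)) (act (conj_rep G g V)) v)" if v: "v \<in> carrier V" for v
  proof -
    let ?S = "stabilizer (subgrp G J) (act V) v"
    have "openin T ?S"
      using V.openin_stabilizer[OF v] open_subgroup by (simp add: open_subgroup_def openin_open_subtopology)
    then have "openin T {x \<in> carrier G. inv g \<otimes> x \<otimes> g \<in> ?S}"
      using openin_translate g by simp
    moreover have "{x \<in> carrier G. inv g \<otimes> x \<otimes> g \<in> ?S} =
        stabilizer (subgrp G (conj_set g J)) (act (conj_rep G g V)) v"
      by (auto simp: stabilizer_def conj_set_def)
    ultimately show ?thesis
      using J1 by (auto simp: open_subgroup_def openin_open_subtopology stabilizer_def)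
  qed
  then show ?thesis
    using mod mult g
    by (auto simp: smooth_rep_def mod_hom_def conj_set_def V_act_closed V_act_add V_act_smult V_act_one)
qed

text \<open>W is pinned down only by its carrier, its zero and its action on g J g^-1. This lets the
  lemma be used for g with W the conjugate of V, and for g^-1 with the roles exchanged, where
  conjugating twice is compared with V on J alone.\<close>

lemma conj_function_closed:
  assumes J': "open_subgroup G T J'" and J: "subgroup J G" "J \<subseteq> J'" and g: "g \<in> carrier G"
    and W: "carrier W = carrier V" "\<zero>\<^bsub>W\<^esub> = \<zero>\<^bsub>V\<^esub>"
      "\<And>j v. j \<in> conj_set g J \<Longrightarrow> v \<in> carrier V \<Longrightarrow> act W j v = act V (inv g \<otimes> j \<otimes> g) v"
    and f: "f \<in> carrier (cind (subgrp G J') (subtopology T J') J V)"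
  shows "(\<lambda>x\<in>conj_set g J'. f (inv g \<otimes> x \<otimes> g)) \<in>
    carrier (cind (subgrp G (conj_set g J')) (subtopology T (conj_set g J')) (conj_set g J) W)"
    (is "?F \<in> _")
proof -
  let ?J1 = "conj_set g J'"
  have J1: "open_subgroup G T ?J1" using open_subgroup_conj_set[OF J' g] .
  interpret J': subgroup J' G using J' by (simp add: open_subgroup_def)
  interpret J1: subgroup ?J1 G using J1 by (simp add: open_subgroup_def)
  obtain K where K: "open_subgroup (subgrp G J') (subtopology T J') K"
    "\<forall>x\<in>J'. \<forall>k\<in>K. f (x \<otimes> k) = f x"
    using cind_smooth[OF f] by auto
  have KG: "open_subgroup G T K" "K \<subseteq> J'" using K(1) open_subgroup_subgrp_iff[OF J'] by auto
  obtain L where L: "compactin (subtopology T J') L" "{x \<in> J'. f x \<noteq> \<zero>\<^bsub>V\<^esub>} \<subseteq> J <#> L"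
    using cind_support[OF f] unfolding compact_mod_def by (auto simp: set_mult_def)
  have LG: "compactin T L" "L \<subseteq> J'" using L(1) by (auto simp: compactin_subtopology)
  let ?L = "(\<lambda>x. g \<otimes> x \<otimes> inv g) ` L"
  have conj: "inv g \<otimes> (x \<otimes> y) \<otimes> g = (inv g \<otimes> x \<otimes> g) \<otimes> (inv g \<otimes> y \<otimes> g)"
    if "x \<in> carrier G" "y \<in> carrier G" for x y
    using that g by (simp add: m_assoc)
  have JJ1: "conj_set g J \<subseteq> ?J1" by (rule conj_set_mono[OF J(2)])
  show ?thesis
  proof (rule cindI[of _ _ _ _ _ "conj_set g K"])
    show "?F x \<in> carrier W" if "x \<in> carrier (subgrp G ?J1)" for x
    proof -
      have x: "x \<in> ?J1" using that by simp
      then have "f (inv g \<otimes> x \<otimes> g) \<in> carrier V" using cind_closed[OF f] conj_setD(2) by simp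
      then show ?thesis using x W(1) by simp
    qed
    show "?F \<in> extensional (carrier (subgrp G ?J1))" by simp
    show "?F (j \<otimes>\<^bsub>subgrp G ?J1\<^esub> x) = act W j (?F x)"
      if "j \<in> conj_set g J" "x \<in> carrier (subgrp G ?J1)" for j x
    proof -
      have x: "j \<in> ?J1" "x \<in> ?J1" "j \<otimes> x \<in> ?J1" using that JJ1 by auto
      have y: "inv g \<otimes> x \<otimes> g \<in> J'" "inv g \<otimes> j \<otimes> g \<in> J"
        using conj_setD(2)[OF x(2)] conj_setD(2)[OF that(1)] .
      have "f (inv g \<otimes> (j \<otimes> x) \<otimes> g) = act V (inv g \<otimes> j \<otimes> g) (f (inv g \<otimes> x \<otimes> g))"
        using cind_equivariant[OF f y(2), of "inv g \<otimes> x \<otimes> g"] y(1) conj x by simp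
      then show ?thesis using x y W(3)[OF that(1)] cind_closed[OF f] by simp
    qed
    show "open_subgroup (subgrp G ?J1) (subtopology T ?J1) (conj_set g K)"
      using open_subgroup_subgrp_iff[OF J1] open_subgroup_conj_set[OF KG(1) g]
        conj_set_mono[OF KG(2)] by blast
    show "?F (x \<otimes>\<^bsub>subgrp G ?J1\<^esub> k) = ?F x" if "x \<in> carrier (subgrp G ?J1)" "k \<in> conj_set g K" for x k
    proof -
      have k: "k \<in> ?J1" "inv g \<otimes> k \<otimes> g \<in> K"
        using that(2) conj_set_mono[OF KG(2)] conj_setD(2) by blast+
      have x: "x \<in> ?J1" "inv g \<otimes> x \<otimes> g \<in> J'" using that(1) conj_setD(2) by auto
      show ?thesis using x k K(2) conj by simp
    qed
    have "x \<in> conj_set g J <#> ?L" if x: "x \<in> ?J1" "f (inv g \<otimes> x \<otimes> g) \<noteq> \<zero>\<^bsub>V\<^esub>" for x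
    proof -
      have xG: "x \<in> carrier G" using x(1) by simp
      have "inv g \<otimes> x \<otimes> g \<in> J <#> L" using x(2) conj_setD(2)[OF x(1)] L(2) by blast
      then obtain j l where jl: "j \<in> J" "l \<in> L" "inv g \<otimes> x \<otimes> g = j \<otimes> l"
        unfolding set_mult_def by blast
      have G: "j \<in> carrier G" "l \<in> carrier G" using jl J LG(2) J'.subset by blast+
      have "x = g \<otimes> (inv g \<otimes> x \<otimes> g) \<otimes> inv g" using xG g by (simp add: m_assoc)
      also have "\<dots> = (g \<otimes> j \<otimes> inv g) \<otimes> (g \<otimes> l \<otimes> inv g)"
        unfolding jl(3) using G g by (simp add: m_assoc)
      finally have "x = (g \<otimes> j \<otimes> inv g) \<otimes> (g \<otimes> l \<otimes> inv g)" .
      moreover have "g \<otimes> j \<otimes> inv g \<in> conj_set g J"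
        using conj_setI jl(1) G(1) g by blast
      ultimately show ?thesis using jl(2) unfolding set_mult_def by blast
    qed
    then have "{x \<in> carrier (subgrp G ?J1). ?F x \<noteq> \<zero>\<^bsub>W\<^esub>} \<subseteq> conj_set g J <#>\<^bsub>subgrp G ?J1\<^esub> ?L"
      unfolding W(2) by (auto simp: set_mult_def)
    moreover have "compactin (subtopology T ?J1) ?L"
    proof -
      have "g \<otimes> l \<otimes> inv g \<in> ?J1" if "l \<in> L" for l
      proof -
        have "l \<in> J'" "l \<in> carrier G" using that LG(2) J'.subset by blast+
        then show ?thesis using conj_setI g by blast
      qed
      then show ?thesis using compactin_translate[OF LG(1)] g by (auto simp: compactin_subtopology)
    qed
    ultimately show "compact_mod (subgrp G ?J1) (subtopology T ?J1) (conj_set g J)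
        {x \<in> carrier (subgrp G ?J1). ?F x \<noteq> \<zero>\<^bsub>W\<^esub>}"
      unfolding compact_mod_def by blast
  qed
qed

text \<open>Precomposition with x \<mapsto> g^-1 x g is the isomorphism; the same construction for
  g^-1 inverts it.\<close>

lemma rep_iso_conj_cind:
  fixes V :: "('c, 'g, 'v) rep"
  assumes J': "open_subgroup G T J'" and J: "subgroup J G" "J \<subseteq> J'" and g: "g \<in> carrier G"
  shows "rep_iso C (subgrp G (conj_set g J'))
    (conj_rep G g (cind (subgrp G J') (subtopology T J') J V))
    (cind (subgrp G (conj_set g J')) (subtopology T (conj_set g J')) (conj_set g J) (conj_rep G g V))"
    (is "rep_iso _ _ (conj_rep G g ?A) ?B")
proof -
  let ?J1 = "conj_set g J'"
  interpret J': subgroup J' G using J' by (simp add: open_subgroup_def)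
  define \<phi> where "\<phi> f = (\<lambda>x\<in>?J1. f (inv g \<otimes> x \<otimes> g))" for f :: "'g \<Rightarrow> 'v"
  define \<psi> where "\<psi> f = (\<lambda>x\<in>J'. f (g \<otimes> x \<otimes> inv g))" for f :: "'g \<Rightarrow> 'v"
  have \<phi>_closed: "\<phi> f \<in> carrier ?B" if "f \<in> carrier ?A" for f
    unfolding \<phi>_def by (rule conj_function_closed[OF J' J g _ _ _ that]) simp_all
  have J1: "open_subgroup G T ?J1" "subgroup (conj_set g J) G"
    using open_subgroup_conj_set[OF J' g] subgroup_conj_set[OF J(1) g] by blast+
  have JJ1: "conj_set g J \<subseteq> ?J1" by (rule conj_set_mono[OF J(2)])
  have J_sub: "J \<subseteq> carrier G" using J'.subset J(2) by blast
  have \<psi>_closed: "\<psi> F \<in> carrier ?A" if F: "F \<in> carrier ?B" for F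
  proof -
    have act: "act V j v = act (conj_rep G g V) (inv (inv g) \<otimes> j \<otimes> inv g) v"
      if "j \<in> conj_set (inv g) (conj_set g J)" for j v
      using that g J_sub by (simp add: conj_set_inv m_assoc subset_iff)
    have "(\<lambda>x\<in>conj_set (inv g) ?J1. F (inv (inv g) \<otimes> x \<otimes> inv g)) \<in> carrier
      (cind (subgrp G (conj_set (inv g) ?J1)) (subtopology T (conj_set (inv g) ?J1))
        (conj_set (inv g) (conj_set g J)) V)"
      by (rule conj_function_closed[OF J1 JJ1 inv_closed[OF g] _ _ act F]) simp_all
    then show ?thesis
      using g conj_set_inv(1)[OF J_sub g] conj_set_inv(1)[OF J'.subset g] by (simp add: \<psi>_def)
  qed
  have "bij_betw \<phi> (carrier ?A) (carrier ?B)"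
  proof (rule bij_betw_byWitness[where f' = \<psi>])
    show "\<forall>f\<in>carrier ?A. \<psi> (\<phi> f) = f"
    proof
      fix f assume f: "f \<in> carrier ?A"
      have "\<psi> (\<phi> f) x = f x" if "x \<in> J'" for x
        using that g J'.mem_carrier[OF that] by (simp add: \<psi>_def \<phi>_def conj_set_def m_assoc)
      then show "\<psi> (\<phi> f) = f"
        using cind_extensional[OF f] by (intro extensionalityI[of _ J']) (auto simp: \<psi>_def)
    qed
    show "\<forall>F\<in>carrier ?B. \<phi> (\<psi> F) = F"
    proof
      fix F assume F: "F \<in> carrier ?B"
      have "\<phi> (\<psi> F) x = F x" if "x \<in> ?J1" for x
      proof -
        have "g \<otimes> (inv g \<otimes> x \<otimes> g) \<otimes> inv g = x"
          using conj_setD(1)[OF that] g by (simp add: m_assoc)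
        then show ?thesis using that conj_setD(2)[OF that] by (simp add: \<psi>_def \<phi>_def)
      qed
      then show "\<phi> (\<psi> F) = F"
        using cind_extensional[OF F] by (intro extensionalityI[of _ ?J1]) (auto simp: \<phi>_def)
    qed
  qed (use \<phi>_closed \<psi>_closed in blast)+
  moreover have "\<phi> \<in> rep_hom C (subgrp G ?J1) (conj_rep G g ?A) ?B"
  proof (rule rep_homI, goal_cases)
    case (1 f)
    then show ?case using \<phi>_closed by simp
  next
    case (2 f f')
    show ?case unfolding conj_rep_simps cind_simps \<phi>_def
      by (auto simp: conj_set_def intro!: restrict_ext)
  next
    case (3 c f)
    show ?case unfolding conj_rep_simps cind_simps \<phi>_def
      by (auto simp: conj_set_def intro!: restrict_ext)
  next
    case (4 x f)
    have "subgroup ?J1 G" using J1(1) by (simp add: open_subgroup_def)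
    then have "y \<otimes> x \<in> ?J1" if "y \<in> ?J1" for y
      using 4(1) that by (simp add: subgroup.m_closed)
    moreover have "inv g \<otimes> (y \<otimes> x) \<otimes> g = inv g \<otimes> y \<otimes> g \<otimes> (inv g \<otimes> x \<otimes> g)" if "y \<in> ?J1" for y
      using that 4(1) g by (simp add: conj_set_def m_assoc)
    ultimately show ?case unfolding conj_rep_simps cind_simps \<phi>_def
      by (auto simp: conj_set_def intro!: restrict_ext)
  qed
  ultimately show ?thesis by (auto simp: rep_iso_def)
qed

text \<open>The operator of g^-1 is the isomorphism, by g^-1 x v = (g^-1 x g) (g^-1 v).\<close>

lemma rep_iso_conj_inner:
  assumes J: "subgroup J G" and g: "g \<in> J" and V: "smooth_rep C (subgrp G J) T' V"
  shows "rep_iso C (subgrp G J) V (conj_rep G g V)"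
proof -
  interpret J: subgroup J G by fact
  interpret V: smooth_representation C "subgrp G J" T' V by unfold_locales fact
  note act_mult = V.act_mult[simplified] and act_one = V.act_one[simplified]
    and act_closed = V.act_closed[simplified]
  have "act V (inv g) (act V x v) = act V (inv g \<otimes> x \<otimes> g) (act V (inv g) v)"
    if x: "x \<in> J" and v: "v \<in> carrier V" for x v
  proof -
    have "act V (inv g \<otimes> x \<otimes> g) (act V (inv g) v) = act V (inv g \<otimes> x \<otimes> g \<otimes> inv g) v"
      using x v g by (simp add: act_mult)
    also have "inv g \<otimes> x \<otimes> g \<otimes> inv g = inv g \<otimes> x"
      using x g J.mem_carrier by (simp add: m_assoc)
    finally show ?thesis using x v g by (simp add: act_mult)
  qed
  then have "act V (inv g) \<in> rep_hom C (subgrp G J) V (conj_rep G g V)"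
    using g V.act_add V.act_smult by (intro rep_homI) (auto simp: act_closed)
  moreover have "bij_betw (act V (inv g)) (carrier V) (carrier (conj_rep G g V))"
  proof (rule bij_betw_byWitness[where f' = "act V g"])
    show "\<forall>v\<in>carrier V. act V g (act V (inv g) v) = v"
      using g by (simp add: act_one flip: act_mult)
    show "\<forall>v\<in>carrier (conj_rep G g V). act V (inv g) (act V g v) = v"
      using g by (simp add: act_one flip: act_mult)
  qed (use g act_closed in auto)
  ultimately show ?thesis by (auto simp: rep_iso_def)
qed

end

section \<open>Types of normalizers\<close>

context locally_profinite_group
begin

text \<open>V' as an actual representation; the classes in \<open>normalizer_types\<close> consist
  of its smooth copies on \<open>'g \<Rightarrow> 'c\<close>.\<close>

definition normalizer_cind :: "'a set \<Rightarrow> ('c, 'a, 'v) rep \<Rightarrow> ('c, 'a, 'a \<Rightarrow> 'v) rep" where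
  "normalizer_cind J V = cind (subgrp G (normalizer G J)) (subtopology T (normalizer G J)) J V"

abbreviation smooth_on :: "'c ring \<Rightarrow> 'a set \<Rightarrow> ('c, 'a, 'v) rep \<Rightarrow> bool" where
  "smooth_on C J V \<equiv> smooth_rep C (subgrp G J) (subtopology T J) V"

lemma compact_inductionI:
  "open_subgroup G T J \<Longrightarrow> smooth_on C J V \<Longrightarrow> compact_induction G T J C V"
  by (intro compact_induction.intro compact_induction_axioms.intro smooth_representation.intro
      topological_group_axioms)

lemma open_subgroup_normalizer:
  assumes "open_subgroup G T J"
  shows "open_subgroup G T (normalizer G J)" "J \<subseteq> normalizer G J"
proof -
  have J: "subgroup J G" using assms by (simp add: open_subgroup_def)
  show "J \<subseteq> normalizer G J" using subgroup_subset_normalizer[OF J] .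
  moreover have "subgroup (normalizer G J) G"
    using normalizer_imp_subgroup subgroup.subset[OF J] by blast
  ultimately show "open_subgroup G T (normalizer G J)"
    using open_subgroup_superset[OF assms] by blast
qed

lemma nested_inductionI:
  assumes "open_subgroup G T J" "smooth_on C J V"
  shows "nested_induction G T J C V (normalizer G J)"
  using assms open_subgroup_normalizer[OF assms(1)]
  by (intro nested_induction.intro nested_induction_axioms.intro compact_inductionI
      locally_profinite_group_axioms)

lemma
  assumes "open_subgroup G T J" "smooth_on C J V"
  shows smooth_normalizer_cind: "smooth_on C (normalizer G J) (normalizer_cind J V)"
    and rep_iso_normalizer_cind:
      "rep_iso C G (cind G T J V) (cind G T (normalizer G J) (normalizer_cind J V))"
    and endomorphisms_induced_normalizer_cind: "endomorphisms_induced C G T J V \<Longrightarrow>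
      endomorphisms_induced C G T (normalizer G J) (normalizer_cind J V)"
    and irreducible_normalizer_cind: "irreducible_rep C G T (cind G T J V) \<Longrightarrow>
      irreducible_rep C (subgrp G (normalizer G J)) (subtopology T (normalizer G J)) (normalizer_cind J V)"
proof -
  interpret nested_induction G T J C V "normalizer G J" by (rule nested_inductionI[OF assms])
  show "smooth_on C (normalizer G J) (normalizer_cind J V)"
    using inner.smooth_cind by (simp add: normalizer_cind_def)
  show iso: "rep_iso C G (cind G T J V) (cind G T (normalizer G J) (normalizer_cind J V))"
    using rep_iso_nested by (simp add: normalizer_cind_def)
  show "endomorphisms_induced C G T (normalizer G J) (normalizer_cind J V)"
    if "endomorphisms_induced C G T J V"
    using endomorphisms_induced_nested[OF that] by (simp add: normalizer_cind_def)
  have sm: "smooth_rep C G T (cind G T (normalizer G J) (normalizer_cind J V))"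
    using outer.smooth_cind by (simp add: normalizer_cind_def)
  \<comment> \<open>Irreducibility crosses the transitivity isomorphism at the level of G and then
    descends to V'.\<close>
  show "irreducible_rep C (subgrp G (normalizer G J)) (subtopology T (normalizer G J)) (normalizer_cind J V)"
    if "irreducible_rep C G T (cind G T J V)"
    using outer.irreducible_cind_imp irreducible_rep_iso[OF that sm iso]
    by (simp add: normalizer_cind_def)
qed

lemma rep_iso_normalizer_cind_cong:
  assumes "open_subgroup G T J" "smooth_on C J V" "smooth_on C J W" "rep_iso C (subgrp G J) V W"
  shows "rep_iso C (subgrp G (normalizer G J)) (normalizer_cind J V) (normalizer_cind J W)"
proof -
  interpret nested_induction G T J C V "normalizer G J" by (rule nested_inductionI[OF assms(1,2)])
  show ?thesis
    unfolding normalizer_cind_def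
    by (rule sub.rep_iso_cind[of J C "subtopology T J" V "subtopology T J" W])
      (use assms open_subgroup_normalizer(2)[OF assms(1)] in simp_all)
qed

text \<open>The conjugate of V' is induced by the conjugate of V, and functoriality then replaces
  that conjugate by \<open>V\<^sub>1\<close>.\<close>

lemma rep_iso_conj_normalizer_cind:
  assumes J: "open_subgroup G T J" "open_subgroup G T J\<^sub>1" and V: "smooth_on C J V" "smooth_on C J\<^sub>1 V\<^sub>1"
    and g: "g \<in> carrier G" "J\<^sub>1 = g <# J #> inv g"
    and iso: "rep_iso C (subgrp G J\<^sub>1) (conj_rep G g V) V\<^sub>1"
  shows "normalizer G J\<^sub>1 = conj_set g (normalizer G J)"
    and "rep_iso C (subgrp G (normalizer G J\<^sub>1)) (conj_rep G g (normalizer_cind J V)) (normalizer_cind J\<^sub>1 V\<^sub>1)"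
proof -
  have J_sub: "J \<subseteq> carrier G" using open_subgroup_subset J(1) by blast
  have J1: "J\<^sub>1 = conj_set g J" using g conj_coset_eq[OF J_sub g(1)] by simp
  show N: "normalizer G J\<^sub>1 = conj_set g (normalizer G J)"
    unfolding J1 by (rule normalizer_conj_set[OF J_sub g(1)])
  have "rep_iso C (subgrp G (normalizer G J\<^sub>1)) (conj_rep G g (normalizer_cind J V))
      (normalizer_cind J\<^sub>1 (conj_rep G g V))"
    unfolding N normalizer_cind_def J1 normalizer_conj_set[OF J_sub g(1)]
    using open_subgroup_normalizer[OF J(1)] J(1) g(1)
    by (intro rep_iso_conj_cind) (simp_all add: open_subgroup_def)
  moreover have "smooth_on C J\<^sub>1 (conj_rep G g V)"
    unfolding J1 by (rule smooth_rep_conj_rep[OF J(1) g(1) V(1)])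
  ultimately show "rep_iso C (subgrp G (normalizer G J\<^sub>1)) (conj_rep G g (normalizer_cind J V))
      (normalizer_cind J\<^sub>1 V\<^sub>1)"
    using rep_iso_trans rep_iso_normalizer_cind_cong[OF J(2) _ V(2) iso] by blast
qed

lemma twistingI:
  assumes "open_subgroup G T J" "smooth_on C J V" "\<sigma> \<in> ring_iso C C"
  shows "twisting C (subgrp G J) (subtopology T J) V \<sigma>"
  using assms
  by (intro twisting.intro twisting_axioms.intro smooth_representation.intro subgroup_imp_group)
    (simp_all add: open_subgroup_def)

text \<open>The tensor twist is exchanged for \<open>scalar_twist\<close> at both ends of the chain,
  so that the passage through induction in the middle is an equality.\<close>

lemma rep_iso_twist_normalizer_cind:
  assumes J: "open_subgroup G T J" and \<sigma>: "\<sigma> \<in> ring_iso C C"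
    and V: "smooth_on C J V" and U: "smooth_on C J U" "rep_iso C (subgrp G J) (twist C \<sigma> V) U"
    and W: "smooth_on C (normalizer G J) W" "rep_iso C (subgrp G (normalizer G J)) (normalizer_cind J V) W"
  shows "rep_iso C (subgrp G (normalizer G J)) (twist C \<sigma> W) (normalizer_cind J U)"
proof -
  let ?N = "normalizer G J"
  interpret V: twisting C "subgrp G J" "subtopology T J" V \<sigma> by (rule twistingI[OF J V \<sigma>])
  interpret W: twisting C "subgrp G ?N" "subtopology T ?N" W \<sigma>
    by (rule twistingI[OF open_subgroup_normalizer(1)[OF J] W(1) \<sigma>])
  have "rep_iso C (subgrp G ?N) (twist C \<sigma> W) (scalar_twist C \<sigma> W)"
    by (rule rep_iso_sym[OF smooth_rep_scalar_twist[OF \<sigma> W(1)] W.rep_iso_twist])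
  moreover have "rep_iso C (subgrp G ?N) (scalar_twist C \<sigma> W) (scalar_twist C \<sigma> (normalizer_cind J V))"
    by (rule rep_iso_scalar_twist[OF \<sigma> V.R.ring_axioms
          rep_iso_sym[OF smooth_normalizer_cind[OF J V] W(2)]])
  moreover have "scalar_twist C \<sigma> (normalizer_cind J V) = normalizer_cind J (scalar_twist C \<sigma> V)"
    by (simp add: normalizer_cind_def cind_scalar_twist)
  moreover have "rep_iso C (subgrp G ?N) (normalizer_cind J (scalar_twist C \<sigma> V)) (normalizer_cind J U)"
    using rep_iso_trans[OF V.rep_iso_twist U(2)] J U(1) smooth_rep_scalar_twist[OF \<sigma> V]
    by (intro rep_iso_normalizer_cind_cong)
  ultimately show ?thesis using rep_iso_trans by metis
qed

lemma rep_iso_cind_of_normalizer_cind_iso: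
  assumes J: "open_subgroup G T J" and V: "smooth_on C J V"
    and W: "smooth_on C (normalizer G J) W" "rep_iso C (subgrp G (normalizer G J)) (normalizer_cind J V) W"
  shows "rep_iso C G (cind G T J V) (cind G T (normalizer G J) W)"
  using rep_iso_normalizer_cind[OF J V] rep_iso_trans
    rep_iso_cind[OF open_subgroup_subset[OF open_subgroup_normalizer(1)[OF J]]
      smooth_normalizer_cind[OF J V] W]
  by blast

lemma is_type_member:
  assumes "is_type C G T (J, \<V>)" "V \<in> \<V>"
  shows "open_subgroup G T J" "smooth_on C J V" "\<V> = iso_class C (subgrp G J) (subtopology T J) V"
    "irreducible_rep C G T (cind G T J V)"
proof -
  have "irreducible_class C (subgrp G J) (subtopology T J) \<V>"
    using assms(1) by (simp add: is_type_def)
  from irreducible_class_member[OF this assms(2)]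
  show "smooth_on C J V" "\<V> = iso_class C (subgrp G J) (subtopology T J) V"
    by (simp_all add: irreducible_rep_def)
qed (use assms in \<open>simp_all add: is_type_def\<close>)

lemma is_type_nonempty:
  fixes \<V> :: "('c, 'a) urep set"
  assumes "is_type C G T (J, \<V>)"
  obtains V where "V \<in> \<V>"
proof -
  obtain V :: "('c, 'a) urep" where "irreducible_rep C (subgrp G J) (subtopology T J) V"
    "\<V> = iso_class C (subgrp G J) (subtopology T J) V"
    using assms by (auto simp: is_type_def irreducible_class_def)
  then have "V \<in> \<V>" using rep_iso_refl by (auto simp: iso_class_def irreducible_rep_def)
  then show thesis using that by blast
qed

end

lemma unicityD:
  assumes "unicity C G T \<XX>" "(J, \<V>) \<in> \<XX>" "(J\<^sub>1, \<V>\<^sub>1) \<in> \<XX>" "V \<in> \<V>" "V\<^sub>1 \<in> \<V>\<^sub>1"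
    and "rep_iso C G (cind G T J V) (cind G T J\<^sub>1 V\<^sub>1)"
  shows "\<exists>g\<in>carrier G. J\<^sub>1 = g <#\<^bsub>G\<^esub> J #>\<^bsub>G\<^esub> inv\<^bsub>G\<^esub> g \<and>
    rep_iso C (subgrp G J\<^sub>1) (conj_rep G g V) V\<^sub>1"
  using bspec[OF bspec[OF bspec[OF bspec[OF assms(1)[unfolded unicity_def] assms(2), unfolded prod.case]
        assms(3), unfolded prod.case] assms(4)] assms(5)] assms(6) by (rule mp)

section \<open>Passage of the properties to the family of normalizer types\<close>

locale types_family = locally_profinite_group G T
  for G :: "'g monoid" (structure) and T and C :: "'c ring" and \<XX> :: "('c, 'g) tpair set" +
  assumes types: "\<forall>t\<in>\<XX>. is_type C G T t"
begin

abbreviation \<XX>' where "\<XX>' \<equiv> normalizer_types C G T \<XX>"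

lemma normalizer_typesI:
  assumes "(J, \<V>) \<in> \<XX>" "V \<in> \<V>"
  shows "(normalizer G J, iso_class C (subgrp G (normalizer G J)) (subtopology T (normalizer G J))
    (normalizer_cind J V)) \<in> \<XX>'"
  using assms unfolding normalizer_types_def normalizer_cind_def by blast

lemma type_member:
  assumes "(J, \<V>) \<in> \<XX>" "V \<in> \<V>"
  shows "open_subgroup G T J" "smooth_on C J V" "\<V> = iso_class C (subgrp G J) (subtopology T J) V"
    "irreducible_rep C G T (cind G T J V)"
proof -
  have "is_type C G T (J, \<V>)" using types assms(1) by blast
  note is_type_member[OF this assms(2)]
  then show "open_subgroup G T J" "smooth_on C J V"
    "\<V> = iso_class C (subgrp G J) (subtopology T J) V" "irreducible_rep C G T (cind G T J V)" .
qed

lemma normalizer_typesE: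
  assumes "(J', \<V>') \<in> \<XX>'"
  obtains J \<V> V where "(J, \<V>) \<in> \<XX>" "V \<in> \<V>" "J' = normalizer G J"
    "\<And>W. W \<in> \<V>' \<longleftrightarrow> smooth_on C (normalizer G J) W \<and>
      rep_iso C (subgrp G (normalizer G J)) (normalizer_cind J V) W"
    "\<V>' = iso_class C (subgrp G (normalizer G J)) (subtopology T (normalizer G J)) (normalizer_cind J V)"
proof -
  obtain J \<V> V where "(J, \<V>) \<in> \<XX>" "V \<in> \<V>" "J' = normalizer G J"
    "\<V>' = iso_class C (subgrp G (normalizer G J)) (subtopology T (normalizer G J)) (normalizer_cind J V)"
    using assms unfolding normalizer_types_def normalizer_cind_def by blast
  then show thesis using that by (simp add: iso_class_def)
qed

text \<open>Being a type concerns every member W of the class of V'; each induces a representation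
  of G isomorphic to the one induced by V.\<close>

lemma normalizer_types_is_type:
  assumes "t \<in> \<XX>'"
  shows "is_type C G T t"
proof -
  obtain J' \<V>' where t: "t = (J', \<V>')" by (cases t)
  obtain J \<V> V where JV: "(J, \<V>) \<in> \<XX>" "V \<in> \<V>" "J' = normalizer G J"
    and mem: "\<And>W. W \<in> \<V>' \<longleftrightarrow> smooth_on C (normalizer G J) W \<and>
      rep_iso C (subgrp G (normalizer G J)) (normalizer_cind J V) W"
    and \<V>': "\<V>' = iso_class C (subgrp G (normalizer G J)) (subtopology T (normalizer G J)) (normalizer_cind J V)"
    using normalizer_typesE assms t by metis
  note V = type_member[OF JV(1,2)]
  note N = open_subgroup_normalizer[OF V(1)]
  have "irreducible_class C (subgrp G J') (subtopology T J') \<V>'"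
    unfolding \<V>' JV(3)
    using N(1) irreducible_normalizer_cind[OF V(1,2,4)] subgroup_imp_group
    by (intro irreducible_class_iso_class) (auto simp: open_subgroup_def)
  moreover have "irreducible_rep C G T (cind G T J' W)" if "W \<in> \<V>'" for W
  proof -
    have W: "smooth_on C (normalizer G J) W"
      "rep_iso C (subgrp G (normalizer G J)) (normalizer_cind J V) W" using that mem by blast+
    interpret W: compact_induction G T J' C W
      unfolding JV(3) by (rule compact_inductionI[OF N(1) W(1)])
    show ?thesis
      using irreducible_rep_iso[OF V(4) W.smooth_cind]
        rep_iso_cind_of_normalizer_cind_iso[OF V(1,2) W] JV(3) by simp
  qed
  ultimately show ?thesis using N(1) JV(3) by (simp add: is_type_def t)
qed

text \<open>Surjectivity on endomorphisms passes from V to V' by transitivity, and from V' to a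
  member W of its class by invariance under isomorphism.\<close>

lemma intertwining_normalizer_types:
  assumes "intertwining C G T \<XX>"
  shows "intertwining C G T \<XX>'"
  unfolding intertwining_def
proof (clarify)
  fix J' \<V>' W assume J': "(J', \<V>') \<in> \<XX>'" and W: "W \<in> \<V>'"
  obtain J \<V> V where JV: "(J, \<V>) \<in> \<XX>" "V \<in> \<V>" "J' = normalizer G J"
    and mem: "\<And>W. W \<in> \<V>' \<longleftrightarrow> smooth_on C (normalizer G J) W \<and>
      rep_iso C (subgrp G (normalizer G J)) (normalizer_cind J V) W"
    using normalizer_typesE[OF J'] by metis
  note V = type_member[OF JV(1,2)]
  note N = open_subgroup_normalizer[OF V(1)]
  have W: "smooth_on C (normalizer G J) W"
    "rep_iso C (subgrp G (normalizer G J)) (normalizer_cind J V) W" using W mem by blast+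
  interpret V: compact_induction G T J C V by (rule compact_inductionI[OF V(1,2)])
  interpret W: compact_induction G T "normalizer G J" C W by (rule compact_inductionI[OF N(1) W(1)])
  have "endomorphisms_induced C G T J V"
    using assms JV(1,2) V.cind_map_ring_iso_iff unfolding intertwining_def by blast
  then have "endomorphisms_induced C G T (normalizer G J) (normalizer_cind J V)"
    by (rule endomorphisms_induced_normalizer_cind[OF V(1,2)])
  then have "endomorphisms_induced C G T (normalizer G J) W"
    by (rule endomorphisms_induced_iso[OF open_subgroup_subset[OF N(1)] W(1)
          smooth_normalizer_cind[OF V(1,2)] rep_iso_sym[OF smooth_normalizer_cind[OF V(1,2)] W(2)]
          W.smooth_cind])
  then show "cind_map G T J' W \<in>
      ring_iso (rep_End C (subgrp G J') W) (rep_End C G (cind G T J' W))"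
    using W.cind_map_ring_iso_iff JV(3) by simp
qed

text \<open>An isomorphism between the representations induced by W and \<open>W\<^sub>1\<close> is
  one between those induced by V and \<open>V\<^sub>1\<close>. The g obtained for the latter pair
  works for the former, since it carries normalizer to normalizer.\<close>

lemma unicity_normalizer_types:
  assumes "unicity C G T \<XX>"
  shows "unicity C G T \<XX>'"
  unfolding unicity_def
proof (clarify)
  fix J' \<V>' J\<^sub>1' \<V>\<^sub>1' W W\<^sub>1
  assume J': "(J', \<V>') \<in> \<XX>'" "W \<in> \<V>'" and J1': "(J\<^sub>1', \<V>\<^sub>1') \<in> \<XX>'" "W\<^sub>1 \<in> \<V>\<^sub>1'"
    and iso: "rep_iso C G (cind G T J' W) (cind G T J\<^sub>1' W\<^sub>1)"
  obtain J \<V> V where JV: "(J, \<V>) \<in> \<XX>" "V \<in> \<V>" "J' = normalizer G J"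
    and W: "smooth_on C (normalizer G J) W"
      "rep_iso C (subgrp G (normalizer G J)) (normalizer_cind J V) W"
    using normalizer_typesE[OF J'(1)] J'(2) by metis
  obtain J\<^sub>1 \<V>\<^sub>1 V\<^sub>1 where JV1: "(J\<^sub>1, \<V>\<^sub>1) \<in> \<XX>" "V\<^sub>1 \<in> \<V>\<^sub>1" "J\<^sub>1' = normalizer G J\<^sub>1"
    and W1: "smooth_on C (normalizer G J\<^sub>1) W\<^sub>1"
      "rep_iso C (subgrp G (normalizer G J\<^sub>1)) (normalizer_cind J\<^sub>1 V\<^sub>1) W\<^sub>1"
    using normalizer_typesE[OF J1'(1)] J1'(2) by metis
  note V = type_member[OF JV(1,2)] and V1 = type_member[OF JV1(1,2)]
  have I1: "smooth_rep C G T (cind G T J\<^sub>1 V\<^sub>1)" using V1(4) by (simp add: irreducible_rep_def)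
  note iso = iso[unfolded JV(3) JV1(3)]
  have "rep_iso C G (cind G T J V) (cind G T J\<^sub>1 V\<^sub>1)"
    by (rule rep_iso_trans[OF rep_iso_trans[OF rep_iso_cind_of_normalizer_cind_iso[OF V(1,2) W] iso]
          rep_iso_sym[OF I1 rep_iso_cind_of_normalizer_cind_iso[OF V1(1,2) W1]]])
  then obtain g where g: "g \<in> carrier G" "J\<^sub>1 = g <# J #> inv g"
    "rep_iso C (subgrp G J\<^sub>1) (conj_rep G g V) V\<^sub>1"
    using unicityD[OF assms JV(1) JV1(1) JV(2) JV1(2)] by blast
  note conj = rep_iso_conj_normalizer_cind[OF V(1) V1(1) V(2) V1(2) g]
  have N: "normalizer G J \<subseteq> carrier G"
    using open_subgroup_subset[OF open_subgroup_normalizer(1)[OF V(1)]] .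
  have "rep_iso C (subgrp G (normalizer G J\<^sub>1)) (conj_rep G g W) (conj_rep G g (normalizer_cind J V))"
    unfolding conj(1)
    by (rule rep_iso_conj_rep[OF N g(1) rep_iso_sym[OF smooth_normalizer_cind[OF V(1,2)] W(2)]])
  then have "rep_iso C (subgrp G J\<^sub>1') (conj_rep G g W) W\<^sub>1"
    unfolding JV1(3) by (rule rep_iso_trans[OF _ rep_iso_trans[OF conj(2) W1(2)]])
  moreover have "J\<^sub>1' = g <# J' #> inv g"
    using conj(1) JV(3) JV1(3) conj_coset_eq[OF N g(1)] by simp
  ultimately show "\<exists>g\<in>carrier G. J\<^sub>1' = g <# J' #> inv g \<and>
      rep_iso C (subgrp G J\<^sub>1') (conj_rep G g W) W\<^sub>1"
    using g(1) by blast
qed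

lemma iso_class_cind_normalizer_cind:
  assumes "(J, \<V>) \<in> \<XX>" "V \<in> \<V>" "smooth_on C (normalizer G J) W"
    "rep_iso C (subgrp G (normalizer G J)) (normalizer_cind J V) W"
  shows "iso_class C G T (cind G T (normalizer G J) W) = iso_class C G T (cind G T J V)"
proof -
  note V = type_member[OF assms(1,2)]
  have "smooth_rep C G T (cind G T J V)" using V(4) by (simp add: irreducible_rep_def)
  from iso_class_cong[OF this rep_iso_cind_of_normalizer_cind_iso[OF V(1,2) assms(3,4)]]
  show ?thesis by simp
qed

lemma exhaustion_normalizer_types:
  assumes "exhaustion C G T \<ZZ> \<XX>"
  shows "exhaustion C G T \<ZZ> \<XX>'"
proof -
  have in_Z: "iso_class C G T (cind G T J V) \<in> \<ZZ>" if "(J, \<V>) \<in> \<XX>" "V \<in> \<V>" for J \<V> V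
    using assms that unfolding exhaustion_def by blast
  have 1: "iso_class C G T (cind G T J' W) \<in> \<ZZ>" if J': "(J', \<V>') \<in> \<XX>'" and "W \<in> \<V>'" for J' \<V>' W
  proof -
    obtain J \<V> V where JV: "(J, \<V>) \<in> \<XX>" "V \<in> \<V>" "J' = normalizer G J"
      and W: "smooth_on C (normalizer G J) W"
        "rep_iso C (subgrp G (normalizer G J)) (normalizer_cind J V) W"
      using normalizer_typesE[OF J'] \<open>W \<in> \<V>'\<close> by metis
    show ?thesis
      using iso_class_cind_normalizer_cind[OF JV(1,2) W] in_Z[OF JV(1,2)] JV(3) by simp
  qed
  have 2: "\<exists>(J', \<V>')\<in>\<XX>'. \<exists>W\<in>\<V>'. \<W> = iso_class C G T (cind G T J' W)" if Z: "\<W> \<in> \<ZZ>" for \<W>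
  proof -
    obtain J \<V> V where JV: "(J, \<V>) \<in> \<XX>" "V \<in> \<V>" "\<W> = iso_class C G T (cind G T J V)"
      using bspec[OF conjunct2[OF assms[unfolded exhaustion_def]] Z] by auto
    let ?t = "(normalizer G J, iso_class C (subgrp G (normalizer G J))
      (subtopology T (normalizer G J)) (normalizer_cind J V))"
    have t: "?t \<in> \<XX>'" by (rule normalizer_typesI[OF JV(1,2)])
    \<comment> \<open>Exhaustion asks for an actual member of the class of V'; there is one because
      the pair is a type.\<close>
    obtain W where W: "W \<in> snd ?t" using is_type_nonempty normalizer_types_is_type[OF t] by force
    then have sW: "smooth_on C (normalizer G J) W"
      "rep_iso C (subgrp G (normalizer G J)) (normalizer_cind J V) W"
      by (simp_all add: iso_class_def)
    have "\<W> = iso_class C G T (cind G T (normalizer G J) W)"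
      unfolding JV(3) by (rule iso_class_cind_normalizer_cind[OF JV(1,2) sW, symmetric])
    then have "case ?t of (J', \<V>') \<Rightarrow> \<exists>W\<in>\<V>'. \<W> = iso_class C G T (cind G T J' W)"
      using W by auto
    then show ?thesis using t by (rule bexI)
  qed
  show ?thesis
    unfolding exhaustion_def by (rule conjI; clarify) (rule 1, assumption+, rule 2)
qed

text \<open>The twist of V has cosets as vectors and so is not itself a member of its class. A
  member U of the class provided by stability stands in for it, and the twist of W is isomorphic to
  the representation induced by U.\<close>

lemma twist_normalizer_cind_obtains:
  assumes H: "H \<subseteq> ring_iso C C" and stab: "stability C G T H \<XX>"
    and "(J, \<V>) \<in> \<XX>" "V \<in> \<V>" "\<sigma> \<in> H" "smooth_on C (normalizer G J) W"
    "rep_iso C (subgrp G (normalizer G J)) (normalizer_cind J V) W"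
  obtains U where "(J, iso_class C (subgrp G J) (subtopology T J) (twist C \<sigma> V)) \<in> \<XX>"
    "U \<in> iso_class C (subgrp G J) (subtopology T J) (twist C \<sigma> V)"
    "rep_iso C (subgrp G (normalizer G J)) (twist C \<sigma> W) (normalizer_cind J U)"
    "smooth_on C (normalizer G J) (twist C \<sigma> W)"
proof -
  note V = type_member[OF assms(3,4)]
  have \<sigma>: "\<sigma> \<in> ring_iso C C" using H assms(5) by blast
  have X: "(J, iso_class C (subgrp G J) (subtopology T J) (twist C \<sigma> V)) \<in> \<XX>"
    using stab assms(3,4,5) unfolding stability_def by blast
  then obtain U where U: "U \<in> iso_class C (subgrp G J) (subtopology T J) (twist C \<sigma> V)"
    using is_type_nonempty types by blast
  then have "smooth_on C J U" "rep_iso C (subgrp G J) (twist C \<sigma> V) U"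
    by (simp_all add: iso_class_def)
  then have "rep_iso C (subgrp G (normalizer G J)) (twist C \<sigma> W) (normalizer_cind J U)"
    by (rule rep_iso_twist_normalizer_cind[OF V(1) \<sigma> V(2) _ _ assms(6,7)])
  moreover have "smooth_on C (normalizer G J) (twist C \<sigma> W)"
    by (rule twisting.smooth_rep_twist[OF twistingI[OF open_subgroup_normalizer(1)[OF V(1)] assms(6) \<sigma>]])
  ultimately show thesis using that X U by blast
qed

lemma stability_normalizer_types:
  assumes H: "H \<subseteq> ring_iso C C" and stab: "stability C G T H \<XX>"
  shows "stability C G T H \<XX>'"
  unfolding stability_def
proof (clarify)
  fix J' \<V>' W \<sigma> assume J': "(J', \<V>') \<in> \<XX>'" "W \<in> \<V>'" and \<sigma>: "\<sigma> \<in> H"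
  obtain J \<V> V where JV: "(J, \<V>) \<in> \<XX>" "V \<in> \<V>" "J' = normalizer G J"
    and W: "smooth_on C (normalizer G J) W"
      "rep_iso C (subgrp G (normalizer G J)) (normalizer_cind J V) W"
    using normalizer_typesE[OF J'(1)] J'(2) by metis
  obtain U where U: "(J, iso_class C (subgrp G J) (subtopology T J) (twist C \<sigma> V)) \<in> \<XX>"
    "U \<in> iso_class C (subgrp G J) (subtopology T J) (twist C \<sigma> V)"
    "rep_iso C (subgrp G (normalizer G J)) (twist C \<sigma> W) (normalizer_cind J U)"
    "smooth_on C (normalizer G J) (twist C \<sigma> W)"
    using twist_normalizer_cind_obtains[OF H stab JV(1,2) \<sigma> W] by metis
  show "(J', iso_class C (subgrp G J') (subtopology T J') (twist C \<sigma> W)) \<in> \<XX>'"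
    unfolding JV(3) iso_class_cong[OF U(4,3)] by (rule normalizer_typesI[OF U(1,2)])
qed

text \<open>Unicity only makes U a conjugate of V by some g, and as g need not lie in J, V and its
  twist need not be isomorphic. Over J' conjugation by g becomes inner, which is what the passage to
  normalizers achieves.\<close>

lemma twist_unicity_normalizer_types:
  assumes H: "H \<subseteq> ring_iso C C" and stab: "stability C G T H \<XX>" and uni: "unicity C G T \<XX>"
  shows "twist_unicity C G T H \<XX>'"
  unfolding twist_unicity_def
proof (intro conjI stability_normalizer_types[OF H stab], clarify)
  fix J' \<V>' W \<sigma> assume J': "(J', \<V>') \<in> \<XX>'" "W \<in> \<V>'" and \<sigma>: "\<sigma> \<in> H"
    and iso: "rep_iso C G (cind G T J' W) (cind G T J' (twist C \<sigma> W))"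
  obtain J \<V> V where JV: "(J, \<V>) \<in> \<XX>" "V \<in> \<V>" "J' = normalizer G J"
    and W: "smooth_on C (normalizer G J) W"
      "rep_iso C (subgrp G (normalizer G J)) (normalizer_cind J V) W"
    using normalizer_typesE[OF J'(1)] J'(2) by metis
  obtain U where U: "(J, iso_class C (subgrp G J) (subtopology T J) (twist C \<sigma> V)) \<in> \<XX>"
    "U \<in> iso_class C (subgrp G J) (subtopology T J) (twist C \<sigma> V)"
    "rep_iso C (subgrp G (normalizer G J)) (twist C \<sigma> W) (normalizer_cind J U)"
    "smooth_on C (normalizer G J) (twist C \<sigma> W)"
    using twist_normalizer_cind_obtains[OF H stab JV(1,2) \<sigma> W] by metis
  let ?N = "normalizer G J"
  note V = type_member[OF JV(1,2)] and UU = type_member[OF U(1,2)]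
  note N = open_subgroup_normalizer[OF V(1)]
  have iU: "smooth_rep C G T (cind G T J U)" using UU(4) by (simp add: irreducible_rep_def)
  note sV = smooth_normalizer_cind[OF V(1,2)] and sU = smooth_normalizer_cind[OF UU(1,2)]
  have "rep_iso C G (cind G T J V) (cind G T ?N (twist C \<sigma> W))"
    by (rule rep_iso_trans[OF rep_iso_cind_of_normalizer_cind_iso[OF V(1,2) W] iso[unfolded JV(3)]])
  also have "rep_iso C G \<dots> (cind G T ?N (normalizer_cind J U))"
    by (rule rep_iso_cind[OF open_subgroup_subset[OF N(1)] U(4) sU U(3)])
  also have "rep_iso C G \<dots> (cind G T J U)"
    by (rule rep_iso_sym[OF iU rep_iso_normalizer_cind[OF UU(1,2)]])
  finally have "rep_iso C G (cind G T J V) (cind G T J U)" .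
  then obtain g where g: "g \<in> carrier G" "J = g <# J #> inv g"
    "rep_iso C (subgrp G J) (conj_rep G g V) U"
    using unicityD[OF uni JV(1) U(1) JV(2) U(2)] by blast
  have J_sub: "J \<subseteq> carrier G" using open_subgroup_subset[OF V(1)] .
  \<comment> \<open>V and U are representations of the same J, so conjugation by g maps J onto
    itself.\<close>
  have "g \<in> ?N" using g(1,2) mem_normalizer_iff[OF J_sub] conj_coset_eq[OF J_sub g(1)] by simp
  then have conj: "rep_iso C (subgrp G ?N) (normalizer_cind J V) (conj_rep G g (normalizer_cind J V))"
    using rep_iso_conj_inner[OF open_subgroup_subgroup[OF N(1)] _ sV] by blast
  \<comment> \<open>The chain leads from W through V', its conjugate by g and the representation
    induced by U to the twist of W.\<close>
  have "rep_iso C (subgrp G ?N) W (normalizer_cind J V)"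
    by (rule rep_iso_sym[OF sV W(2)])
  also note conj
  also note rep_iso_conj_normalizer_cind(2)[OF V(1) V(1) V(2) UU(2) g]
  also note rep_iso_sym[OF U(4,3)]
  finally show "rep_iso C (subgrp G J') W (twist C \<sigma> W)" by (simp only: JV(3))
qed

end

theorem proposition3p18:
  fixes G :: "'g monoid" and T :: "'g topology" and Z :: "'g set" and C :: "'c ring"
    and \<XX> \<XX>' :: "('c, 'g) tpair set" and \<ZZ> :: "('c, 'g) urep set set" and H :: "('c \<Rightarrow> 'c) set"
  assumes "locally_profinite_group G T"
    and "subgroup Z G" and "closedin T Z"
    and "\<forall>z\<in>Z. \<forall>g\<in>carrier G. z \<otimes>\<^bsub>G\<^esub> g = g \<otimes>\<^bsub>G\<^esub> z"
    and "field C"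
    and "\<forall>t\<in>\<XX>. is_type C G T t"
    and "\<forall>\<W>\<in>\<ZZ>. irreducible_class C G T \<W> \<and> (\<forall>W\<in>\<W>. Z_compact C G T Z W)"
    and "subgroup H (Aut_ring C)"
    and "\<XX>' = normalizer_types C G T \<XX>"
  shows "(\<forall>t\<in>\<XX>'. is_type C G T t) \<and>
    (intertwining C G T \<XX> \<longrightarrow> intertwining C G T \<XX>') \<and>
    (unicity C G T \<XX> \<longrightarrow> unicity C G T \<XX>') \<and>
    (exhaustion C G T \<ZZ> \<XX> \<longrightarrow> exhaustion C G T \<ZZ> \<XX>') \<and>
    (stability C G T H \<XX> \<longrightarrow> stability C G T H \<XX>') \<and>
    (unicity C G T \<XX> \<and> stability C G T H \<XX> \<longrightarrow> twist_unicity C G T H \<XX>')"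
proof -
  interpret types_family G T C \<XX>
    using assms(1,6) by (intro types_family.intro types_family_axioms.intro)
  have H: "H \<subseteq> ring_iso C C"
    using subgroup.subset[OF assms(8)] by (auto simp: Aut_ring_def)
  show ?thesis
    unfolding assms(9)
    using normalizer_types_is_type intertwining_normalizer_types unicity_normalizer_types
      exhaustion_normalizer_types stability_normalizer_types[OF H] twist_unicity_normalizer_types[OF H]
    by blast
qed

end
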